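(* Let $f$ be a weakly reflection positive and multiplicative graph parameter that is not identically zero. Then $f$ belongs to one of the following three types. (1) $\operatorname{rk}(M(f,n))=\infty$ for all $n\ge 2$. (2) There is a real number $c\ge 1$ such that $\operatorname{rk}(M(f,n))^{1/n}\to c$ as $n\to\infty$, and there is a weighted graph $H$ such that $f(F)=\hom(F,H)$ for all multigraphs $F$. (3) There is a real number $c>1$ such that $\operatorname{rk}(M(f,n))^{1/n^2}\to c$ as $n\to\infty$, and there is a proper randomly weighted graph $H$ such that $f(F)=\hom(F,H)$ for all multigraphs $F$.
   Context: A multigraph is a finite undirected graph with at least one node, in which multiple edges are allowed and loops are excluded; for distinct nodes $i,j$ of a multigraph $F$, $F_{i,j}$ denotes the number of edges joining $i$ and $j$. A graph parameter is a real-valued function on multigraphs that is invariant under isomorphism. It is multiplicative if $f(F_1\cup F_2)=f(F_1)f(F_2)$ for all multigraphs $F_1,F_2$, where $F_1\cup F_2$ is the disjoint union. For $n\ge 1$, let $\mathcal{G}_n$ be the set of (isomorphism types of) multigraphs in which $n$ different nodes are labeled $1,\dots,n$, with any number of further unlabeled nodes, and let $\mathcal{F}_n\subset\mathcal{G}_n$ be the set of those with node set exactly $\{1,\dots,n\}$ (no unlabeled nodes). The product $F_1F_2$ of $F_1,F_2\in\mathcal{G}_n$ is obtained by taking their disjoint union and identifying nodes with identical labels, keeping all edges with multiplicity. Let $\mathcal{P}_n$ be the real vector space of formal finite linear combinations of elements of $\mathcal{F}_n$, with the product extended bilinearly, and extend $f$ linearly to $\mathcal{P}_n$ (forgetting labels).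 The parameter $f$ is weakly reflection positive if $f(p^2)\ge 0$ for every $n$ and every $p\in\mathcal{P}_n$. The $n$-th connection matrix $M(f,n)$ is the infinite matrix with rows and columns indexed by $\mathcal{G}_n$ whose entry in row $F_1$ and column $F_2$ is $f(F_1F_2)$; $\operatorname{rk}$ denotes its rank. A weighted graph $H$ is a finite node set $V(H)$ with positive real nodeweights $\alpha_i$ and real edgeweights $\beta_{ij}=\beta_{ji}$ ($i,j\in V(H)$, $i=j$ allowed). A randomly weighted graph $H$ is a finite node set $V(H)$ with nonnegative real nodeweights $\alpha_i$ and with edges $ij$ ($i,j\in V(H)$, $i=j$ allowed) weighted by independent real random variables $B_{i,j}=B_{j,i}$, each taking only finitely many values. An ordinary weighted graph is regarded as a randomly weighted graph in which every $B_{i,j}$ is concentrated on the single value $\beta_{ij}$; a randomly weighted graph is proper if it is not an ordinary weighted graph, i.e. if some $B_{i,j}$ takes at least two values with positive probability. For a randomly weighted graph $H$ and a multigraph $F$, $$\hom(F,H)=\sum_{\varphi:V(F)\to V(H)}\ \prod_{i\in V(F)}\alpha_{\varphi(i)}\prod_{\{i,j\}\subseteq V(F),\,i\ne j}\mathsf{E}\bigl(B_{\varphi(i),\varphi(j)}^{F_{i,j}}\bigr)$$ (with $\mathsf{E}(B^0)=1$). For an ordinary weighted graph this is $\sum_{\varphi}\prod_i\alpha_{\varphi(i)}\prod_{i<j}\beta_{\varphi(i)\varphi(j)}^{F_{i,j}}$ (with $0^0=1$). *)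

theory Defs
  imports "HOL-Probability.Probability" "HOL-Library.Poly_Mapping"
begin

section \<open>Multigraphs and graph parameters\<close>

text \<open>Nodes are natural numbers; every finite multigraph is isomorphic to such a one. The edges are
  a multiset of two-element node sets, so edges are undirected, loops are excluded and
  multiplicities are counted.\<close>

record mgraph =
  nodes :: "nat set"
  edges :: "nat set multiset"

definition multigraph :: "mgraph \<Rightarrow> bool" where
  "multigraph F \<longleftrightarrow> finite (nodes F) \<and> nodes F \<noteq> {} \<and>
     (\<forall>e. e \<in># edges F \<longrightarrow> e \<subseteq> nodes F \<and> card e = 2)"

definition mult :: "mgraph \<Rightarrow> nat \<Rightarrow> nat \<Rightarrow> nat" where
  "mult F i j = count (edges F) {i, j}"

definition rename :: "(nat \<Rightarrow> nat) \<Rightarrow> mgraph \<Rightarrow> mgraph" where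
  "rename h F = \<lparr>nodes = h ` nodes F, edges = image_mset ((`) h) (edges F)\<rparr>"

definition isomorphic :: "mgraph \<Rightarrow> mgraph \<Rightarrow> bool" where
  "isomorphic F G \<longleftrightarrow> (\<exists>h. inj_on h (nodes F) \<and> G = rename h F)"

definition munion :: "mgraph \<Rightarrow> mgraph \<Rightarrow> mgraph" where
  "munion F G = \<lparr>nodes = nodes F \<union> nodes G, edges = edges F + edges G\<rparr>"

definition graph_parameter :: "(mgraph \<Rightarrow> real) \<Rightarrow> bool" where
  "graph_parameter f \<longleftrightarrow>
     (\<forall>F G. multigraph F \<longrightarrow> multigraph G \<longrightarrow> isomorphic F G \<longrightarrow> f F = f G)"

text \<open>For a graph parameter it is enough to speak about node-disjoint representatives of the two
  isomorphism types; their union is then the disjoint union.\<close>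

definition multiplicative :: "(mgraph \<Rightarrow> real) \<Rightarrow> bool" where
  "multiplicative f \<longleftrightarrow>
     (\<forall>F G. multigraph F \<longrightarrow> multigraph G \<longrightarrow> nodes F \<inter> nodes G = {} \<longrightarrow>
        f (munion F G) = f F * f G)"

section \<open>Labeled multigraphs and their product\<close>

text \<open>The node carrying label \<open>i\<close> is the number \<open>i\<close> itself; all nodes outside \<open>{1..n}\<close> are
  unlabeled. Every isomorphism type of labeled multigraphs has such representatives.\<close>

definition labeled_graphs :: "nat \<Rightarrow> mgraph set" where
  "labeled_graphs n = {F. multigraph F \<and> {1..n} \<subseteq> nodes F}"

definition fully_labeled_graphs :: "nat \<Rightarrow> mgraph set" where
  "fully_labeled_graphs n = {F. multigraph F \<and> nodes F = {1..n}}"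

text \<open>The renamings keep the labeled nodes and move the unlabeled nodes of the two factors to
  disjoint sets beyond \<open>n\<close>. On fully labeled graphs they are the identity.\<close>

definition glue :: "nat \<Rightarrow> mgraph \<Rightarrow> mgraph \<Rightarrow> mgraph" where
  "glue n F G = munion
     (rename (\<lambda>v. if v \<in> {1..n} then v else n + 2 * v + 1) F)
     (rename (\<lambda>v. if v \<in> {1..n} then v else n + 2 * v + 2) G)"

lemma multigraph_rename:
  assumes "multigraph F" "inj h"
  shows "multigraph (rename h F)"
  using assms
  by (auto simp: multigraph_def rename_def card_image inj_on_subset[of h UNIV])

lemma multigraph_munion:
  "multigraph F \<Longrightarrow> multigraph G \<Longrightarrow> multigraph (munion F G)"
  by (auto simp: multigraph_def munion_def)

lemma multigraph_glue:
  assumes "multigraph F" "multigraph G"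
  shows "multigraph (glue n F G)"
proof -
  have "inj (\<lambda>v. if v \<in> {1..n} then v else n + 2 * v + 1)"
       "inj (\<lambda>v. if v \<in> {1..n} then v else n + 2 * v + 2)"
    by (auto simp: inj_on_def split: if_splits)
  with assms show ?thesis
    by (simp only: glue_def multigraph_rename multigraph_munion)
qed

section \<open>Weak reflection positivity\<close>

definition quantum_graphs :: "nat \<Rightarrow> (mgraph \<Rightarrow>\<^sub>0 real) set" where
  "quantum_graphs n = {p. Poly_Mapping.keys p \<subseteq> fully_labeled_graphs n}"

definition quantum_prod ::
    "nat \<Rightarrow> (mgraph \<Rightarrow>\<^sub>0 real) \<Rightarrow> (mgraph \<Rightarrow>\<^sub>0 real) \<Rightarrow> (mgraph \<Rightarrow>\<^sub>0 real)" where
  "quantum_prod n p q =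
     (\<Sum>F\<in>Poly_Mapping.keys p. \<Sum>G\<in>Poly_Mapping.keys q.
        Poly_Mapping.single (glue n F G) (Poly_Mapping.lookup p F * Poly_Mapping.lookup q G))"

definition linear_ext :: "(mgraph \<Rightarrow> real) \<Rightarrow> (mgraph \<Rightarrow>\<^sub>0 real) \<Rightarrow> real" where
  "linear_ext f p = (\<Sum>F\<in>Poly_Mapping.keys p. Poly_Mapping.lookup p F * f F)"

definition weakly_reflection_positive :: "(mgraph \<Rightarrow> real) \<Rightarrow> bool" where
  "weakly_reflection_positive f \<longleftrightarrow>
     (\<forall>n\<ge>1. \<forall>p\<in>quantum_graphs n. linear_ext f (quantum_prod n p p) \<ge> 0)"

section \<open>Connection matrices and their rank\<close>

definition rows_independent :: "'r set \<Rightarrow> 'c set \<Rightarrow> ('r \<Rightarrow> 'c \<Rightarrow> real) \<Rightarrow> bool" where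
  "rows_independent S C A \<longleftrightarrow>
     (\<forall>u. (\<forall>y\<in>C. (\<Sum>x\<in>S. u x * A x y) = 0) \<longrightarrow> (\<forall>x\<in>S. u x = 0))"

text \<open>The rank of a possibly infinite matrix: the supremum of the sizes of finite linearly
  independent families of rows.\<close>

definition matrix_rank :: "'r set \<Rightarrow> 'c set \<Rightarrow> ('r \<Rightarrow> 'c \<Rightarrow> real) \<Rightarrow> enat" where
  "matrix_rank R C A =
     Sup {enat (card S) |S. finite S \<and> S \<subseteq> R \<and> rows_independent S C A}"

definition connection_matrix :: "(mgraph \<Rightarrow> real) \<Rightarrow> nat \<Rightarrow> mgraph \<Rightarrow> mgraph \<Rightarrow> real" where
  "connection_matrix f n F G = f (glue n F G)"

text \<open>Rows and columns are indexed by labeled multigraphs instead of their isomorphism types. For a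
  graph parameter this only repeats rows and columns, which does not affect the rank.\<close>

definition connection_rank :: "(mgraph \<Rightarrow> real) \<Rightarrow> nat \<Rightarrow> enat" where
  "connection_rank f n =
     matrix_rank (labeled_graphs n) (labeled_graphs n) (connection_matrix f n)"

text \<open>The \<open>k\<close>-th root (meant for \<open>k \<ge> 1\<close>), with value \<open>\<infinity>\<close> at \<open>\<infinity>\<close>.\<close>

definition enat_root :: "nat \<Rightarrow> enat \<Rightarrow> ereal" where
  "enat_root k r = (case r of enat m \<Rightarrow> ereal (root k (real m)) | \<infinity> \<Rightarrow> \<infinity>)"

section \<open>Weighted and randomly weighted graphs\<close>

record wgraph =
  wnodes :: "nat set"
  nodeweight :: "nat \<Rightarrow> real"
  edgeweight :: "nat \<Rightarrow> nat \<Rightarrow> real"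

definition weighted_graph :: "wgraph \<Rightarrow> bool" where
  "weighted_graph H \<longleftrightarrow> finite (wnodes H) \<and>
     (\<forall>i\<in>wnodes H. nodeweight H i > 0) \<and>
     (\<forall>i\<in>wnodes H. \<forall>j\<in>wnodes H. edgeweight H i j = edgeweight H j i)"

definition hom :: "mgraph \<Rightarrow> wgraph \<Rightarrow> real" where
  "hom F H = (\<Sum>\<phi>\<in>nodes F \<rightarrow>\<^sub>E wnodes H.
     (\<Prod>i\<in>nodes F. nodeweight H (\<phi> i)) *
     (\<Prod>(i, j)\<in>{(i, j). i \<in> nodes F \<and> j \<in> nodes F \<and> i < j}.
        edgeweight H (\<phi> i) (\<phi> j) ^ mult F i j))"

text \<open>The random edgeweights are random variables on a common probability space, part of the data.\<close>

record 'w rwgraph =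
  rnodes :: "nat set"
  rnodeweight :: "nat \<Rightarrow> real"
  rspace :: "'w measure"
  redgeweight :: "nat \<Rightarrow> nat \<Rightarrow> 'w \<Rightarrow> real"

text \<open>The family of random edgeweights is indexed by unordered pairs of nodes (a node with itself
  allowed), represented by the pairs \<open>(i, j)\<close> with \<open>i \<le> j\<close>. Measurability is part of
  \<open>indep_vars\<close>.\<close>

definition randomly_weighted_graph :: "'w rwgraph \<Rightarrow> bool" where
  "randomly_weighted_graph H \<longleftrightarrow> finite (rnodes H) \<and>
     (\<forall>i\<in>rnodes H. rnodeweight H i \<ge> 0) \<and>
     prob_space (rspace H) \<and>
     (\<forall>i\<in>rnodes H. \<forall>j\<in>rnodes H. redgeweight H i j = redgeweight H j i) \<and>
     (\<forall>i\<in>rnodes H. \<forall>j\<in>rnodes H. finite (redgeweight H i j ` space (rspace H))) \<and>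
     prob_space.indep_vars (rspace H) (\<lambda>_. borel) (\<lambda>(i, j). redgeweight H i j)
       {(i, j). i \<in> rnodes H \<and> j \<in> rnodes H \<and> i \<le> j}"

definition proper :: "'w rwgraph \<Rightarrow> bool" where
  "proper H \<longleftrightarrow> (\<exists>i\<in>rnodes H. \<exists>j\<in>rnodes H. \<exists>x y. x \<noteq> y \<and>
     measure (rspace H) {\<omega> \<in> space (rspace H). redgeweight H i j \<omega> = x} > 0 \<and>
     measure (rspace H) {\<omega> \<in> space (rspace H). redgeweight H i j \<omega> = y} > 0)"

definition rhom :: "mgraph \<Rightarrow> 'w rwgraph \<Rightarrow> real" where
  "rhom F H = (\<Sum>\<phi>\<in>nodes F \<rightarrow>\<^sub>E rnodes H.
     (\<Prod>i\<in>nodes F. rnodeweight H (\<phi> i)) *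
     (\<Prod>(i, j)\<in>{(i, j). i \<in> nodes F \<and> j \<in> nodes F \<and> i < j}.
        (\<integral>\<omega>. redgeweight H (\<phi> i) (\<phi> j) \<omega> ^ mult F i j \<partial>rspace H)))"

end

theory Submission
  imports Defs "HOL-Computational_Algebra.Fundamental_Theorem_Algebra" "HOL-Real_Asymp.Real_Asymp"
begin

text \<open>Suppose that some \<open>M(f,n)\<close> with \<open>n \<ge> 2\<close> has finite rank. Powers of an edge are linearly dependent, so
  by positivity the edge variables take values in a finite set \<open>B\<close>, and \<open>f\<close> (normalized by
  \<open>f(K\<^sub>1) = 1\<close>) is given by exchangeable random \<open>B\<close>-colourings of complete graphs. Multiplicativity makes
  the densities in these colourings concentrate, hence \<open>f\<close> is the limit of the densities of fixed
  \<open>B\<close>-coloured complete graphs \<open>g\<close>.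

  On the nodes of \<open>g\<close> consider the squared distance \<open>D(x,y)\<close> of the rows of the codegree kernels of the
  powers of \<open>g\<close>. It is a combination of rooted densities of paths and four-cycles, whose powers are again
  dependent, so in the limit it takes finitely many values. On the other hand only boundedly many nodes
  can be pairwise far apart, because a row of a codegree kernel is approximated by an average over
  boundedly many sample nodes. So the nodes fall into boundedly many classes with \<open>D\<close> nearly \<open>0\<close> inside
  each class, which makes \<open>g\<close> close in cut norm to a random model with boundedly many nodes. By
  compactness, \<open>f = hom(.,H)\<close> for a randomly weighted graph \<open>H\<close>.

  For such \<open>H\<close>, the matrix \<open>M(f,n)\<close> is a positive combination of rank-one matrices indexed by pairs of a map
  \<open>\<psi>\<close> from the labels to \<open>V(H)\<close> and a choice \<open>c\<close> of values of the edges between labels, and its rank is at least the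
  number of different \<open>c\<close>. If the edge weights are deterministic, this gives the number of
  twin classes as growth rate of the \<open>n\<close>-th root. Otherwise the rank is, up to a factor \<open>|V(H)|\<^sup>n\<close>, the maximum over
  \<open>\<psi>\<close> of the product of the support sizes over all pairs of labels.\<close>

section \<open>Linear algebra and interpolation\<close>

text \<open>Two obstacles shape the argument. Positivity is given only for graphs without unlabeled
  nodes, while the paths and four-cycles whose powers must be controlled have unlabeled nodes. The
  approximating colourings compensate for this: once the images of the labels are fixed, the density
  of a square is a plain sum of squares, so positivity for all labeled graphs returns in the limit.
  The other obstacle is genuine randomness. If the edges of \<open_g> look random, the rows of the
  kernel itself are far apart for most pairs of nodes. The codegree kernel averages over a middle
  node, which removes the noise, and its rows still control the cut norm. In a general regularity
  partition the number of classes grows as the error shrinks. Here there is a gap between 0 and the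
  next limit value of \<open>D\<close>, so one fixed scale suffices: a distance below the gap is
  close to 0 for almost all pairs. The number of classes stays fixed along the sequence and the
  limit is finite. Powers of \<open>g\<close> enter since the whole distribution of colours between
  two classes has to be recovered, not only its mean.\<close>

lemma homogeneous_system_nontrivial:
  fixes a :: "'s \<Rightarrow> 'i \<Rightarrow> real"
  assumes "finite I" "finite S" "card I < card S"
  shows "\<exists>u. (\<exists>x\<in>S. u x \<noteq> 0) \<and> (\<forall>i\<in>I. (\<Sum>x\<in>S. u x * a x i) = 0)"
  using assms
proof (induction I arbitrary: S a rule: finite_induct)
  case empty
  then obtain x where "x \<in> S" by fastforce
  then show ?case by (intro exI[of _ "\<lambda>_. 1"]) auto
next
  case (insert j I)
  show ?case
  proof (cases "\<forall>x\<in>S. a x j = 0")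
    case True
    have "card I < card S" using insert by simp
    then obtain u where "\<exists>x\<in>S. u x \<noteq> 0" "\<forall>i\<in>I. (\<Sum>x\<in>S. u x * a x i) = 0"
      using insert.IH[OF insert.prems(1), of a] by blast
    moreover have "(\<Sum>x\<in>S. u x * a x j) = 0" using True by simp
    ultimately show ?thesis by (intro exI[of _ u]) simp
  next
    case False
    then obtain s where s: "s \<in> S" "a s j \<noteq> 0" by blast
    \<comment> \<open>Equation \<open>j\<close> is solved for the unknown at \<open>s\<close>;
      \<open>b\<close> is the system left after substituting that solution, and \<open>t\<close>
      below is the solved value.\<close>
    define b where "b x i = a x i - a x j / a s j * a s i" for x i
    have card: "card I < card (S - {s})" using insert s by simp
    obtain u where u: "\<exists>x\<in>S-{s}. u x \<noteq> 0" "\<And>i. i \<in> I \<Longrightarrow> (\<Sum>x\<in>S-{s}. u x * b x i) = 0"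
      using insert.IH[of "S - {s}" b] card insert.prems by auto
    define t where "t = - (\<Sum>x\<in>S-{s}. u x * a x j) / a s j"
    define v where "v = u(s := t)"
    have sumv: "(\<Sum>x\<in>S. v x * a x i) = t * a s i + (\<Sum>x\<in>S-{s}. u x * a x i)" for i
    proof -
      have "(\<Sum>x\<in>S. v x * a x i) = v s * a s i + (\<Sum>x\<in>S-{s}. v x * a x i)"
        using insert.prems s by (subst sum.remove[of S s]) auto
      also have "(\<Sum>x\<in>S-{s}. v x * a x i) = (\<Sum>x\<in>S-{s}. u x * a x i)"
        by (rule sum.cong) (auto simp: v_def)
      finally show ?thesis by (simp add: v_def)
    qed
    have "(\<Sum>x\<in>S. v x * a x j) = 0"
      unfolding sumv t_def using s by simp
    moreover have "(\<Sum>x\<in>S. v x * a x i) = 0" if "i \<in> I" for i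
    proof -
      have "0 = (\<Sum>x\<in>S-{s}. u x * a x i) - (\<Sum>x\<in>S-{s}. u x * a x j) * (a s i / a s j)"
        using u(2)[OF that] unfolding b_def
        by (simp add: algebra_simps sum_subtractf sum_distrib_left sum_distrib_right)
      then show ?thesis unfolding sumv t_def by (simp add: field_simps)
    qed
    moreover have "\<exists>x\<in>S. v x \<noteq> 0" using u(1) by (auto simp: v_def)
    ultimately show ?thesis by auto
  qed
qed

text \<open>Row rank equals column rank, for finitely many columns \<open>P\<close> and arbitrarily
  many rows \<open>M\<close>. In the induction the set \<open>S\<close> found for \<open>P\<close>
  is one function too small for \<open>insert q P\<close>, so all of \<open>S\<close> annihilates
  some nonzero \<open>v\<close>. A function \<open>m\<close> that does not annihilate
  \<open>v\<close> is then independent of \<open>S\<close>.\<close>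

lemma independent_functions_on_points:
  fixes ev :: "'m \<Rightarrow> 'p \<Rightarrow> real"
  assumes "finite P"
    and "\<And>v. (\<forall>m\<in>M. (\<Sum>p\<in>P. v p * ev m p) = 0) \<Longrightarrow> \<forall>p\<in>P. v p = 0"
  shows "\<exists>S\<subseteq>M. finite S \<and> card S = card P \<and>
    (\<forall>u. (\<forall>p\<in>P. (\<Sum>m\<in>S. u m * ev m p) = 0) \<longrightarrow> (\<forall>m\<in>S. u m = 0))"
  using assms
proof (induction P rule: finite_induct)
  case empty
  then show ?case by (intro exI[of _ "{}"]) auto
next
  case (insert q P)
  have "\<exists>S\<subseteq>M. finite S \<and> card S = card P \<and>
    (\<forall>u. (\<forall>p\<in>P. (\<Sum>m\<in>S. u m * ev m p) = 0) \<longrightarrow> (\<forall>m\<in>S. u m = 0))"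
  proof (rule insert.IH)
    fix v assume v: "\<forall>m\<in>M. (\<Sum>p\<in>P. v p * ev m p) = 0"
    have "\<forall>m\<in>M. (\<Sum>p\<in>insert q P. (v(q := 0)) p * ev m p) = 0"
    proof
      fix m assume "m \<in> M"
      have "(\<Sum>p\<in>P. (v(q := 0)) p * ev m p) = (\<Sum>p\<in>P. v p * ev m p)"
        using insert.hyps by (intro sum.cong) auto
      then show "(\<Sum>p\<in>insert q P. (v(q := 0)) p * ev m p) = 0"
        using v \<open>m \<in> M\<close> insert.hyps by simp
    qed
    from insert.prems[OF this] show "\<forall>p\<in>P. v p = 0" using insert.hyps(2) by (auto split: if_splits)
  qed
  then obtain S where S: "S \<subseteq> M" "finite S" "card S = card P"
    "\<And>u. (\<forall>p\<in>P. (\<Sum>m\<in>S. u m * ev m p) = 0) \<Longrightarrow> (\<forall>m\<in>S. u m = 0)" by blast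
  obtain v where v: "\<exists>p\<in>insert q P. v p \<noteq> 0" "\<forall>m\<in>S. (\<Sum>p\<in>insert q P. v p * ev m p) = 0"
    using homogeneous_system_nontrivial[of S "insert q P" "\<lambda>p m. ev m p"] S insert.hyps by auto
  obtain m where m: "m \<in> M" "(\<Sum>p\<in>insert q P. v p * ev m p) \<noteq> 0"
    using insert.prems[of v] v(1) by blast
  have mS: "m \<notin> S" using v(2) m(2) by blast
  have "\<forall>l\<in>insert m S. u l = 0"
    if u: "\<forall>p\<in>insert q P. (\<Sum>l\<in>insert m S. u l * ev l p) = 0" for u
  proof -
    \<comment> \<open>Pairing the dependency with \<open>v\<close> kills every function of
      \<open>S\<close> and leaves only the coefficient of \<open>m\<close>.\<close>
    have "0 = (\<Sum>p\<in>insert q P. v p * (\<Sum>l\<in>insert m S. u l * ev l p))"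
      by (rule sum.neutral[symmetric], rule ballI, subst bspec[OF u]) (assumption, simp)
    also have "\<dots> = (\<Sum>l\<in>insert m S. u l * (\<Sum>p\<in>insert q P. v p * ev l p))"
      unfolding sum_distrib_left by (subst sum.swap) (simp add: mult.left_commute)
    also have "\<dots> = u m * (\<Sum>p\<in>insert q P. v p * ev m p)
        + (\<Sum>l\<in>S. u l * (\<Sum>p\<in>insert q P. v p * ev l p))"
      using S mS by (subst sum.insert) auto
    also have "(\<Sum>l\<in>S. u l * (\<Sum>p\<in>insert q P. v p * ev l p)) = 0" using v(2) by simp
    finally have "u m = 0" using m by simp
    moreover have "\<forall>p\<in>P. (\<Sum>l\<in>S. u l * ev l p) = 0"
      using u \<open>u m = 0\<close> S mS by simp
    ultimately show ?thesis using S(4) by auto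
  qed
  moreover have "card (insert m S) = card (insert q P)" using S mS insert.hyps by simp
  ultimately show ?case using S m by (intro exI[of _ "insert m S"]) auto
qed

lemma prod_poly_eq_sum_monomials:
  fixes p :: "'e \<Rightarrow> real poly"
  assumes "finite E"
  shows "(\<Prod>e\<in>E. poly (p e) (x e)) =
    (\<Sum>k\<in>(\<Pi>\<^sub>E e\<in>E. {..degree (p e)}). (\<Prod>e\<in>E. coeff (p e) (k e)) * (\<Prod>e\<in>E. x e ^ k e))"
proof -
  have "(\<Prod>e\<in>E. poly (p e) (x e)) = (\<Prod>e\<in>E. \<Sum>i\<in>{..degree (p e)}. coeff (p e) i * x e ^ i)"
    by (simp add: poly_altdef)
  also have "\<dots> = (\<Sum>k\<in>(\<Pi>\<^sub>E e\<in>E. {..degree (p e)}). \<Prod>e\<in>E. coeff (p e) (k e) * x e ^ k e)"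
    using assms by (subst prod_sum_PiE) auto
  finally show ?thesis by (simp add: prod.distrib)
qed

text \<open>A polynomial in product form singles out the point \<open>x0\<close>: its factor
  \<open>q e\<close> vanishes at every value of the coordinate \<open>e\<close> on \<open>P\<close>
  other than \<open>x0 e\<close>. Extensionality guarantees that a different point differs from
  \<open>x0\<close> in a coordinate of \<open>E\<close>.\<close>

lemma monomials_separate_points:
  fixes P :: "('e \<Rightarrow> real) set" and v :: "('e \<Rightarrow> real) \<Rightarrow> real"
  assumes "finite E" "finite P" and ext: "P \<subseteq> extensional E"
    and *: "\<And>k. (\<Sum>x\<in>P. v x * (\<Prod>e\<in>E. x e ^ k e)) = 0"
  shows "\<forall>x\<in>P. v x = 0"
proof
  fix x0 assume x0: "x0 \<in> P"
  define q where "q e = (\<Prod>b\<in>(\<lambda>x. x e) ` P - {x0 e}. [:-b, 1:])" for e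
  let ?K = "\<Pi>\<^sub>E e\<in>E. {..degree (q e)}"
  have q0: "(\<Prod>e\<in>E. poly (q e) (x e)) = 0" if "x \<in> P" "x \<noteq> x0" for x
  proof -
    have "\<exists>e\<in>E. x e \<noteq> x0 e" using that x0 ext by (meson extensionalityI in_mono)
    then obtain e where e: "e \<in> E" "x e \<noteq> x0 e" by blast
    then have "poly (q e) (x e) = 0"
      using that assms(2) by (auto simp: q_def poly_prod prod_zero_iff)
    then show ?thesis using e assms(1) by (auto simp: prod_zero_iff)
  qed
  have q1: "(\<Prod>e\<in>E. poly (q e) (x0 e)) \<noteq> 0"
    using assms(1,2) by (auto simp: q_def poly_prod prod_zero_iff)
  have "(\<Sum>x\<in>P. v x * (\<Prod>e\<in>E. poly (q e) (x e))) =
     (\<Sum>x\<in>P. \<Sum>k\<in>?K. (\<Prod>e\<in>E. coeff (q e) (k e)) * (v x * (\<Prod>e\<in>E. x e ^ k e)))"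
    by (simp add: prod_poly_eq_sum_monomials[OF assms(1)] sum_distrib_left mult_ac)
  also have "\<dots> = (\<Sum>k\<in>?K. (\<Prod>e\<in>E. coeff (q e) (k e)) * (\<Sum>x\<in>P. v x * (\<Prod>e\<in>E. x e ^ k e)))"
    by (subst sum.swap) (simp add: sum_distrib_left)
  also have "\<dots> = 0" using * by simp
  finally have "(\<Sum>x\<in>P. v x * (\<Prod>e\<in>E. poly (q e) (x e))) = 0" .
  moreover have "(\<Sum>x\<in>P. v x * (\<Prod>e\<in>E. poly (q e) (x e))) = v x0 * (\<Prod>e\<in>E. poly (q e) (x0 e))"
    using assms(2) x0 q0 by (subst sum.remove[of P x0]) (auto intro!: sum.neutral)
  ultimately show "v x0 = 0" using q1 by simp
qed

lemma lagrange_interpolation: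
  fixes B :: "real set" and h :: "real \<Rightarrow> real"
  assumes "finite B"
  shows "\<exists>c. \<forall>b\<in>B. h b = (\<Sum>j<card B. c j * b ^ j)"
proof -
  define l where "l b = (\<Prod>a\<in>B-{b}. [:-a, 1:])" for b :: real
  have l0: "poly (l b) a = 0" if "a \<in> B" "a \<noteq> b" for a b
    using that assms by (auto simp: l_def poly_prod prod_zero_iff)
  have l1: "poly (l b) b \<noteq> 0" for b
    using assms by (auto simp: l_def poly_prod prod_zero_iff)
  have dl: "degree (l b) < card B" if "b \<in> B" for b
  proof -
    have "degree (l b) \<le> (\<Sum>a\<in>B-{b}. degree [:-a, 1:])"
      unfolding l_def using assms degree_prod_sum_le[of "B-{b}" "\<lambda>a. [:-a, 1:]"]
      by (simp add: o_def)
    also have "\<dots> = card B - 1" using assms that by simp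
    also have "\<dots> < card B" using assms that by (metis card_gt_0_iff diff_less empty_iff zero_less_one)
    finally show ?thesis .
  qed
  define c where "c j = (\<Sum>b\<in>B. h b / poly (l b) b * coeff (l b) j)" for j
  show ?thesis
  proof (intro exI ballI)
    fix a assume a: "a \<in> B"
    have "(\<Sum>j<card B. c j * a ^ j) = (\<Sum>b\<in>B. h b / poly (l b) b * (\<Sum>j<card B. coeff (l b) j * a ^ j))"
      unfolding c_def sum_distrib_right sum_distrib_left by (subst sum.swap) (simp add: mult_ac)
    also have "\<dots> = (\<Sum>b\<in>B. h b / poly (l b) b * poly (l b) a)"
    proof (rule sum.cong, simp)
      fix b assume "b \<in> B"
      have "(\<Sum>j<card B. coeff (l b) j * a ^ j) = (\<Sum>j\<le>degree (l b). coeff (l b) j * a ^ j)"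
        using dl[OF \<open>b \<in> B\<close>] by (intro sum.mono_neutral_right) (auto simp: coeff_eq_0)
      then show "h b / poly (l b) b * (\<Sum>j<card B. coeff (l b) j * a ^ j) = h b / poly (l b) b * poly (l b) a"
        by (simp add: poly_altdef)
    qed
    also have "\<dots> = h a / poly (l a) a * poly (l a) a"
      using assms a l0 by (subst sum.remove[of B a]) (auto intro!: sum.neutral)
    finally show "h a = (\<Sum>j<card B. c j * a ^ j)" using l1 by simp
  qed
qed

text \<open>Compactness of a cube. It is applied to the class sizes and colour frequencies of the
  step models, which are finite in number.\<close>

lemma bounded_family_convergent_subsequence:
  fixes X :: "'i \<Rightarrow> nat \<Rightarrow> real"
  assumes "finite I" "\<And>i. i \<in> I \<Longrightarrow> \<exists>C. \<forall>n. \<bar>X i n\<bar> \<le> C"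
  shows "\<exists>r::nat \<Rightarrow> nat. strict_mono r \<and> (\<forall>i\<in>I. convergent (\<lambda>n. X i (r n)))"
  using assms
proof (induction I rule: finite_induct)
  case empty
  show ?case by (intro exI[of _ id]) (auto simp: strict_mono_def)
next
  case (insert j I)
  then obtain r where r: "strict_mono r" "\<forall>i\<in>I. convergent (\<lambda>n. X i (r n))" by auto
  obtain C where "\<And>n. \<bar>X j n\<bar> \<le> C" using insert.prems by auto
  then have "bounded (range (\<lambda>n. X j (r n)))" by (auto simp: bounded_iff)
  then obtain s l where s: "strict_mono s" "((\<lambda>n. X j (r n)) \<circ> s) \<longlonglongrightarrow> l"
    using bounded_imp_convergent_subsequence by blast
  have "convergent (\<lambda>n. X i (r (s n)))" if "i \<in> I" for i
    using r(2) that LIMSEQ_subseq_LIMSEQ[OF _ s(1), of "\<lambda>n. X i (r n)"]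
    by (auto simp: convergent_def o_def)
  moreover have "convergent (\<lambda>n. X j (r (s n)))" using s(2) by (auto simp: convergent_def o_def)
  ultimately show ?case using strict_mono_o[OF r(1) s(1)]
    by (intro exI[of _ "r \<circ> s"]) (auto simp: o_def)
qed

section \<open>Homomorphism functionals\<close>

text \<open>The nodes in \<open>L\<close> are sent by the fixed map \<open>\<psi>\<close>, the other
  nodes are summed over. Edges inside \<open>L\<close> have their own weight \<open>\<rho>\<close>,
  separate from \<open>\<mu>\<close>: it can be a power of a fixed value, hence multiplicative under
  gluing, even when \<open>\<mu>\<close> is a sequence of moments and is not.\<close>

definition rooted_hom :: "nat set \<Rightarrow> nat set \<Rightarrow> (nat \<Rightarrow> real) \<Rightarrow> (nat set \<Rightarrow> nat \<Rightarrow> real) \<Rightarrow> (nat \<Rightarrow> nat) \<Rightarrow>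
    (nat set \<Rightarrow> nat \<Rightarrow> real) \<Rightarrow> mgraph \<Rightarrow> real" where
  "rooted_hom L V \<alpha> \<mu> \<psi> \<rho> F = (\<Sum>\<phi>\<in>(nodes F - L) \<rightarrow>\<^sub>E V. (\<Prod>i\<in>nodes F - L. \<alpha> (\<phi> i)) *
     (\<Prod>e\<in>set_mset (edges F). if e \<subseteq> L then \<rho> e (count (edges F) e)
        else \<mu> ((\<lambda>i. if i \<in> L then \<psi> i else \<phi> i) ` e) (count (edges F) e)))"

text \<open>Common form of \<open>hom\<close>, \<open>rhom\<close> and \<open>density\<close>. An
  edge weight depends on the unordered image of the edge, which is a singleton if both ends have the
  same image, and on the multiplicity. It may be any function of the multiplicity, so that moments
  of random weights are covered.\<close>

definition edge_hom :: "nat set \<Rightarrow> (nat \<Rightarrow> real) \<Rightarrow> (nat set \<Rightarrow> nat \<Rightarrow> real) \<Rightarrow> mgraph \<Rightarrow> real" where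
  "edge_hom V \<alpha> \<mu> F = (\<Sum>\<phi>\<in>nodes F \<rightarrow>\<^sub>E V. (\<Prod>i\<in>nodes F. \<alpha> (\<phi> i)) *
     (\<Prod>e\<in>set_mset (edges F). \<mu> (\<phi> ` e) (count (edges F) e)))"

lemma multigraph_edgeE:
  assumes "multigraph F" "e \<in># edges F"
  obtains i j where "i < j" "e = {i, j}" "i \<in> nodes F" "j \<in> nodes F"
proof -
  have "card e = 2" "e \<subseteq> nodes F" using assms by (auto simp: multigraph_def)
  then obtain i j where "e = {i, j}" "i \<noteq> j" by (auto simp: card_2_iff)
  then show thesis using \<open>e \<subseteq> nodes F\<close> that[of i j] that[of j i]
    by (cases "i < j") (auto simp: insert_commute)
qed

lemma edge_hom_eq_rt: "multigraph F \<Longrightarrow> edge_hom V \<alpha> \<mu> F = rooted_hom {} V \<alpha> \<mu> \<psi> \<rho> F"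
  unfolding edge_hom_def rooted_hom_def
  by (intro sum.cong arg_cong2[where f = "(*)"] prod.cong)
     (auto elim: multigraph_edgeE)

lemma sum_PiE_Un:
  assumes "A \<inter> B = {}"
  shows "(\<Sum>\<phi>\<in>(A \<union> B) \<rightarrow>\<^sub>E V. f \<phi>) =
    (\<Sum>\<phi>\<in>A \<rightarrow>\<^sub>E V. \<Sum>\<xi>\<in>B \<rightarrow>\<^sub>E V. f (\<lambda>i. if i \<in> A then \<phi> i else \<xi> i))"
proof -
  have "(\<Sum>\<phi>\<in>(A \<union> B) \<rightarrow>\<^sub>E V. f \<phi>) =
      (\<Sum>(\<phi>, \<xi>)\<in>(A \<rightarrow>\<^sub>E V) \<times> (B \<rightarrow>\<^sub>E V). f (\<lambda>i. if i \<in> A then \<phi> i else \<xi> i))"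
    by (rule sum.reindex_bij_witness[where
          j = "\<lambda>\<phi>. (restrict \<phi> A, restrict \<phi> B)"
          and i = "\<lambda>(\<phi>, \<xi>) i. if i \<in> A then \<phi> i else \<xi> i"])
       (use assms in \<open>auto simp: fun_eq_iff PiE_iff extensional_def restrict_def split: if_splits
          intro!: arg_cong[where f = f]\<close>)
  then show ?thesis by (simp add: sum.cartesian_product)
qed

lemma edge_hom_expand:
  assumes "L \<subseteq> nodes F" "multigraph F"
  shows "edge_hom V \<alpha> \<mu> F =
    (\<Sum>\<psi>\<in>L \<rightarrow>\<^sub>E V. (\<Prod>i\<in>L. \<alpha> (\<psi> i)) * rooted_hom L V \<alpha> \<mu> \<psi> (\<lambda>e k. \<mu> (\<psi> ` e) k) F)"
proof -
  have N: "nodes F = L \<union> (nodes F - L)" using assms by auto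
  have fin: "finite L" "finite (nodes F - L)"
    using assms finite_subset by (auto simp: multigraph_def)
  have PN: "nodes F \<rightarrow>\<^sub>E V = (L \<union> (nodes F - L)) \<rightarrow>\<^sub>E V"
    by (rule arg_cong[where f = "\<lambda>A. A \<rightarrow>\<^sub>E V", OF N])
  show ?thesis
    unfolding edge_hom_def PN sum_PiE_Un[OF Diff_disjoint] rooted_hom_def sum_distrib_left
  proof (intro sum.cong refl)
    fix \<psi> \<phi> :: "nat \<Rightarrow> nat"
    let ?c = "\<lambda>i. if i \<in> L then \<psi> i else \<phi> i"
    have "(\<Prod>i\<in>nodes F. \<alpha> (?c i)) = (\<Prod>i\<in>L \<union> (nodes F - L). \<alpha> (?c i))" using N by simp
    also have "\<dots> = (\<Prod>i\<in>L. \<alpha> (?c i)) * (\<Prod>i\<in>nodes F - L. \<alpha> (?c i))"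
      using fin by (intro prod.union_disjoint) auto
    also have "\<dots> = (\<Prod>i\<in>L. \<alpha> (\<psi> i)) * (\<Prod>i\<in>nodes F - L. \<alpha> (\<phi> i))"
      by (intro arg_cong2[where f = "(*)"] prod.cong) auto
    finally have 1: "(\<Prod>i\<in>nodes F. \<alpha> (?c i)) = (\<Prod>i\<in>L. \<alpha> (\<psi> i)) * (\<Prod>i\<in>nodes F - L. \<alpha> (\<phi> i))" .
    have 2: "(\<Prod>e\<in>set_mset (edges F). \<mu> (?c ` e) (count (edges F) e)) =
      (\<Prod>e\<in>set_mset (edges F). if e \<subseteq> L then \<mu> (\<psi> ` e) (count (edges F) e)
         else \<mu> (?c ` e) (count (edges F) e))"
    proof (intro prod.cong refl)
      fix e
      have "e \<subseteq> L \<Longrightarrow> ?c ` e = \<psi> ` e" by (intro image_cong) auto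
      then show "\<mu> (?c ` e) (count (edges F) e) = (if e \<subseteq> L then \<mu> (\<psi> ` e) (count (edges F) e)
         else \<mu> (?c ` e) (count (edges F) e))" by simp
    qed
    show "(\<Prod>i\<in>nodes F. \<alpha> (?c i)) * (\<Prod>e\<in>set_mset (edges F). \<mu> (?c ` e) (count (edges F) e)) =
      (\<Prod>i\<in>L. \<alpha> (\<psi> i)) * ((\<Prod>i\<in>nodes F - L. \<alpha> (\<phi> i)) * 
      (\<Prod>e\<in>set_mset (edges F). if e \<subseteq> L then \<mu> (\<psi> ` e) (count (edges F) e)
         else \<mu> (?c ` e) (count (edges F) e)))"
      unfolding 1 2 by (simp only: mult.assoc)
  qed
qed

lemma inj_on_image_edges:
  assumes "multigraph F" "inj_on h (nodes F)"
  shows "inj_on ((`) h) (set_mset (edges F))"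
proof (rule inj_onI)
  fix e e' assume "e \<in># edges F" "e' \<in># edges F" "h ` e = h ` e'"
  then show "e = e'" using assms inj_on_image_eq_iff[of h "nodes F" e e']
    by (auto simp: multigraph_def)
qed

lemma count_image_mset_inj_on:
  assumes "inj_on f (set_mset M)" "x \<in># M"
  shows "count (image_mset f M) (f x) = count M x"
proof -
  have "f -` {f x} \<inter> set_mset M = {x}" using assms by (auto dest: inj_onD)
  then show ?thesis by (simp add: count_image_mset)
qed

lemma rooted_hom_rename:
  assumes F: "multigraph F" and inj: "inj_on h (nodes F)"
    and fix': "\<And>i. i \<in> nodes F \<Longrightarrow> i \<in> L \<Longrightarrow> h i = i"
    and out: "\<And>i. i \<in> nodes F \<Longrightarrow> i \<notin> L \<Longrightarrow> h i \<notin> L"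
  shows "rooted_hom L V \<alpha> \<mu> \<psi> \<rho> (rename h F) = rooted_hom L V \<alpha> \<mu> \<psi> \<rho> F"
proof -
  let ?A = "nodes F - L"
  have nodes: "nodes (rename h F) - L = h ` ?A"
  proof -
    have "x \<in> h ` nodes F - L \<Longrightarrow> x \<in> h ` ?A" for x using fix' by force
    then show ?thesis using out by (auto simp: rename_def)
  qed
  have edges: "set_mset (edges (rename h F)) = (`) h ` set_mset (edges F)"
    by (simp add: rename_def)
  have injA: "inj_on h ?A" using inj by (rule inj_on_subset) auto
  note inje = inj_on_image_edges[OF F inj]
  define g where "g = the_inv_into ?A h"
  have g: "i \<in> ?A \<Longrightarrow> g (h i) = i" for i unfolding g_def using injA by (rule the_inv_into_f_f)
  let ?t = "\<lambda>F \<phi>. (\<Prod>i\<in>nodes F - L. \<alpha> (\<phi> i)) *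
     (\<Prod>e\<in>set_mset (edges F). if e \<subseteq> L then \<rho> e (count (edges F) e)
        else \<mu> ((\<lambda>i. if i \<in> L then \<psi> i else \<phi> i) ` e) (count (edges F) e))"
  have "(\<Sum>\<phi>\<in>h ` ?A \<rightarrow>\<^sub>E V. ?t (rename h F) \<phi>) = (\<Sum>\<phi>\<in>?A \<rightarrow>\<^sub>E V. ?t F \<phi>)"
  proof (rule sum.reindex_bij_witness[where j = "\<lambda>\<phi>. restrict (\<phi> \<circ> h) ?A"
        and i = "\<lambda>\<phi>. restrict (\<phi> \<circ> g) (h ` ?A)"])
    fix \<phi> assume phi: "\<phi> \<in> h ` ?A \<rightarrow>\<^sub>E V"
    show "restrict (restrict (\<phi> \<circ> h) ?A \<circ> g) (h ` ?A) = \<phi>"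
    proof (rule extensionalityI[of _ "h ` ?A"])
      show "\<phi> \<in> extensional (h ` ?A)" using phi by (simp add: PiE_def)
      fix x assume "x \<in> h ` ?A"
      then obtain i where "i \<in> ?A" "x = h i" by blast
      then show "restrict (restrict (\<phi> \<circ> h) ?A \<circ> g) (h ` ?A) x = \<phi> x"
        using g[of i] by simp
    qed simp
    show "restrict (\<phi> \<circ> h) ?A \<in> ?A \<rightarrow>\<^sub>E V" using phi by auto
    let ?\<phi> = "restrict (\<phi> \<circ> h) ?A"
    have 1: "(\<Prod>i\<in>nodes (rename h F) - L. \<alpha> (\<phi> i)) = (\<Prod>i\<in>?A. \<alpha> (?\<phi> i))"
      unfolding nodes using injA by (simp add: prod.reindex)
    have 2: "(\<Prod>e\<in>set_mset (edges (rename h F)).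
        if e \<subseteq> L then \<rho> e (count (edges (rename h F)) e)
        else \<mu> ((\<lambda>i. if i \<in> L then \<psi> i else \<phi> i) ` e) (count (edges (rename h F)) e)) =
      (\<Prod>e\<in>set_mset (edges F). if e \<subseteq> L then \<rho> e (count (edges F) e)
        else \<mu> ((\<lambda>i. if i \<in> L then \<psi> i else ?\<phi> i) ` e) (count (edges F) e))"
    proof (rule prod.reindex_cong[OF inje edges])
      fix e assume e: "e \<in># edges F"
      then have sub: "e \<subseteq> nodes F" using F by (auto simp: multigraph_def)
      have c: "count (edges (rename h F)) (h ` e) = count (edges F) e"
        using count_image_mset_inj_on[OF inje e] by (simp add: rename_def)
      have hi: "h i \<in> L \<longleftrightarrow> i \<in> L" if "i \<in> e" for i
        using sub fix'[of i] out[of i] that by (cases "i \<in> L") auto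
      then have L: "h ` e \<subseteq> L \<longleftrightarrow> e \<subseteq> L" by (simp add: image_subset_iff subset_eq)
      have hL: "h ` e = e" if "e \<subseteq> L"
      proof -
        have "h ` e = id ` e" using sub fix' that by (intro image_cong) auto
        then show ?thesis by simp
      qed
      have im: "(\<lambda>i. if i \<in> L then \<psi> i else \<phi> i) ` h ` e = (\<lambda>i. if i \<in> L then \<psi> i else ?\<phi> i) ` e"
        unfolding image_image
      proof (intro image_cong refl)
        fix i assume "i \<in> e"
        then show "(if h i \<in> L then \<psi> (h i) else \<phi> (h i)) = (if i \<in> L then \<psi> i else ?\<phi> i)"
          using sub fix' out by (cases "i \<in> L") auto
      qed
      show "(if h ` e \<subseteq> L then \<rho> (h ` e) (count (edges (rename h F)) (h ` e))
         else \<mu> ((\<lambda>i. if i \<in> L then \<psi> i else \<phi> i) ` h ` e) (count (edges (rename h F)) (h ` e))) =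
        (if e \<subseteq> L then \<rho> e (count (edges F) e)
        else \<mu> ((\<lambda>i. if i \<in> L then \<psi> i else ?\<phi> i) ` e) (count (edges F) e))"
        unfolding c L im using hL by simp
    qed
    show "?t F ?\<phi> = ?t (rename h F) \<phi>" using 1 2 by simp
  next
    fix \<phi> assume phi: "\<phi> \<in> ?A \<rightarrow>\<^sub>E V"
    show "restrict (restrict (\<phi> \<circ> g) (h ` ?A) \<circ> h) ?A = \<phi>"
      by (rule extensionalityI[of _ ?A]) (use phi g in \<open>auto simp: PiE_def\<close>)
    show "restrict (\<phi> \<circ> g) (h ` ?A) \<in> h ` ?A \<rightarrow>\<^sub>E V" using phi g by auto
  qed
  then show ?thesis by (simp add: rooted_hom_def nodes)
qed

lemma edge_hom_rename:
  assumes "multigraph F" "inj_on h (nodes F)"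
  shows "edge_hom V \<alpha> \<mu> (rename h F) = edge_hom V \<alpha> \<mu> F"
proof -
  have "multigraph (rename h F)"
    using assms unfolding multigraph_def rename_def
    by (auto simp: card_image inj_on_subset)
  then show ?thesis
    using rooted_hom_rename[OF assms, of "{}" V \<alpha> \<mu> id "\<lambda>_ _. 1"] assms
    by (simp add: edge_hom_eq_rt[of _ V \<alpha> \<mu> id "\<lambda>_ _. 1"])
qed

text \<open>The unlabeled nodes of the two graphs are disjoint, so the sum factorizes. A pair of
  nodes that is an edge of both graphs lies inside \<open>L\<close>, where \<open>\<rho>\<close> is
  multiplicative in the multiplicity; every other edge belongs to one graph only, and
  \<open>\<mu>\<close> may be arbitrary.\<close>

lemma rooted_hom_munion:
  assumes F: "multigraph F" and G: "multigraph G" and FG: "nodes F \<inter> nodes G \<subseteq> L"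
    and add: "\<And>e k l. \<rho> e (k + l) = \<rho> e k * \<rho> e l" and zero: "\<And>e. \<rho> e 0 = 1"
  shows "rooted_hom L V \<alpha> \<mu> \<psi> \<rho> (munion F G) = rooted_hom L V \<alpha> \<mu> \<psi> \<rho> F * rooted_hom L V \<alpha> \<mu> \<psi> \<rho> G"
proof -
  let ?A = "nodes F - L" and ?B = "nodes G - L"
  have dis: "?A \<inter> ?B = {}" using FG by auto
  have N: "nodes (munion F G) - L = ?A \<union> ?B" by (auto simp: munion_def)
  have fin: "finite ?A" "finite ?B" using F G by (auto simp: multigraph_def)
  let ?ed = "\<lambda>F \<phi> e. if e \<subseteq> L then \<rho> e (count (edges F) e)
        else \<mu> ((\<lambda>i. if i \<in> L then \<psi> i else \<phi> i) ` e) (count (edges F) e)"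
  let ?t = "\<lambda>F \<phi>. (\<Prod>i\<in>nodes F - L. \<alpha> (\<phi> i)) * (\<Prod>e\<in>set_mset (edges F). ?ed F \<phi> e)"
  have "rooted_hom L V \<alpha> \<mu> \<psi> \<rho> (munion F G) =
    (\<Sum>\<phi>\<in>?A \<rightarrow>\<^sub>E V. \<Sum>\<xi>\<in>?B \<rightarrow>\<^sub>E V. ?t (munion F G) (\<lambda>i. if i \<in> ?A then \<phi> i else \<xi> i))"
    unfolding rooted_hom_def N by (subst sum_PiE_Un[OF dis]) simp
  also have "\<dots> = (\<Sum>\<phi>\<in>?A \<rightarrow>\<^sub>E V. \<Sum>\<xi>\<in>?B \<rightarrow>\<^sub>E V. ?t F \<phi> * ?t G \<xi>)"
  proof (intro sum.cong refl)
    fix \<phi> \<xi> :: "nat \<Rightarrow> nat"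
    let ?c = "\<lambda>i. if i \<in> ?A then \<phi> i else \<xi> i"
    have "(\<Prod>i\<in>?A \<union> ?B. \<alpha> (?c i)) = (\<Prod>i\<in>?A. \<alpha> (?c i)) * (\<Prod>i\<in>?B. \<alpha> (?c i))"
      using fin dis by (intro prod.union_disjoint)
    also have "\<dots> = (\<Prod>i\<in>?A. \<alpha> (\<phi> i)) * (\<Prod>i\<in>?B. \<alpha> (\<xi> i))"
      using dis by (intro arg_cong2[where f = "(*)"] prod.cong) auto
    finally have 1: "(\<Prod>i\<in>nodes (munion F G) - L. \<alpha> (?c i)) =
      (\<Prod>i\<in>?A. \<alpha> (\<phi> i)) * (\<Prod>i\<in>?B. \<alpha> (\<xi> i))" unfolding N .
    let ?U = "set_mset (edges F) \<union> set_mset (edges G)"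
    have 2: "?ed (munion F G) ?c e =
       (if e \<in># edges F then ?ed F \<phi> e else 1) * (if e \<in># edges G then ?ed G \<xi> e else 1)"
      if "e \<in> ?U" for e
    proof (cases "e \<subseteq> L")
      case True
      then show ?thesis using zero[of e]
        by (auto simp: munion_def add not_in_iff)
    next
      case False
      have cF: "(\<lambda>i. if i \<in> L then \<psi> i else ?c i) ` e = (\<lambda>i. if i \<in> L then \<psi> i else \<phi> i) ` e"
        if "e \<in># edges F"
        using that F by (intro image_cong) (auto simp: multigraph_def)
      have cG: "(\<lambda>i. if i \<in> L then \<psi> i else ?c i) ` e = (\<lambda>i. if i \<in> L then \<psi> i else \<xi> i) ` e"
        if "e \<in># edges G"
        using that G dis by (intro image_cong) (auto simp: multigraph_def)
      have not: "\<not> (e \<in># edges F \<and> e \<in># edges G)"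
        using False F G FG by (fastforce simp: multigraph_def)
      show ?thesis
      proof (cases "e \<in># edges F")
        case True
        then have "e \<notin># edges G" "count (edges G) e = 0" using not by (simp, simp add: count_eq_zero_iff)
        with True False show ?thesis using cF[OF True] by (simp add: munion_def del: if_image_distrib)
      next
        case nF: False
        then have "e \<in># edges G" "count (edges F) e = 0" using that nF by (simp, simp add: count_eq_zero_iff)
        with nF False show ?thesis using cG by (simp add: munion_def del: if_image_distrib)
      qed
    qed
    have "(\<Prod>e\<in>set_mset (edges (munion F G)). ?ed (munion F G) ?c e) =
      (\<Prod>e\<in>?U. (if e \<in># edges F then ?ed F \<phi> e else 1) * (if e \<in># edges G then ?ed G \<xi> e else 1))"
      using 2 by (intro prod.cong) (auto simp: munion_def)
    also have "\<dots> = (\<Prod>e\<in>?U. (if e \<in># edges F then ?ed F \<phi> e else 1)) *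
       (\<Prod>e\<in>?U. (if e \<in># edges G then ?ed G \<xi> e else 1))" by (rule prod.distrib)
    also have "(\<Prod>e\<in>?U. (if e \<in># edges F then ?ed F \<phi> e else 1)) =
       (\<Prod>e\<in>set_mset (edges F). ?ed F \<phi> e)"
      by (intro prod.mono_neutral_cong_right) auto
    also have "(\<Prod>e\<in>?U. (if e \<in># edges G then ?ed G \<xi> e else 1)) =
       (\<Prod>e\<in>set_mset (edges G). ?ed G \<xi> e)"
      by (intro prod.mono_neutral_cong_right) auto
    finally show "?t (munion F G) ?c = ?t F \<phi> * ?t G \<xi>" using 1 by (simp only: mult_ac)
  qed
  also have "\<dots> = rooted_hom L V \<alpha> \<mu> \<psi> \<rho> F * rooted_hom L V \<alpha> \<mu> \<psi> \<rho> G"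
    unfolding rooted_hom_def sum_product ..
  finally show ?thesis .
qed

lemma edge_hom_munion:
  assumes "multigraph F" "multigraph G" "nodes F \<inter> nodes G = {}"
  shows "edge_hom V \<alpha> \<mu> (munion F G) = edge_hom V \<alpha> \<mu> F * edge_hom V \<alpha> \<mu> G"
  using rooted_hom_munion[of F G "{}" "\<lambda>_ _. 1" V \<alpha> \<mu> id] assms
  by (simp add: edge_hom_eq_rt[of _ V \<alpha> \<mu> id "\<lambda>_ _. 1"] multigraph_munion)

lemma rooted_hom_glue:
  assumes "F \<in> labeled_graphs n" "G \<in> labeled_graphs n"
    and "\<And>e k l. \<rho> e (k + l) = \<rho> e k * \<rho> e l" "\<And>e. \<rho> e 0 = 1"
  shows "rooted_hom {1..n} V \<alpha> \<mu> \<psi> \<rho> (glue n F G) = rooted_hom {1..n} V \<alpha> \<mu> \<psi> \<rho> F * rooted_hom {1..n} V \<alpha> \<mu> \<psi> \<rho> G"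
proof -
  let ?h = "\<lambda>v. if v \<in> {1..n} then v else n + 2 * v + 1"
  let ?k = "\<lambda>v. if v \<in> {1..n} then v else n + 2 * v + 2"
  have FG: "multigraph F" "multigraph G" using assms by (auto simp: labeled_graphs_def)
  have inj: "inj ?h" "inj ?k" by (auto simp: inj_on_def split: if_splits)
  have "nodes (rename ?h F) \<inter> nodes (rename ?k G) \<subseteq> {1..n}"
    by (auto simp: rename_def split: if_splits) presburger+
  then have "rooted_hom {1..n} V \<alpha> \<mu> \<psi> \<rho> (glue n F G) =
     rooted_hom {1..n} V \<alpha> \<mu> \<psi> \<rho> (rename ?h F) * rooted_hom {1..n} V \<alpha> \<mu> \<psi> \<rho> (rename ?k G)"
    unfolding glue_def using assms(3,4) FG inj
    by (intro rooted_hom_munion multigraph_rename)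
  also have "rooted_hom {1..n} V \<alpha> \<mu> \<psi> \<rho> (rename ?h F) = rooted_hom {1..n} V \<alpha> \<mu> \<psi> \<rho> F"
    using FG inj_on_subset[OF inj(1), of "nodes F"] by (intro rooted_hom_rename) auto
  also have "rooted_hom {1..n} V \<alpha> \<mu> \<psi> \<rho> (rename ?k G) = rooted_hom {1..n} V \<alpha> \<mu> \<psi> \<rho> G"
    using FG inj_on_subset[OF inj(2), of "nodes G"] by (intro rooted_hom_rename) auto
  finally show ?thesis .
qed

lemma glue_in_labeled_graphs:
  assumes "F \<in> labeled_graphs n" "G \<in> labeled_graphs n"
  shows "glue n F G \<in> labeled_graphs n"
proof -
  have "{1..n} \<subseteq> nodes (glue n F G)"
  proof
    fix x assume x: "x \<in> {1..n}"
    then have "x \<in> nodes F" using assms by (auto simp: labeled_graphs_def)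
    then have "x \<in> (\<lambda>v. if v \<in> {1..n} then v else n + 2 * v + 1) ` nodes F"
      using x by (intro image_eqI[of _ _ x]) auto
    then show "x \<in> nodes (glue n F G)" by (simp add: glue_def munion_def rename_def)
  qed
  then show ?thesis using assms multigraph_glue by (auto simp: labeled_graphs_def)
qed

text \<open>Bridge between the products over ordered pairs in \<open>hom\<close> and
  \<open>rhom\<close>, where non-edges occur with exponent 0, and the products over edges in
  \<open>edge_hom\<close>. \<open>Min\<close> and \<open>Max\<close> of the image merely pick some
  order of the two ends, which is harmless by symmetry.\<close>

lemma prod_ordered_pairs_eq_prod_edges:
  fixes w :: "nat \<Rightarrow> nat \<Rightarrow> nat \<Rightarrow> real"
  assumes F: "multigraph F" and phi: "\<phi> \<in> nodes F \<rightarrow> V"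
    and sym: "\<And>a b k. a \<in> V \<Longrightarrow> b \<in> V \<Longrightarrow> w a b k = w b a k"
    and zero: "\<And>a b. a \<in> V \<Longrightarrow> b \<in> V \<Longrightarrow> w a b 0 = 1"
  shows "(\<Prod>(i, j)\<in>{(i, j). i \<in> nodes F \<and> j \<in> nodes F \<and> i < j}. w (\<phi> i) (\<phi> j) (mult F i j)) =
    (\<Prod>e\<in>set_mset (edges F). w (Min (\<phi> ` e)) (Max (\<phi> ` e)) (count (edges F) e))"
proof -
  let ?P = "{(i, j). i \<in> nodes F \<and> j \<in> nodes F \<and> i < j}"
  let ?Q = "{(i, j). i \<in> nodes F \<and> j \<in> nodes F \<and> i < j \<and> {i, j} \<in># edges F}"
  have "finite (nodes F \<times> nodes F)" using F by (auto simp: multigraph_def)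
  then have finP: "finite ?P" by (rule finite_subset[rotated]) auto
  have "(\<Prod>(i, j)\<in>?P. w (\<phi> i) (\<phi> j) (mult F i j)) = (\<Prod>(i, j)\<in>?Q. w (\<phi> i) (\<phi> j) (mult F i j))"
  proof (intro prod.mono_neutral_right[OF finP] ballI)
    fix p assume "p \<in> ?P - ?Q"
    then obtain i j where "p = (i, j)" "i \<in> nodes F" "j \<in> nodes F" "{i, j} \<notin># edges F" by auto
    then show "(case p of (i, j) \<Rightarrow> w (\<phi> i) (\<phi> j) (mult F i j)) = 1"
      using phi zero by (auto simp: mult_def not_in_iff Pi_iff)
  qed auto
  also have "\<dots> = (\<Prod>e\<in>set_mset (edges F). w (Min (\<phi> ` e)) (Max (\<phi> ` e)) (count (edges F) e))"
  proof (rule prod.reindex_bij_witness[where j = "\<lambda>(i, j). {i, j}" and i = "\<lambda>e. (Min e, Max e)"])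
    fix e assume "e \<in># edges F"
    then obtain i j where "i < j" "e = {i, j}" "i \<in> nodes F" "j \<in> nodes F"
      using F by (auto elim: multigraph_edgeE)
    then show "(case (Min e, Max e) of (i, j) \<Rightarrow> {i, j}) = e" "(Min e, Max e) \<in> ?Q"
      using \<open>e \<in># edges F\<close> by auto
  next
    fix p assume "p \<in> ?Q"
    then obtain i j where p: "p = (i, j)" "i \<in> nodes F" "j \<in> nodes F" "i < j" "{i, j} \<in># edges F"
      by auto
    then show "(Min (case p of (i, j) \<Rightarrow> {i, j}), Max (case p of (i, j) \<Rightarrow> {i, j})) = p"
      "(case p of (i, j) \<Rightarrow> {i, j}) \<in># edges F" by auto
    have V: "\<phi> i \<in> V" "\<phi> j \<in> V" using phi p by auto
    show "w (Min (\<phi> ` (case p of (i, j) \<Rightarrow> {i, j}))) (Max (\<phi> ` (case p of (i, j) \<Rightarrow> {i, j})))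
          (count (edges F) (case p of (i, j) \<Rightarrow> {i, j})) =
         (case p of (i, j) \<Rightarrow> w (\<phi> i) (\<phi> j) (mult F i j))"
      using p sym[OF V] by (auto simp: mult_def min_def max_def)
  qed
  finally show ?thesis .
qed

section \<open>Positive functionals and finite moment problems\<close>

text \<open>The coefficient map \<open>C\<close> is left general because it is instantiated twice:
  by the embedding of the reals into the complex numbers and by the embedding of constants into the
  polynomials in edge variables.\<close>

lemma poly_map_poly_hom_add:
  fixes C :: "'a::comm_ring_1 \<Rightarrow> 'b::comm_ring_1"
  assumes "C 0 = 0" "\<And>a b. C (a + b) = C a + C b"
  shows "poly (map_poly C (p + q)) x = poly (map_poly C p) x + poly (map_poly C q) x"
  by (induction p q rule: poly_induct2)
     (simp_all add: map_poly_pCons assms algebra_simps)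

lemma poly_map_poly_hom_smult:
  fixes C :: "'a::comm_ring_1 \<Rightarrow> 'b::comm_ring_1"
  assumes "C 0 = 0" "\<And>a b. C (a * b) = C a * C b"
  shows "poly (map_poly C (smult c p)) x = C c * poly (map_poly C p) x"
  by (induction p) (simp_all add: map_poly_pCons assms algebra_simps)

lemma poly_map_poly_hom_mult:
  fixes C :: "'a::comm_ring_1 \<Rightarrow> 'b::comm_ring_1"
  assumes "C 0 = 0" "\<And>a b. C (a + b) = C a + C b" "\<And>a b. C (a * b) = C a * C b"
  shows "poly (map_poly C (p * q)) x = poly (map_poly C p) x * poly (map_poly C q) x"
  by (induction p)
     (simp_all add: map_poly_pCons poly_map_poly_hom_add poly_map_poly_hom_smult assms algebra_simps)

lemma linear_nonneg_imp_zero: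
  fixes b c :: real
  assumes "\<And>t. 2 * t * b + c \<ge> 0"
  shows "b = 0"
proof (rule ccontr)
  assume "b \<noteq> 0"
  then have "2 * ((- c - 1) / (2 * b)) * b + c = -1" by (simp add: field_simps)
  then show False using assms[of "(- c - 1) / (2 * b)"] by simp
qed

definition node_poly :: "real set \<Rightarrow> real poly" where
  "node_poly B = (\<Prod>b\<in>B. [:-b, 1:])"

lemma poly_node_poly_eq_0_iff: "finite B \<Longrightarrow> poly (node_poly B) x = 0 \<longleftrightarrow> x \<in> B"
  by (auto simp: node_poly_def poly_prod prod_zero_iff)

lemma node_poly_dvd:
  assumes "finite B" "\<And>b. b \<in> B \<Longrightarrow> poly q b = 0"
  shows "node_poly B dvd q"
  using assms
proof (induction B arbitrary: q rule: finite_induct)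
  case empty
  then show ?case by (simp add: node_poly_def)
next
  case (insert a B)
  have "[:-a, 1:] dvd q" using insert.prems by (simp add: poly_eq_0_iff_dvd)
  then obtain s where s: "q = [:-a, 1:] * s" by (auto elim: dvdE)
  have "poly s b = 0" if "b \<in> B" for b
  proof -
    have "(b - a) * poly s b = 0" using insert.prems[of b] that by (simp add: s algebra_simps)
    then show ?thesis using insert.hyps that by auto
  qed
  from insert.IH[OF this] show ?case
    using insert.hyps by (simp add: s node_poly_def mult_dvd_mono del: mult_pCons_left)
qed

text \<open>A conjugate pair of roots \<open>a \<plusminus> ib\<close> may be removed since \<open>((x - a)\<^sup>2 + b\<^sup>2) s\<^sup>2\<close> is a sum of two
  squares.\<close>

lemma positive_functional_annihilates_node_poly:
  fixes l :: "real poly \<Rightarrow> real"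
  assumes "p \<noteq> 0"
    and "\<And>p q. l (p + q) = l p + l q" "\<And>c p. l (smult c p) = c * l p"
    and "\<And>q. l (q * q) \<ge> 0" and "\<And>q. l (p * q) = 0"
  shows "\<exists>B. finite B \<and> (\<forall>q. l (node_poly B * q) = 0)"
  using assms
proof (induction "degree p" arbitrary: p l rule: less_induct)
  case less
  note add = less.prems(2) and smult = less.prems(3) and pos = less.prems(4)
  \<comment> \<open>Cauchy-Schwarz for the semidefinite form \<open>l (p * q)\<close>: a polynomial
    whose square has value 0 is orthogonal to everything.\<close>
  have annih: "l (r * q) = 0" if "l (r * r) = 0" for r q
  proof -
    have "0 \<le> 2 * t * l (r * q) + l (q * q)" for t
    proof -
      have "(smult t r + q) * (smult t r + q) = smult (t * t) (r * r) + (smult (2 * t) (r * q) + q * q)"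
      proof -
        have "smult (2 * t) (r * q) = smult t (r * q) + smult t (r * q)" by (simp flip: smult_add_left)
        then show ?thesis by (simp add: algebra_simps)
      qed
      then show ?thesis using pos[of "smult t r + q"] that by (simp add: add smult)
    qed
    from linear_nonneg_imp_zero[OF this] show ?thesis .
  qed
  show ?case
  proof (cases "degree p = 0")
    case True
    then obtain c where c: "p = [:c:]" "c \<noteq> 0" using less.prems(1) by (auto elim: degree_eq_zeroE)
    have "l q = 0" for q using less.prems(5)[of q] c by (simp add: smult)
    then show ?thesis by (intro exI[of _ "{}"]) auto
  next
    case False
    let ?C = "complex_of_real"
    have "\<exists>z. poly (map_poly ?C p) z = 0"
      using False by (intro alg_closed_imp_poly_has_root) (simp add: degree_map_poly)
    then obtain z where z: "poly (map_poly ?C p) z = 0" by blast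
    show ?thesis
    proof (cases "Im z = 0")
      case True
      define a where "a = Re z"
      have za: "z = ?C a" using True by (simp add: a_def complex_eq_iff)
      have "poly (map_poly ?C p) (?C a) = ?C (poly p a)"
        by (induction p) (simp_all add: map_poly_pCons)
      then have "poly p a = 0" using z za by simp
      then obtain s where s: "p = [:-a, 1:] * s" by (auto simp: poly_eq_0_iff_dvd elim: dvdE)
      then have "s \<noteq> 0" using less.prems(1) by auto
      then have "degree p = 1 + degree s" unfolding s by (subst degree_mult_eq) auto
      then have deg: "degree s < degree p" by simp
      \<comment> \<open>Weighting by the square of \<open>[:-a, 1:]\<close> keeps positivity, and
        the weighted functional is annihilated by the cofactor \<open>s\<close>, which has smaller
        degree.\<close>
      define l' where "l' q = l ([:-a, 1:] * [:-a, 1:] * q)" for q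
      have "\<exists>B. finite B \<and> (\<forall>q. l' (node_poly B * q) = 0)"
      proof (rule less.hyps[OF deg \<open>s \<noteq> 0\<close>])
        show "l' (s * q) = 0" for q
          using less.prems(5)[of "[:-a, 1:] * q"] by (simp only: l'_def s mult_ac)
        show "l' (q * q) \<ge> 0" for q
          using pos[of "[:-a, 1:] * q"] by (simp only: l'_def mult_ac)
      qed (simp_all only: l'_def add smult distrib_left mult_smult_right)
      then obtain B where B: "finite B" "\<And>q. l' (node_poly B * q) = 0" by blast
      \<comment> \<open>Since \<open>l'\<close> vanishes on the square of
        \<open>node_poly B\<close>, the functional \<open>l\<close> vanishes on the square of
        \<open>[:-a, 1:] * node_poly B\<close>.\<close>
      have *: "l ([:-a, 1:] * node_poly B * q) = 0" for q
        by (rule annih) (use B(2)[of "node_poly B"] in \<open>simp only: l'_def mult_ac\<close>)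
      show ?thesis
      proof (cases "a \<in> B")
        case False
        then show ?thesis using * B(1)
          by (intro exI[of _ "insert a B"]) (simp add: node_poly_def)
      next
        case True
        \<comment> \<open>Here the root \<open>a\<close> would become double. The square of
          \<open>node_poly B\<close> is a multiple of the polynomial just found, so
          \<open>node_poly B\<close> itself already annihilates \<open>l\<close> and the roots stay
          simple.\<close>
        have N: "node_poly B = [:-a, 1:] * node_poly (B - {a})"
          unfolding node_poly_def using B(1) True by (rule prod.remove)
        have "l (node_poly B * node_poly B) = 0"
          using *[of "node_poly (B - {a})"] unfolding N by (simp only: mult_ac)
        then show ?thesis using annih B(1) by blast
      qed
    next
      case im: False
      define a b where "a = Re z" and "b = Im z"
      have zab: "z = Complex a b" by (simp add: a_def b_def)
      define d where "d = [:a * a + b * b, -2 * a, 1:]"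
      have dz: "poly (map_poly ?C d) z = 0"
        by (simp add: d_def map_poly_pCons zab complex_eq_iff algebra_simps)
      define r where "r = p mod d"
      have "degree d = 2" "d \<noteq> 0" by (simp_all add: d_def)
      then have "degree r < 2 \<or> r = 0" unfolding r_def using degree_mod_less[of d p] by auto
      then have "degree r < 2" by auto
      have p: "p = d * (p div d) + r" by (simp add: r_def)
      have "poly (map_poly ?C p) z = poly (map_poly ?C r) z"
        by (subst p) (simp add: poly_map_poly_hom_add poly_map_poly_hom_mult dz)
      then have rz: "poly (map_poly ?C r) z = 0" using z by simp
      obtain r0 r1 where r01: "r = [:r0, r1:]"
      proof -
        have "r = [:coeff r 0, coeff r 1:]"
        proof (rule poly_eqI)
          fix n
          show "coeff r n = coeff [:coeff r 0, coeff r 1:] n"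
            using \<open>degree r < 2\<close>
            by (cases n; cases "n - 1") (auto simp: coeff_eq_0 coeff_pCons split: nat.splits)
        qed
        then show thesis using that by blast
      qed
      \<comment> \<open>The remainder is real, of degree below 2, and has a non-real root, so it is
        zero.\<close>
      have "r1 * b = 0" "r0 + r1 * a = 0"
        using rz by (simp_all add: r01 map_poly_pCons zab complex_eq_iff algebra_simps)
      then have "r = 0" using im by (simp add: r01 b_def)
      define s where "s = p div d"
      have s: "p = d * s" using p \<open>r = 0\<close> by (simp add: s_def)
      then have "s \<noteq> 0" using less.prems(1) by auto
      then have "degree p = degree d + degree s" unfolding s using \<open>d \<noteq> 0\<close> by (subst degree_mult_eq) auto
      then have deg: "degree s < degree p" using \<open>degree d = 2\<close> by simp
      have "d * s * s = ([:-a, 1:] * s) * ([:-a, 1:] * s) + smult (b * b) (s * s)"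
      proof -
        have "d = [:-a, 1:] * [:-a, 1:] + [:b * b:]" by (simp add: d_def)
        then show ?thesis by (simp only: distrib_right mult_ac) (simp add: algebra_simps smult_add_left)
      qed
      then have "l (([:-a, 1:] * s) * ([:-a, 1:] * s)) + b * b * l (s * s) = 0"
        using less.prems(5)[of s] by (simp add: s add smult)
      moreover have "b * b > 0" using im by (simp add: b_def zero_less_mult_iff) linarith
      ultimately have "\<not> l (s * s) > 0"
        using pos[of "[:-a, 1:] * s"] mult_pos_pos[of "b * b" "l (s * s)"] by linarith
      then have "l (s * s) = 0" using pos[of s] by linarith
      from less.hyps[OF deg \<open>s \<noteq> 0\<close> add smult pos annih[OF this]] show ?thesis .
    qed
  qed
qed

section \<open>Polynomials in edge variables and their linear functionals\<close>

definition lin_ext :: "('a \<Rightarrow> real) \<Rightarrow> ('a \<Rightarrow>\<^sub>0 real) \<Rightarrow> real" where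
  "lin_ext h p = (\<Sum>a\<in>Poly_Mapping.keys p. Poly_Mapping.lookup p a * h a)"

lemma lin_ext_superset:
  assumes "finite S" "Poly_Mapping.keys p \<subseteq> S"
  shows "lin_ext h p = (\<Sum>a\<in>S. Poly_Mapping.lookup p a * h a)"
  unfolding lin_ext_def using assms
  by (intro sum.mono_neutral_left) (auto simp: in_keys_iff)

lemma lin_ext_add: "lin_ext h (p + q) = lin_ext h p + lin_ext h q"
proof -
  let ?S = "Poly_Mapping.keys p \<union> Poly_Mapping.keys q"
  have "lin_ext h (p + q) = (\<Sum>a\<in>?S. Poly_Mapping.lookup (p + q) a * h a)"
    by (intro lin_ext_superset) (use keys_add[of p q] in auto)
  moreover have "lin_ext h p = (\<Sum>a\<in>?S. Poly_Mapping.lookup p a * h a)"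
    "lin_ext h q = (\<Sum>a\<in>?S. Poly_Mapping.lookup q a * h a)"
    by (intro lin_ext_superset; auto)+
  ultimately show ?thesis by (simp add: lookup_add algebra_simps sum.distrib)
qed

lemma lin_ext_single: "lin_ext h (Poly_Mapping.single a x) = x * h a"
  by (simp add: lin_ext_def)

lemma lin_ext_0: "lin_ext h 0 = 0"
  by (simp add: lin_ext_def)

lemma lin_ext_sum: "lin_ext h (\<Sum>i\<in>I. p i) = (\<Sum>i\<in>I. lin_ext h (p i))"
  by (induction I rule: infinite_finite_induct) (simp_all add: lin_ext_0 lin_ext_add)

lemma poly_mapping_eq_sum_single:
  "p = (\<Sum>a\<in>Poly_Mapping.keys p. Poly_Mapping.single a (Poly_Mapping.lookup p a))"
  by (rule poly_mapping_eqI) (auto simp: lookup_sum lookup_single when_def in_keys_iff)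

lemma lin_ext_scale:
  fixes p :: "'a::comm_monoid_add \<Rightarrow>\<^sub>0 real"
  shows "lin_ext h (Poly_Mapping.single 0 c * p) = c * lin_ext h p"
proof -
  have "Poly_Mapping.single 0 c * p =
      (\<Sum>a\<in>Poly_Mapping.keys p. Poly_Mapping.single a (c * Poly_Mapping.lookup p a))"
    by (subst (1) poly_mapping_eq_sum_single[of p]) (simp add: sum_distrib_left mult_single)
  then show ?thesis by (simp add: lin_ext_sum lin_ext_single lin_ext_def[of h p] sum_distrib_left mult.assoc)
qed

lemma lin_ext_minus: "lin_ext h (p - q) = lin_ext h p - lin_ext h q"
  using lin_ext_add[of h "p - q" q] by simp

text \<open>Finitely supported functions on multisets of edges, with convolution as product, form
  the polynomial ring with one variable per edge. Adding edge multisets, that is multiplying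
  monomials, is the gluing of fully labeled graphs.\<close>

abbreviation const_edge :: "real \<Rightarrow> nat set multiset \<Rightarrow>\<^sub>0 real" where
  "const_edge \<equiv> Poly_Mapping.single 0"

abbreviation edge_var :: "nat set \<Rightarrow> nat set multiset \<Rightarrow>\<^sub>0 real" where
  "edge_var e \<equiv> Poly_Mapping.single {#e#} 1"

definition edge_poly :: "real poly \<Rightarrow> nat set \<Rightarrow> nat set multiset \<Rightarrow>\<^sub>0 real" where
  "edge_poly p e = poly (map_poly const_edge p) (edge_var e)"

lemma const_edge_hom:
  "const_edge 0 = 0" "const_edge (a + b) = const_edge a + const_edge b"
  "const_edge (a * b) = const_edge a * const_edge b"
  by (simp_all add: single_add mult_single)

lemma edge_poly_0 [simp]: "edge_poly 0 e = 0"
  by (simp add: edge_poly_def)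

lemma edge_poly_pCons: "edge_poly (pCons a p) e = const_edge a + edge_var e * edge_poly p e"
  by (simp add: edge_poly_def map_poly_pCons const_edge_hom)

lemma edge_poly_add: "edge_poly (p + q) e = edge_poly p e + edge_poly q e"
  unfolding edge_poly_def by (intro poly_map_poly_hom_add const_edge_hom)

lemma edge_poly_mult: "edge_poly (p * q) e = edge_poly p e * edge_poly q e"
  unfolding edge_poly_def by (intro poly_map_poly_hom_mult const_edge_hom)

lemma edge_poly_smult: "edge_poly (smult c p) e = const_edge c * edge_poly p e"
  unfolding edge_poly_def by (intro poly_map_poly_hom_smult const_edge_hom)

lemma edge_poly_diff: "edge_poly (p - q) e = edge_poly p e - edge_poly q e"
  using edge_poly_add[of "p - q" q e] by simp

lemma edge_poly_sum: "edge_poly (\<Sum>i\<in>I. p i) e = (\<Sum>i\<in>I. edge_poly (p i) e)"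
  by (induction I rule: infinite_finite_induct) (simp_all add: edge_poly_add)

lemma edge_poly_monom: "edge_poly (monom 1 k) e = Poly_Mapping.single (replicate_mset k e) 1"
  by (induction k) (simp_all add: monom_0 monom_Suc edge_poly_pCons mult_single)

lemma lin_ext_edge_poly:
  "lin_ext h (edge_poly p e) = (\<Sum>k\<le>degree p. coeff p k * h (replicate_mset k e))"
proof -
  have "edge_poly p e = edge_poly (\<Sum>k\<le>degree p. smult (coeff p k) (monom 1 k)) e"
    by (simp add: smult_monom poly_as_sum_of_monoms)
  then show ?thesis
    by (simp add: edge_poly_sum edge_poly_smult edge_poly_monom mult_single lin_ext_sum lin_ext_single)
qed

definition edge_algebra :: "nat set set \<Rightarrow> (nat set multiset \<Rightarrow>\<^sub>0 real) set" where
  "edge_algebra E = {p. \<forall>a\<in>Poly_Mapping.keys p. set_mset a \<subseteq> E}"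

lemma edge_algebra_single: "set_mset a \<subseteq> E \<Longrightarrow> Poly_Mapping.single a x \<in> edge_algebra E"
  by (auto simp: edge_algebra_def split: if_splits)

lemma edge_algebra_0: "0 \<in> edge_algebra E"
  and edge_algebra_1: "1 \<in> edge_algebra E"
  by (auto simp: edge_algebra_def)

lemma edge_algebra_add: "p \<in> edge_algebra E \<Longrightarrow> q \<in> edge_algebra E \<Longrightarrow> p + q \<in> edge_algebra E"
  using keys_add[of p q] by (fastforce simp: edge_algebra_def)

lemma edge_algebra_mult: "p \<in> edge_algebra E \<Longrightarrow> q \<in> edge_algebra E \<Longrightarrow> p * q \<in> edge_algebra E"
  using keys_mult[of p q] by (fastforce simp: edge_algebra_def)

lemma edge_algebra_prod: "(\<And>i. i \<in> I \<Longrightarrow> p i \<in> edge_algebra E) \<Longrightarrow> (\<Prod>i\<in>I. p i) \<in> edge_algebra E"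
  by (induction I rule: infinite_finite_induct) (auto simp: edge_algebra_1 edge_algebra_mult)

lemma edge_poly_in_edge_algebra: "e \<in> E \<Longrightarrow> edge_poly p e \<in> edge_algebra E"
  by (induction p)
     (auto simp: edge_algebra_0 edge_poly_pCons intro!: edge_algebra_add edge_algebra_mult edge_algebra_single)

text \<open>Cauchy-Schwarz again, now in several variables and inside the subalgebra on which
  positivity is known.\<close>

lemma positive_functional_annihilates:
  assumes pos: "\<And>p. p \<in> edge_algebra E \<Longrightarrow> lin_ext h (p * p) \<ge> 0"
    and p: "p \<in> edge_algebra E" "lin_ext h (p * p) = 0" and q: "q \<in> edge_algebra E"
  shows "lin_ext h (p * q) = 0"
proof -
  have "0 \<le> 2 * t * lin_ext h (p * q) + lin_ext h (q * q)" for t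
  proof -
    let ?r = "const_edge t * p + q"
    have "?r * ?r = const_edge (t * t) * (p * p) + (const_edge (2 * t) * (p * q) + q * q)"
    proof -
      have "const_edge (2 * t) = const_edge t + const_edge t" by (simp flip: single_add)
      then show ?thesis by (simp add: const_edge_hom algebra_simps)
    qed
    moreover have "?r \<in> edge_algebra E"
      using p q by (intro edge_algebra_add edge_algebra_mult edge_algebra_single) auto
    ultimately show ?thesis using pos[of ?r] p(2) by (simp add: lin_ext_add lin_ext_scale)
  qed
  from linear_nonneg_imp_zero[OF this] show ?thesis .
qed

text \<open>The radical \<open>I\<close> of the form is an ideal, and it contains
  \<open>node_poly B\<close> in every variable. Modulo \<open>I\<close> the functional therefore
  lives on functions on the grid of colourings \<open>E \<rightarrow> B\<close>. The mass of a
  colouring \<open>c\<close> is the value at its indicator function, a product of Lagrange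
  polynomials; it is nonnegative because the indicator is congruent to its own square.\<close>

lemma finite_moment_representation:
  assumes E: "finite E" and B: "finite B"
    and pos: "\<And>p. p \<in> edge_algebra E \<Longrightarrow> lin_ext h (p * p) \<ge> 0"
    and null: "\<And>e. e \<in> E \<Longrightarrow> lin_ext h (edge_poly (node_poly B) e * edge_poly (node_poly B) e) = 0"
  shows "\<exists>\<mu>. (\<forall>c\<in>E \<rightarrow>\<^sub>E B. \<mu> c \<ge> 0) \<and>
    (\<forall>a. set_mset a \<subseteq> E \<longrightarrow> h a = (\<Sum>c\<in>E \<rightarrow>\<^sub>E B. \<mu> c * (\<Prod>e\<in>E. c e ^ count a e)))"
proof -
  define I where "I = {p \<in> edge_algebra E. \<forall>q\<in>edge_algebra E. lin_ext h (p * q) = 0}"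
  have I_lin: "lin_ext h p = 0" if "p \<in> I" for p
  proof -
    have "lin_ext h (p * 1) = 0" using that edge_algebra_1[of E] unfolding I_def by blast
    then show ?thesis by simp
  qed
  have I_add: "p + q \<in> I" if "p \<in> I" "q \<in> I" for p q
    using that by (auto simp: I_def edge_algebra_add distrib_right lin_ext_add)
  have I_mult: "p * q \<in> I" if "p \<in> I" "q \<in> edge_algebra E" for p q
    using that by (auto simp: I_def edge_algebra_mult mult.assoc)
  \<comment> \<open>Congruences modulo an ideal may be multiplied, by telescoping.\<close>
  have I_prod: "(\<Prod>e\<in>E'. u e) - (\<Prod>e\<in>E'. v e) \<in> I"
    if "finite E'" "\<And>e. e \<in> E' \<Longrightarrow> u e \<in> edge_algebra E" "\<And>e. e \<in> E' \<Longrightarrow> v e \<in> edge_algebra E"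
      "\<And>e. e \<in> E' \<Longrightarrow> u e - v e \<in> I" for E' u v
    using that
  proof (induction E' rule: finite_induct)
    case empty
    then show ?case by (auto simp: I_def edge_algebra_0 lin_ext_0)
  next
    case (insert x F)
    have "(\<Prod>e\<in>insert x F. u e) - (\<Prod>e\<in>insert x F. v e) =
      (u x - v x) * (\<Prod>e\<in>F. u e) + ((\<Prod>e\<in>F. u e) - (\<Prod>e\<in>F. v e)) * v x"
      using insert.hyps by (simp add: algebra_simps)
    also have "\<dots> \<in> I" using insert by (intro I_add I_mult edge_algebra_prod) auto
    finally show ?case .
  qed
  have nodeI: "edge_poly (node_poly B) e \<in> I" if "e \<in> E" for e
    using that positive_functional_annihilates[OF pos _ null] edge_poly_in_edge_algebra
    by (auto simp: I_def)
  have dvdI: "edge_poly q e \<in> I" if "e \<in> E" "\<And>b. b \<in> B \<Longrightarrow> poly q b = 0" for q e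
  proof -
    have "node_poly B dvd q" using node_poly_dvd[OF B] that(2) by blast
    then obtain s where "q = node_poly B * s" by (elim dvdE)
    then show ?thesis using nodeI[OF that(1)] that(1)
      by (simp add: edge_poly_mult I_mult edge_poly_in_edge_algebra)
  qed
  define lag where "lag b = smult (inverse (poly (node_poly (B - {b})) b)) (node_poly (B - {b}))" for b
  have lag: "poly (lag b) a = (if a = b then 1 else 0)" if "a \<in> B" "b \<in> B" for a b
    using that B poly_node_poly_eq_0_iff[of "B - {b}"] by (auto simp: lag_def)
  define \<mu> where "\<mu> c = lin_ext h (\<Prod>e\<in>E. edge_poly (lag (c e)) e)" for c
  have "\<mu> c \<ge> 0" if c: "c \<in> E \<rightarrow>\<^sub>E B" for c
  proof -
    let ?P = "\<Prod>e\<in>E. edge_poly (lag (c e)) e"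
    \<comment> \<open>A Lagrange polynomial takes only the values 0 and 1 on \<open>B\<close>, so it
      is idempotent modulo \<open>I\<close>.\<close>
    have "(\<Prod>e\<in>E. edge_poly (lag (c e) * lag (c e)) e) - ?P \<in> I"
    proof (rule I_prod[OF E])
      fix e assume e: "e \<in> E"
      then show "edge_poly (lag (c e) * lag (c e)) e - edge_poly (lag (c e)) e \<in> I"
        unfolding edge_poly_diff[symmetric] using e lag[OF _ PiE_mem[OF c e]] by (intro dvdI) auto
    qed (auto intro: edge_poly_in_edge_algebra)
    then have "lin_ext h ?P = lin_ext h (?P * ?P)"
      using I_lin by (fastforce simp: edge_poly_mult prod.distrib lin_ext_minus)
    then show ?thesis unfolding \<mu>_def
      using pos[of ?P] by (simp add: edge_algebra_prod edge_poly_in_edge_algebra)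
  qed
  moreover have "h a = (\<Sum>c\<in>E \<rightarrow>\<^sub>E B. \<mu> c * (\<Prod>e\<in>E. c e ^ count a e))" if a: "set_mset a \<subseteq> E" for a
  proof -
    have single_prod: "Poly_Mapping.single (\<Sum>e\<in>E'. f e) (1::real) = (\<Prod>e\<in>E'. Poly_Mapping.single (f e) 1)"
      for E' and f :: "nat set \<Rightarrow> nat set multiset"
    proof (induction E' rule: infinite_finite_induct)
      case (insert x F)
      then show ?case using mult_single[of "f x" "1::real" "sum f F" 1] by simp
    qed simp_all
    have "a = (\<Sum>e\<in>E. replicate_mset (count a e) e)"
      using a E by (intro multiset_eqI) (auto simp: count_sum sum.delta not_in_iff)
    then have 1: "Poly_Mapping.single a 1 = (\<Prod>e\<in>E. edge_poly (monom 1 (count a e)) e)"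
      by (metis (no_types, lifting) single_prod edge_poly_monom prod.cong)
    \<comment> \<open>Each power is congruent to its interpolation polynomial on \<open>B\<close>;
      expanding the product of these turns the sum over \<open>B\<close> per edge into a sum over
      colourings.\<close>
    have "(\<Prod>e\<in>E. edge_poly (monom 1 (count a e)) e) -
       (\<Prod>e\<in>E. edge_poly (\<Sum>b\<in>B. smult (b ^ count a e) (lag b)) e) \<in> I"
    proof (rule I_prod[OF E])
      fix e assume e: "e \<in> E"
      have "poly (\<Sum>b\<in>B. smult (b ^ k) (lag b)) x = x ^ k" if "x \<in> B" for x k
        using that B by (simp add: poly_sum lag if_distrib[of "(*) _"] sum.delta' cong: if_cong)
      then show "edge_poly (monom 1 (count a e)) e - edge_poly (\<Sum>b\<in>B. smult (b ^ count a e) (lag b)) e \<in> I"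
        unfolding edge_poly_diff[symmetric] by (intro dvdI[OF e]) (simp add: poly_monom)
    qed (auto intro: edge_poly_in_edge_algebra)
    then have "h a = lin_ext h (\<Prod>e\<in>E. edge_poly (\<Sum>b\<in>B. smult (b ^ count a e) (lag b)) e)"
      using I_lin unfolding 1[symmetric] by (fastforce simp: lin_ext_minus lin_ext_single)
    also have "(\<Prod>e\<in>E. edge_poly (\<Sum>b\<in>B. smult (b ^ count a e) (lag b)) e) =
       (\<Prod>e\<in>E. \<Sum>b\<in>B. const_edge (b ^ count a e) * edge_poly (lag b) e)"
      by (simp add: edge_poly_sum edge_poly_smult)
    also have "\<dots> = (\<Sum>c\<in>E \<rightarrow>\<^sub>E B. \<Prod>e\<in>E. const_edge (c e ^ count a e) * edge_poly (lag (c e)) e)"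
      using E B by (subst prod_sum_PiE) auto
    also have "\<dots> = (\<Sum>c\<in>E \<rightarrow>\<^sub>E B. const_edge (\<Prod>e\<in>E. c e ^ count a e) * (\<Prod>e\<in>E. edge_poly (lag (c e)) e))"
    proof -
      have "(\<Prod>e\<in>E'. const_edge (f e)) = const_edge (\<Prod>e\<in>E'. f e)" for E' :: "nat set set" and f
        by (induction E' rule: infinite_finite_induct) (simp_all add: const_edge_hom)
      then show ?thesis by (simp add: prod.distrib)
    qed
    finally have "h a = (\<Sum>c\<in>E \<rightarrow>\<^sub>E B. (\<Prod>e\<in>E. c e ^ count a e) * \<mu> c)"
      by (simp only: lin_ext_sum lin_ext_scale \<mu>_def)
    then show ?thesis by (simp only: mult.commute)
  qed
  ultimately show ?thesis by blast
qed

section \<open>Weakly reflection positive multiplicative parameters\<close>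

definition pairs :: "nat \<Rightarrow> nat set set" where
  "pairs n = {e. e \<subseteq> {1..n} \<and> card e = 2}"

definition lgraph :: "nat \<Rightarrow> nat set multiset \<Rightarrow> mgraph" where
  "lgraph n a = \<lparr>nodes = {1..n}, edges = a\<rparr>"

lemma finite_pairs: "finite (pairs n)"
  by (rule finite_subset[of _ "Pow {1..n}"]) (auto simp: pairs_def)

lemma multigraph_lgraph: "n \<ge> 1 \<Longrightarrow> set_mset a \<subseteq> pairs n \<Longrightarrow> multigraph (lgraph n a)"
  by (auto simp: multigraph_def lgraph_def pairs_def)

lemma lgraph_in_fully_labeled_graphs:
  "n \<ge> 1 \<Longrightarrow> set_mset a \<subseteq> pairs n \<Longrightarrow> lgraph n a \<in> fully_labeled_graphs n"
  using multigraph_lgraph by (auto simp: fully_labeled_graphs_def lgraph_def)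

lemma lgraph_in_labeled_graphs:
  "n \<ge> 1 \<Longrightarrow> set_mset a \<subseteq> pairs n \<Longrightarrow> lgraph n a \<in> labeled_graphs n"
  using multigraph_lgraph by (auto simp: labeled_graphs_def lgraph_def)

lemma glue_lgraph:
  assumes "set_mset a \<subseteq> pairs n" "set_mset b \<subseteq> pairs n"
  shows "glue n (lgraph n a) (lgraph n b) = lgraph n (a + b)"
proof -
  have "rename h (lgraph n a) = lgraph n a"
    if "\<And>v. v \<in> {1..n} \<Longrightarrow> h v = v" "set_mset a \<subseteq> pairs n" for h a
  proof -
    have "h ` {1..n} = id ` {1..n}" using that by (intro image_cong) auto
    moreover have "image_mset ((`) h) a = image_mset id a"
    proof (rule image_mset_cong)
      fix e assume "e \<in># a"
      then have "e \<subseteq> {1..n}" using that by (auto simp: pairs_def)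
      then have "h ` e = id ` e" using that(1) by (intro image_cong) auto
      then show "h ` e = id e" by simp
    qed
    ultimately show ?thesis by (simp add: rename_def lgraph_def)
  qed
  then show ?thesis unfolding glue_def using assms
    by (simp add: munion_def lgraph_def)
qed

lemma multigraph_rename_inj_on:
  assumes "multigraph F" "inj_on h (nodes F)"
  shows "multigraph (rename h F)"
  using assms unfolding multigraph_def rename_def
  by (auto simp: card_image inj_on_subset)

lemma replicate_mset_add: "replicate_mset k x + replicate_mset j x = replicate_mset (k + j) x"
  by (induction k) simp_all

text \<open>The rank counts sets of rows, while \<open>F\<close> is a sequence in which a row may
  recur. If it does, the difference of the two equal rows is the dependency.\<close>

lemma rank_finite_imp_dependent:
  assumes rank: "matrix_rank R C A = enat r" and F: "\<And>k. F k \<in> R"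
  shows "\<exists>u. (\<exists>k\<le>r. u k \<noteq> 0) \<and> (\<forall>y\<in>C. (\<Sum>k\<le>r. u k * A (F k) y) = 0)"
proof (cases "inj_on F {..r}")
  case True
  let ?S = "F ` {..r}"
  have card: "card ?S = Suc r" using True by (simp add: card_image)
  have "\<not> rows_independent ?S C A"
  proof
    assume "rows_independent ?S C A"
    then have "enat (card ?S) \<le> matrix_rank R C A"
      unfolding matrix_rank_def using F by (intro Sup_upper) blast
    then show False using rank card by simp
  qed
  then obtain u where u: "\<forall>y\<in>C. (\<Sum>x\<in>?S. u x * A x y) = 0" "\<exists>x\<in>?S. u x \<noteq> 0"
    unfolding rows_independent_def by blast
  then show ?thesis using True
    by (intro exI[of _ "u \<circ> F"]) (auto simp: sum.reindex)
next
  case False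
  then obtain i j where ij: "i \<le> r" "j \<le> r" "i \<noteq> j" "F i = F j" by (auto simp: inj_on_def)
  define u :: "nat \<Rightarrow> real" where "u k = (if k = i then 1 else if k = j then -1 else 0)" for k
  have "(\<Sum>k\<le>r. u k * A (F k) y) = 0" for y
  proof -
    have "(\<Sum>k\<le>r. u k * A (F k) y) = (\<Sum>k\<in>{i, j}. u k * A (F k) y)"
      using ij by (intro sum.mono_neutral_right) (auto simp: u_def)
    also have "\<dots> = 0" using ij by (simp add: u_def)
    finally show ?thesis .
  qed
  then show ?thesis using ij by (intro exI[of _ u]) (auto simp: u_def)
qed

text \<open>Allows one sequence of colourings to approximate the parameter on all multigraphs at
  once.\<close>

lemma countable_multigraphs: "countable {F. multigraph F}"
proof -
  let ?e = "\<lambda>F. (set_encode (nodes F), sorted_list_of_multiset (image_mset set_encode (edges F)))"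
  have fin: "finite e" if "multigraph F" "e \<in># edges F" for F e
    using that finite_subset by (auto simp: multigraph_def)
  have "inj_on ?e {F. multigraph F}"
  proof (rule inj_onI, clarsimp)
    fix F G assume FG: "multigraph F" "multigraph G"
      and n: "set_encode (nodes F) = set_encode (nodes G)"
      and e': "sorted_list_of_multiset (image_mset set_encode (edges F)) =
        sorted_list_of_multiset (image_mset set_encode (edges G))"
    have e: "image_mset set_encode (edges F) = image_mset set_encode (edges G)"
      using arg_cong[OF e', of mset] by simp
    have "nodes F = nodes G"
      using n FG by (metis multigraph_def set_encode_inverse)
    moreover have *: "image_mset set_decode (image_mset set_encode (edges H)) = edges H"
      if "multigraph H" for H
    proof -
      have "image_mset set_decode (image_mset set_encode (edges H)) = image_mset id (edges H)"
        unfolding image_mset.compositionality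
        using fin[OF that] by (intro image_mset_cong) simp
      then show ?thesis by simp
    qed
    have "edges F = edges G" using *[OF FG(1)] unfolding e *[OF FG(2)] by (rule sym)
    ultimately show "F = G" by simp
  qed
  then show ?thesis by (rule countableI')
qed

text \<open>Colourings of the pairs in \<open>{1..n}\<close> are total functions on sets, with an arbitrary value on
  singletons; these occur only for non-injective maps.\<close>

abbreviation density :: "nat \<Rightarrow> (nat set \<Rightarrow> real) \<Rightarrow> mgraph \<Rightarrow> real" where
  "density n g \<equiv> edge_hom {1..n} (\<lambda>_. 1 / real n) (\<lambda>A k. g A ^ k)"

locale reflection_positive_parameter =
  fixes f :: "mgraph \<Rightarrow> real"
  assumes param: "graph_parameter f"
    and positive: "weakly_reflection_positive f"
    and mult: "multiplicative f"
    and nonzero: "\<exists>F. multigraph F \<and> f F \<noteq> 0"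
begin

definition K1 :: real where "K1 = f (lgraph 1 {#})"

text \<open>By multiplicativity an isolated node contributes the factor \<open>K1\<close>. After
  division by it, isolated nodes are neutral, so \<open>F\<close> has the same value as any embedded
  copy of it inside a larger node set \<open>{1..n}\<close>.\<close>

definition norm_param :: "mgraph \<Rightarrow> real" where "norm_param F = f F / K1 ^ card (nodes F)"

lemma f_rename: "multigraph F \<Longrightarrow> inj_on h (nodes F) \<Longrightarrow> f (rename h F) = f F"
  using param[unfolded graph_parameter_def isomorphic_def, rule_format, of F "rename h F", OF _ _ exI[of _ h]]
    multigraph_rename_inj_on[of F h] by simp

lemma f_add_node:
  assumes F: "multigraph F" and "v \<notin> nodes F"
  shows "f \<lparr>nodes = insert v (nodes F), edges = edges F\<rparr> = f F * K1"
proof -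
  have "rename (\<lambda>_. v) (lgraph 1 {#}) = \<lparr>nodes = {v}, edges = {#}\<rparr>"
    by (simp add: rename_def lgraph_def)
  then have "f \<lparr>nodes = {v}, edges = {#}\<rparr> = K1"
    using f_rename[of "lgraph 1 {#}" "\<lambda>_. v"] multigraph_lgraph[of 1 "{#}"]
    by (simp add: K1_def) (simp add: lgraph_def)
  moreover have "munion F \<lparr>nodes = {v}, edges = {#}\<rparr> = \<lparr>nodes = insert v (nodes F), edges = edges F\<rparr>"
    by (simp add: munion_def)
  moreover have "multigraph \<lparr>nodes = {v}, edges = {#}\<rparr>" by (simp add: multigraph_def)
  ultimately show ?thesis
    using mult[unfolded multiplicative_def, rule_format, of F "\<lparr>nodes = {v}, edges = {#}\<rparr>"] F assms(2)
    by simp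
qed

lemma f_add_nodes:
  assumes F: "multigraph F" and "finite W" "nodes F \<inter> W = {}"
  shows "f \<lparr>nodes = nodes F \<union> W, edges = edges F\<rparr> = f F * K1 ^ card W"
  using assms(2,3)
proof (induction W rule: finite_induct)
  case empty
  then show ?case by (cases F) simp
next
  case (insert v W)
  let ?F = "\<lparr>nodes = nodes F \<union> W, edges = edges F\<rparr>"
  have "multigraph ?F" using F insert by (auto simp: multigraph_def)
  from f_add_node[OF this, of v] show ?case using insert by (simp add: mult_ac)
qed

lemma f_embed:
  assumes F: "multigraph F" and inj: "inj_on h (nodes F)" and sub: "h ` nodes F \<subseteq> {1..n}"
  shows "f (lgraph n (image_mset ((`) h) (edges F))) = f F * K1 ^ (n - card (nodes F))"
proof -
  let ?W = "{1..n} - h ` nodes F"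
  have "f \<lparr>nodes = nodes (rename h F) \<union> ?W, edges = edges (rename h F)\<rparr> =
      f (rename h F) * K1 ^ card ?W"
    by (rule f_add_nodes) (use multigraph_rename_inj_on[OF F inj] in \<open>auto simp: rename_def\<close>)
  moreover have "nodes (rename h F) \<union> ?W = {1..n}" using sub by (auto simp: rename_def)
  moreover have "card ?W = n - card (nodes F)"
    using sub F inj by (subst card_Diff_subset) (auto simp: card_image multigraph_def)
  ultimately show ?thesis using f_rename[OF F inj] by (simp add: lgraph_def rename_def)
qed

lemma exists_embedding:
  assumes "multigraph F" "card (nodes F) \<le> n"
  shows "\<exists>h. inj_on h (nodes F) \<and> h ` nodes F \<subseteq> {1..n}"
proof -
  have "finite (nodes F)" using assms by (simp add: multigraph_def)
  from card_le_inj[OF this, of "{1..n}"] show ?thesis using assms by auto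
qed

lemma embedded_edges_subset:
  assumes F: "multigraph F" and inj: "inj_on h (nodes F)" and sub: "h ` nodes F \<subseteq> {1..n}"
  shows "set_mset (image_mset ((`) h) (edges F)) \<subseteq> pairs n"
proof
  fix e assume "e \<in># image_mset ((`) h) (edges F)"
  then obtain e' where e': "e = h ` e'" "e' \<in># edges F" by auto
  then have "e' \<subseteq> nodes F" "card e' = 2" using F by (auto simp: multigraph_def)
  then show "e \<in> pairs n" using e' inj sub
    by (auto simp: pairs_def card_image inj_on_subset)
qed

text \<open>Weak reflection positivity in the language of edge polynomials: a quantum graph on
  \<open>n\<close> labels is a polynomial in the pairs of labels, and its square under gluing is the
  square of the polynomial.\<close>

lemma lin_ext_square_nonneg:
  assumes n: "n \<ge> 1" and p: "p \<in> edge_algebra (pairs n)"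
  shows "lin_ext (\<lambda>a. f (lgraph n a)) (p * p) \<ge> 0"
proof -
  let ?K = "Poly_Mapping.keys p" and ?l = "Poly_Mapping.lookup p"
  define q where "q = (\<Sum>a\<in>?K. Poly_Mapping.single (lgraph n a) (?l a))"
  have inj: "inj (lgraph n)" by (auto simp: inj_def lgraph_def)
  have look: "Poly_Mapping.lookup q (lgraph n a) = ?l a" for a
    using inj by (auto simp: q_def lookup_sum lookup_single when_def in_keys_iff inj_eq)
  have keys: "Poly_Mapping.keys q = lgraph n ` ?K"
  proof
    have "Poly_Mapping.keys q \<subseteq> (\<Union>a\<in>?K. Poly_Mapping.keys (Poly_Mapping.single (lgraph n a) (?l a)))"
      unfolding q_def by (rule keys_sum)
    then show "Poly_Mapping.keys q \<subseteq> lgraph n ` ?K" by (auto split: if_splits)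
    show "lgraph n ` ?K \<subseteq> Poly_Mapping.keys q" using look by (auto simp: in_keys_iff)
  qed
  have "q \<in> quantum_graphs n"
    using p lgraph_in_fully_labeled_graphs[OF n]
    by (auto simp: quantum_graphs_def keys edge_algebra_def)
  then have "linear_ext f (quantum_prod n q q) \<ge> 0"
    using positive n by (auto simp: weakly_reflection_positive_def)
  also have "linear_ext f = lin_ext f" by (auto simp: linear_ext_def lin_ext_def)
  also have "lin_ext f (quantum_prod n q q) = (\<Sum>a\<in>?K. \<Sum>b\<in>?K. ?l a * ?l b * f (lgraph n (a + b)))"
    unfolding quantum_prod_def keys
    using p by (simp add: sum.reindex[OF inj_on_subset[OF inj]] look lin_ext_sum lin_ext_single
        glue_lgraph edge_algebra_def)
  also have "\<dots> = lin_ext (\<lambda>a. f (lgraph n a)) (p * p)"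
  proof -
    have "p * p = (\<Sum>a\<in>?K. Poly_Mapping.single a (?l a)) * (\<Sum>b\<in>?K. Poly_Mapping.single b (?l b))"
      using poly_mapping_eq_sum_single[of p] by simp
    then show ?thesis by (simp add: sum_product mult_single lin_ext_sum lin_ext_single)
  qed
  finally show ?thesis .
qed

text \<open>If \<open>K1\<close> were 0, the edgeless graph on \<open>n\<close> nodes would have
  value 0. The polynomial 1 would then have a square of value 0, and Cauchy-Schwarz would make the
  parameter vanish on every graph with \<open>n\<close> nodes, hence identically.\<close>

lemma K1_pos: "K1 > 0"
proof -
  have nonneg: "K1 \<ge> 0"
    using lin_ext_square_nonneg[of 1 1] edge_algebra_1
    by (simp add: K1_def lin_ext_def)
  have "K1 \<noteq> 0"
  proof
    assume zero: "K1 = 0"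
    obtain F where F: "multigraph F" "f F \<noteq> 0" using nonzero by blast
    define n where "n = card (nodes F)"
    have n: "n \<ge> 1" using F by (simp add: n_def multigraph_def Suc_le_eq card_gt_0_iff)
    obtain h where h: "inj_on h (nodes F)" "h ` nodes F \<subseteq> {1..n}"
      using exists_embedding[OF F(1), of n] by (auto simp: n_def)
    let ?a = "image_mset ((`) h) (edges F)"
    have Fa: "f (lgraph n ?a) = f F" using f_embed[OF F(1) h] by (simp add: n_def)
    have "f (lgraph n {#}) = 0"
    proof -
      have "f \<lparr>nodes = nodes (lgraph 1 {#}) \<union> {2..n}, edges = edges (lgraph 1 {#})\<rparr> =
          f (lgraph 1 {#}) * K1 ^ card {2..n}"
        by (rule f_add_nodes) (auto simp: multigraph_def lgraph_def)
      moreover have "{1} \<union> {2..n} = {1..n}" using n by auto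
      ultimately show ?thesis using zero by (simp add: lgraph_def K1_def)
    qed
    then have "lin_ext (\<lambda>a. f (lgraph n a)) (1 * 1) = 0" by (simp add: lin_ext_def)
    from positive_functional_annihilates[OF lin_ext_square_nonneg[OF n] edge_algebra_1 this
        edge_algebra_single[OF embedded_edges_subset[OF F(1) h]]]
    have "lin_ext (\<lambda>a. f (lgraph n a)) (1 * Poly_Mapping.single ?a 1) = 0" .
    then show False using Fa F by (simp add: lin_ext_single)
  qed
  then show ?thesis using nonneg by simp
qed

lemma norm_param_rename: "multigraph F \<Longrightarrow> inj_on h (nodes F) \<Longrightarrow> norm_param (rename h F) = norm_param F"
  by (simp add: norm_param_def f_rename) (simp add: rename_def card_image)

lemma norm_param_munion:
  assumes "multigraph F" "multigraph G" "nodes F \<inter> nodes G = {}"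
  shows "norm_param (munion F G) = norm_param F * norm_param G"
proof -
  have "f (munion F G) = f F * f G" using mult assms by (auto simp: multiplicative_def)
  moreover have "card (nodes (munion F G)) = card (nodes F) + card (nodes G)"
    using assms by (simp add: munion_def card_Un_disjoint multigraph_def)
  ultimately show ?thesis by (simp add: norm_param_def power_add)
qed

lemma norm_param_embed:
  assumes F: "multigraph F" and inj: "inj_on h (nodes F)" and sub: "h ` nodes F \<subseteq> {1..n}"
  shows "norm_param (lgraph n (image_mset ((`) h) (edges F))) = norm_param F"
proof -
  have "card (nodes F) = card (h ` nodes F)" using inj by (simp add: card_image)
  also have "\<dots> \<le> card {1..n}" using sub by (intro card_mono) auto
  finally have "card (nodes F) \<le> n" by simp
  then show ?thesis using f_embed[OF assms] K1_pos
    by (simp add: norm_param_def) (simp add: lgraph_def field_simps flip: power_add)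
qed

lemma norm_param_edgeless: "n \<ge> 1 \<Longrightarrow> norm_param (lgraph n {#}) = 1"
proof -
  assume n: "n \<ge> 1"
  have "norm_param (lgraph n {#}) = norm_param (lgraph 1 {#})"
    using norm_param_embed[of "lgraph 1 {#}" id n] multigraph_lgraph[of 1 "{#}"] n
    by (simp add: lgraph_def)
  also have "\<dots> = K1 / K1 ^ card (nodes (lgraph 1 {#}))" by (simp only: norm_param_def K1_def)
  also have "\<dots> = 1" using K1_pos by (simp add: lgraph_def)
  finally show ?thesis .
qed

lemma f_parallel_edges:
  assumes "n \<ge> 2" "e \<in> pairs n"
  shows "f (lgraph n (replicate_mset k e)) = f (lgraph 2 (replicate_mset k {1, 2})) * K1 ^ (n - 2)"
proof -
  let ?F = "lgraph 2 (replicate_mset k {1, 2})"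
  have F: "multigraph ?F" by (intro multigraph_lgraph) (auto simp: pairs_def split: if_splits)
  obtain i j where e: "e = {i, j}" "i \<noteq> j" "i \<in> {1..n}" "j \<in> {1..n}"
    using assms(2) by (auto simp: pairs_def card_2_iff)
  define h where "h v = (if v = 1 then i else j)" for v :: nat
  have two: "{1..2::nat} = {1, 2}" by auto
  have "inj_on h (nodes ?F)" "h ` nodes ?F \<subseteq> {1..n}"
    unfolding lgraph_def mgraph.simps two using e by (auto simp: h_def)
  moreover have "image_mset ((`) h) (edges ?F) = replicate_mset k e"
    using e by (simp add: lgraph_def h_def insert_commute)
  ultimately show ?thesis using f_embed[OF F, of h n] by (simp add: lgraph_def)
qed

text \<open>A bundle of parallel edges has the same value wherever it is placed, up to a power of
  \<open>K1\<close>. All single-edge functionals are therefore multiples of the one functional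
  \<open>l\<close>, and a single set \<open>B\<close> serves every \<open>m\<close> and every
  edge.\<close>

lemma exists_node_poly:
  assumes n: "n \<ge> 2" and r: "connection_rank f n = enat r"
  shows "\<exists>B. finite B \<and> (\<forall>m\<ge>2. \<forall>e\<in>pairs m.
    lin_ext (\<lambda>a. f (lgraph m a)) (edge_poly (node_poly B) e * edge_poly (node_poly B) e) = 0)"
proof -
  have e12: "{1, 2} \<in> pairs m" if "m \<ge> 2" for m using that by (auto simp: pairs_def)
  have sub: "set_mset (replicate_mset k {1, 2}) \<subseteq> pairs m" if "m \<ge> 2" for m k
    using e12[OF that] by (auto split: if_splits)
  define l where "l p = lin_ext (\<lambda>a. f (lgraph 2 a)) (edge_poly p {1, 2})" for p
  have l_sum: "l p = (\<Sum>k\<le>degree p. coeff p k * f (lgraph 2 (replicate_mset k {1, 2})))" for p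
    unfolding l_def by (rule lin_ext_edge_poly)
  have lm: "lin_ext (\<lambda>a. f (lgraph m a)) (edge_poly p e) = l p * K1 ^ (m - 2)"
    if "m \<ge> 2" "e \<in> pairs m" for p m e
    by (simp only: lin_ext_edge_poly l_sum f_parallel_edges[OF that] sum_distrib_right mult.assoc)
  have l_add: "l (p + q) = l p + l q" for p q by (simp add: l_def edge_poly_add lin_ext_add)
  have l_smult: "l (smult c p) = c * l p" for c p by (simp add: l_def edge_poly_smult lin_ext_scale)
  have l_monom: "l (monom 1 k) = f (lgraph 2 (replicate_mset k {1, 2}))" for k
    by (simp add: l_def edge_poly_monom lin_ext_single)
  have l_lsum: "l (\<Sum>i\<in>I. p i) = (\<Sum>i\<in>I. l (p i))" for p and I :: "nat set"
    by (simp add: l_def edge_poly_sum lin_ext_sum)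
  have l_pos: "l (q * q) \<ge> 0" for q
    unfolding l_def edge_poly_mult
    using e12 by (intro lin_ext_square_nonneg edge_poly_in_edge_algebra) auto
  \<comment> \<open>The rows of the bundles of 0 to \<open>r\<close> parallel edges are one more
    than the rank; a dependency among them is read as the coefficient sequence of a polynomial
    \<open>p\<close>.\<close>
  obtain u where u: "\<exists>k\<le>r. u k \<noteq> 0"
    "\<And>G. G \<in> labeled_graphs n \<Longrightarrow>
       (\<Sum>k\<le>r. u k * connection_matrix f n (lgraph n (replicate_mset k {1, 2})) G) = 0"
    using rank_finite_imp_dependent[OF r[unfolded connection_rank_def],
        of "\<lambda>k. lgraph n (replicate_mset k {1, 2})"] n sub
    by (force intro!: lgraph_in_labeled_graphs)
  define p where "p = (\<Sum>k\<le>r. smult (u k) (monom 1 k))"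
  have "coeff p k = u k" if "k \<le> r" for k
    using that by (simp add: p_def coeff_sum if_distrib[of "(*) _"] cong: if_cong)
  then have "p \<noteq> 0" using u(1) by auto
  have pm: "l (p * monom 1 j) = 0" for j
  proof -
    have "0 = (\<Sum>k\<le>r. u k * f (lgraph n (replicate_mset (k + j) {1, 2})))"
      using u(2)[of "lgraph n (replicate_mset j {1, 2})"] n sub
      by (simp add: lgraph_in_labeled_graphs connection_matrix_def glue_lgraph replicate_mset_add)
    also have "\<dots> = (\<Sum>k\<le>r. u k * l (monom 1 (k + j))) * K1 ^ (n - 2)"
      by (simp only: l_monom f_parallel_edges[OF n e12[OF n]] sum_distrib_right mult.assoc)
    also have "(\<Sum>k\<le>r. u k * l (monom 1 (k + j))) = l (p * monom 1 j)"
    proof -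
      have "p * monom 1 j = (\<Sum>k\<le>r. smult (u k) (monom 1 (k + j)))"
        by (simp add: p_def sum_distrib_right mult_monom smult_monom)
      then show ?thesis by (simp only: l_lsum l_smult)
    qed
    finally show ?thesis using K1_pos by simp
  qed
  have "l (p * q) = 0" for q
  proof -
    have "p * q = (\<Sum>k\<le>degree q. smult (coeff q k) (p * monom 1 k))"
    proof -
      have "p * q = p * (\<Sum>k\<le>degree q. smult (coeff q k) (monom 1 k))"
        by (simp add: smult_monom poly_as_sum_of_monoms)
      then show ?thesis by (simp only: sum_distrib_left mult_smult_right)
    qed
    then show ?thesis by (simp only: l_lsum l_smult pm mult_zero_right sum.neutral_const)
  qed
  from positive_functional_annihilates_node_poly[OF \<open>p \<noteq> 0\<close> l_add l_smult l_pos this]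
  obtain B where "finite B" "\<And>q. l (node_poly B * q) = 0" by blast
  then show ?thesis by (intro exI[of _ B]) (simp add: lm flip: edge_poly_mult)
qed

text \<open>The set \<open>B\<close> is fixed before \<open>m\<close>, so the random colourings of
  all sizes use the same finitely many colours. It is nonempty because the edgeless graph has
  normalized value 1; the same evaluation shows that each \<mu> has total mass 1.\<close>

lemma colouring_measure:
  assumes n: "n \<ge> 2" and r: "connection_rank f n = enat r"
  shows "\<exists>B. finite B \<and> B \<noteq> {} \<and> (\<forall>m\<ge>2. \<exists>\<mu>. (\<forall>c\<in>pairs m \<rightarrow>\<^sub>E B. \<mu> c \<ge> 0) \<and>
    (\<forall>a. set_mset a \<subseteq> pairs m \<longrightarrow>
      norm_param (lgraph m a) = (\<Sum>c\<in>pairs m \<rightarrow>\<^sub>E B. \<mu> c * (\<Prod>e\<in>pairs m. c e ^ count a e))))"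
proof -
  obtain B where B: "finite B" "\<And>m e. m \<ge> 2 \<Longrightarrow> e \<in> pairs m \<Longrightarrow>
    lin_ext (\<lambda>a. f (lgraph m a)) (edge_poly (node_poly B) e * edge_poly (node_poly B) e) = 0"
    using exists_node_poly[OF assms] by blast
  have main: "\<exists>\<mu>. (\<forall>c\<in>pairs m \<rightarrow>\<^sub>E B. \<mu> c \<ge> 0) \<and>
    (\<forall>a. set_mset a \<subseteq> pairs m \<longrightarrow>
      norm_param (lgraph m a) = (\<Sum>c\<in>pairs m \<rightarrow>\<^sub>E B. \<mu> c * (\<Prod>e\<in>pairs m. c e ^ count a e)))"
    if m: "m \<ge> 2" for m
  proof -
    have "\<exists>\<mu>. (\<forall>c\<in>pairs m \<rightarrow>\<^sub>E B. \<mu> c \<ge> 0) \<and> (\<forall>a. set_mset a \<subseteq> pairs m \<longrightarrow>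
       f (lgraph m a) = (\<Sum>c\<in>pairs m \<rightarrow>\<^sub>E B. \<mu> c * (\<Prod>e\<in>pairs m. c e ^ count a e)))"
      using m by (intro finite_moment_representation finite_pairs B lin_ext_square_nonneg) auto
    then obtain \<mu> where \<mu>: "\<And>c. c \<in> pairs m \<rightarrow>\<^sub>E B \<Longrightarrow> \<mu> c \<ge> 0"
      "\<And>a. set_mset a \<subseteq> pairs m \<Longrightarrow>
       f (lgraph m a) = (\<Sum>c\<in>pairs m \<rightarrow>\<^sub>E B. \<mu> c * (\<Prod>e\<in>pairs m. c e ^ count a e))"
      by blast
    have "card (nodes (lgraph m a)) = m" for a by (simp add: lgraph_def)
    then show ?thesis using \<mu> K1_pos
      by (intro exI[of _ "\<lambda>c. \<mu> c / K1 ^ m"]) (simp add: norm_param_def sum_divide_distrib)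
  qed
  moreover have "B \<noteq> {}"
  proof
    assume "B = {}"
    have "{1, 2} \<in> pairs 2" by (auto simp: pairs_def)
    then have "pairs 2 \<rightarrow>\<^sub>E B = {}" using \<open>B = {}\<close> by (auto simp: PiE_eq_empty_iff)
    then have "norm_param (lgraph 2 {#}) = 0" using main[of 2] by force
    then show False using norm_param_edgeless[of 2] by simp
  qed
  ultimately show ?thesis using B(1) by blast
qed

end

section \<open>Approximation by coloured complete graphs\<close>

text \<open>Union bound over the pairs of points that are identified; each pair leaves
  \<open>n ^ (card A - 1)\<close> maps.\<close>

lemma card_not_inj_on_PiE:
  assumes "finite A" "n \<ge> 1"
  shows "card {\<phi> \<in> A \<rightarrow>\<^sub>E {1..n}. \<not> inj_on \<phi> A} * n \<le> (card A)\<^sup>2 * n ^ card A"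
proof -
  let ?V = "{1..n}"
  let ?S = "\<lambda>(i, j). {\<phi> \<in> A \<rightarrow>\<^sub>E ?V. \<phi> i = \<phi> j}"
  let ?I = "{(i, j). i \<in> A \<and> j \<in> A \<and> i \<noteq> j}"
  have finI: "finite ?I" by (rule finite_subset[of _ "A \<times> A"]) (use assms in auto)
  have cardI: "card ?I \<le> (card A)\<^sup>2"
    using card_mono[of "A \<times> A" ?I] assms by (force simp: card_cartesian_product power2_eq_square)
  have finS: "finite (?S p)" for p
    by (rule finite_subset[of _ "A \<rightarrow>\<^sub>E ?V"]) (use assms in \<open>auto intro: finite_PiE split: prod.splits\<close>)
  have one: "card (?S p) * n \<le> n ^ card A" if "p \<in> ?I" for p
  proof -
    from that obtain i j where p: "p = (i, j)" "i \<in> A" "j \<in> A" "i \<noteq> j" by auto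
    have "card (?S p) \<le> card ((A - {i}) \<rightarrow>\<^sub>E ?V)"
    proof (rule card_inj_on_le[of "\<lambda>\<phi>. restrict \<phi> (A - {i})"])
      show "inj_on (\<lambda>\<phi>. restrict \<phi> (A - {i})) (?S p)"
      proof (rule inj_onI)
        fix \<phi> \<psi> assume *: "\<phi> \<in> ?S p" "\<psi> \<in> ?S p"
          and eq: "restrict \<phi> (A - {i}) = restrict \<psi> (A - {i})"
        have eq': "\<phi> x = \<psi> x" if "x \<in> A - {i}" for x using fun_cong[OF eq, of x] that by simp
        show "\<phi> = \<psi>"
        proof (rule extensionalityI[of _ A])
          show "\<phi> x = \<psi> x" if "x \<in> A" for x
            using eq'[of x] eq'[of j] * p that by (cases "x = i") auto
        qed (use * p in \<open>auto simp: PiE_def\<close>)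
      qed
      show "(\<lambda>\<phi>. restrict \<phi> (A - {i})) ` ?S p \<subseteq> (A - {i}) \<rightarrow>\<^sub>E ?V"
        using p by (intro image_subsetI) (auto simp: restrict_PiE_iff simp del: restrict_apply)
    qed (use assms in \<open>auto intro: finite_PiE\<close>)
    also have "\<dots> = n ^ (card A - 1)" using assms p by (simp add: card_PiE)
    finally have "card (?S p) * n \<le> n ^ (card A - 1) * n" by simp
    also have "\<dots> = n ^ card A"
      using assms p by (metis card_gt_0_iff empty_iff power_minus_mult)
    finally show ?thesis .
  qed
  have "{\<phi> \<in> A \<rightarrow>\<^sub>E ?V. \<not> inj_on \<phi> A} \<subseteq> (\<Union>p\<in>?I. ?S p)" by (auto simp: inj_on_def)
  then have "card {\<phi> \<in> A \<rightarrow>\<^sub>E ?V. \<not> inj_on \<phi> A} \<le> card (\<Union>p\<in>?I. ?S p)"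
    using finI finS by (intro card_mono finite_UN_I)
  also have "\<dots> \<le> (\<Sum>p\<in>?I. card (?S p))" by (rule card_UN_le[OF finI])
  finally have "card {\<phi> \<in> A \<rightarrow>\<^sub>E ?V. \<not> inj_on \<phi> A} * n \<le> (\<Sum>p\<in>?I. card (?S p) * n)"
    unfolding sum_distrib_right[symmetric] by (rule mult_le_mono1)
  also have "\<dots> \<le> (\<Sum>p\<in>?I. n ^ card A)" by (intro sum_mono one)
  also have "\<dots> \<le> (card A)\<^sup>2 * n ^ card A" using cardI by simp
  finally show ?thesis .
qed

lemma abs_prod_edges_le:
  fixes w :: "nat set \<Rightarrow> real"
  assumes "\<And>e. \<bar>w e\<bar> \<le> M"
  shows "\<bar>\<Prod>e\<in>set_mset X. w e ^ count X e\<bar> \<le> M ^ size X"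
proof -
  have "\<bar>\<Prod>e\<in>set_mset X. w e ^ count X e\<bar> = (\<Prod>e\<in>set_mset X. \<bar>w e\<bar> ^ count X e)"
    by (simp add: abs_prod power_abs)
  also have "\<dots> \<le> (\<Prod>e\<in>set_mset X. M ^ count X e)"
    using assms by (intro prod_mono) (auto intro: power_mono)
  also have "\<dots> = M ^ size X"
    by (simp add: size_multiset_overloaded_eq power_sum)
  finally show ?thesis .
qed

context reflection_positive_parameter
begin

definition colour_ext :: "real \<Rightarrow> (nat set \<Rightarrow> real) \<Rightarrow> nat set \<Rightarrow> real" where
  "colour_ext b c A = (if card A = 2 then c A else b)"

text \<open>For an injective map the expected weight of the image of \<open>F\<close> is exactly
  \<open>norm_param F\<close>, since neither the position nor isolated nodes matter. Only the
  non-injective maps, a fraction of order \<open>1 / n\<close>, cause an error.\<close>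

lemma expected_density:
  assumes n: "n \<ge> 2" and B: "finite B" "b \<in> B" "\<And>b. b \<in> B \<Longrightarrow> \<bar>b\<bar> \<le> M"
    and \<mu>: "\<And>c. c \<in> pairs n \<rightarrow>\<^sub>E B \<Longrightarrow> \<mu> c \<ge> 0"
      "\<And>a. set_mset a \<subseteq> pairs n \<Longrightarrow>
        norm_param (lgraph n a) = (\<Sum>c\<in>pairs n \<rightarrow>\<^sub>E B. \<mu> c * (\<Prod>e\<in>pairs n. c e ^ count a e))"
    and F: "multigraph F"
  shows "\<bar>(\<Sum>c\<in>pairs n \<rightarrow>\<^sub>E B. \<mu> c * density n (colour_ext b c) F) - norm_param F\<bar> \<le>
    (card (nodes F))\<^sup>2 * (M ^ size (edges F) + \<bar>norm_param F\<bar>) / n"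
    and "(\<Sum>c\<in>pairs n \<rightarrow>\<^sub>E B. \<mu> c) = 1"
proof -
  let ?A = "nodes F" and ?C = "pairs n \<rightarrow>\<^sub>E B"
  let ?\<Phi> = "?A \<rightarrow>\<^sub>E {1..n}"
  let ?m = "M ^ size (edges F)"
  have finA: "finite ?A" using F by (simp add: multigraph_def)
  have fn1: "norm_param (lgraph n {#}) = 1" using n by (intro norm_param_edgeless) simp
  show sum1: "(\<Sum>c\<in>?C. \<mu> c) = 1" using \<mu>(2)[of "{#}"] fn1 by simp
  define P where "P \<phi> c = (\<Prod>e\<in>set_mset (edges F). colour_ext b c (\<phi> ` e) ^ count (edges F) e)"
    for \<phi> :: "nat \<Rightarrow> nat" and c
  define T where "T \<phi> = (\<Sum>c\<in>?C. \<mu> c * P \<phi> c)" for \<phi>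
  have dens: "density n (colour_ext b c) F = (\<Sum>\<phi>\<in>?\<Phi>. (1 / n) ^ card ?A * P \<phi> c)" for c
    by (simp add: edge_hom_def P_def)
  have Pb: "\<bar>P \<phi> c\<bar> \<le> ?m" if phi: "\<phi> \<in> ?\<Phi>" and c: "c \<in> ?C" for \<phi> c
  proof -
    let ?w = "\<lambda>e. if e \<in># edges F then colour_ext b c (\<phi> ` e) else b"
    have "\<bar>?w e\<bar> \<le> M" for e
    proof (cases "e \<in># edges F \<and> card (\<phi> ` e) = 2")
      case True
      then have "e \<subseteq> ?A" using F by (auto simp: multigraph_def)
      then have "\<phi> ` e \<in> pairs n" using phi True by (auto simp: pairs_def)
      then show ?thesis using True c B by (auto simp: colour_ext_def PiE_mem)
    qed (use B in \<open>auto simp: colour_ext_def\<close>)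
    then have "\<bar>\<Prod>e\<in>set_mset (edges F). ?w e ^ count (edges F) e\<bar> \<le> ?m"
      by (rule abs_prod_edges_le)
    then show ?thesis by (simp add: P_def cong: prod.cong)
  qed
  have Tb: "\<bar>T \<phi>\<bar> \<le> ?m" if phi: "\<phi> \<in> ?\<Phi>" for \<phi>
  proof -
    have "\<bar>T \<phi>\<bar> \<le> (\<Sum>c\<in>?C. \<bar>\<mu> c * P \<phi> c\<bar>)" unfolding T_def by (rule sum_abs)
    also have "\<dots> \<le> (\<Sum>c\<in>?C. \<mu> c * ?m)"
      using \<mu>(1) Pb[OF phi] by (intro sum_mono) (simp add: abs_mult mult_left_mono)
    also have "\<dots> = ?m" using sum1 by (simp flip: sum_distrib_right)
    finally show ?thesis .
  qed
  have Tinj: "T \<phi> = norm_param F" if phi: "\<phi> \<in> ?\<Phi>" and inj: "inj_on \<phi> ?A" for \<phi>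
  proof -
    let ?a = "image_mset ((`) \<phi>) (edges F)"
    have sub: "\<phi> ` ?A \<subseteq> {1..n}" using phi by auto
    note a = embedded_edges_subset[OF F inj sub]
    note inje = inj_on_image_edges[OF F inj]
    have "(\<Prod>e\<in>pairs n. c e ^ count ?a e) = P \<phi> c" for c
    proof -
      have "(\<Prod>e\<in>pairs n. c e ^ count ?a e) = (\<Prod>e\<in>set_mset ?a. c e ^ count ?a e)"
      proof (rule prod.mono_neutral_right[OF finite_pairs a], rule ballI)
        fix e assume "e \<in> pairs n - set_mset ?a"
        then have "count ?a e = 0" by (simp only: count_eq_zero_iff Diff_iff not_False_eq_True)
        then show "c e ^ count ?a e = 1" by simp
      qed
      also have "\<dots> = P \<phi> c" unfolding P_def
      proof (rule prod.reindex_cong[OF inje])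
        show "set_mset ?a = (`) \<phi> ` set_mset (edges F)" by simp
        fix e assume e: "e \<in># edges F"
        then have "\<phi> ` e \<in> pairs n" using a by auto
        then have "card (\<phi> ` e) = 2" by (simp add: pairs_def)
        then show "c (\<phi> ` e) ^ count ?a (\<phi> ` e) = colour_ext b c (\<phi> ` e) ^ count (edges F) e"
          using count_image_mset_inj_on[OF inje e] by (simp add: colour_ext_def)
      qed
      finally show ?thesis .
    qed
    then have "norm_param (lgraph n ?a) = T \<phi>" using \<mu>(2)[OF a] by (simp add: T_def)
    then show ?thesis using norm_param_embed[OF F inj sub] by simp
  qed
  have "(\<Sum>c\<in>?C. \<mu> c * density n (colour_ext b c) F) = (\<Sum>\<phi>\<in>?\<Phi>. (1 / n) ^ card ?A * T \<phi>)"
    unfolding dens T_def sum_distrib_left by (subst sum.swap) (simp add: mult_ac)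
  moreover have "norm_param F = (\<Sum>\<phi>\<in>?\<Phi>. (1 / n) ^ card ?A * norm_param F)"
    using finA n by (simp add: card_PiE power_divide)
  ultimately have "(\<Sum>c\<in>?C. \<mu> c * density n (colour_ext b c) F) - norm_param F =
      (\<Sum>\<phi>\<in>?\<Phi>. (1 / n) ^ card ?A * (T \<phi> - norm_param F))"
    by (simp add: right_diff_distrib sum_subtractf)
  also have "\<bar>\<dots>\<bar> \<le> (\<Sum>\<phi>\<in>?\<Phi>. \<bar>(1 / n) ^ card ?A * (T \<phi> - norm_param F)\<bar>)" by (rule sum_abs)
  also have "\<dots> = (\<Sum>\<phi>\<in>{\<phi> \<in> ?\<Phi>. \<not> inj_on \<phi> ?A}. (1 / n) ^ card ?A * \<bar>T \<phi> - norm_param F\<bar>)"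
    using finA by (intro sum.mono_neutral_cong_right) (auto simp: Tinj abs_mult intro: finite_PiE)
  also have "\<dots> \<le> (\<Sum>\<phi>\<in>{\<phi> \<in> ?\<Phi>. \<not> inj_on \<phi> ?A}. (1 / n) ^ card ?A * (?m + \<bar>norm_param F\<bar>))"
    using Tb by (intro sum_mono mult_left_mono order_trans[OF abs_triangle_ineq4] add_mono) auto
  also have "\<dots> = card {\<phi> \<in> ?\<Phi>. \<not> inj_on \<phi> ?A} / n ^ card ?A * (?m + \<bar>norm_param F\<bar>)"
    by (simp add: power_divide)
  also have "\<dots> \<le> (card ?A)\<^sup>2 / n * (?m + \<bar>norm_param F\<bar>)"
  proof (rule mult_right_mono)
    have "real (card {\<phi> \<in> ?\<Phi>. \<not> inj_on \<phi> ?A} * n) \<le> real ((card ?A)\<^sup>2 * n ^ card ?A)"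
      using card_not_inj_on_PiE[OF finA, of n] n by (subst of_nat_le_iff) simp
    then show "card {\<phi> \<in> ?\<Phi>. \<not> inj_on \<phi> ?A} / n ^ card ?A \<le> (card ?A)\<^sup>2 / n"
      using n by (simp add: field_simps)
    have "0 \<le> M" using B by (metis abs_ge_zero order_trans)
    then show "0 \<le> ?m + \<bar>norm_param F\<bar>" by simp
  qed
  finally show "\<bar>(\<Sum>c\<in>?C. \<mu> c * density n (colour_ext b c) F) - norm_param F\<bar> \<le>
    (card ?A)\<^sup>2 * (?m + \<bar>norm_param F\<bar>) / n" by simp
qed

text \<open>The square of a density is the density of two disjoint copies of \<open>F\<close>. By
  multiplicativity its expectation is close to the square of \<open>norm_param F\<close>, so the
  variance is of order \<open>1 / n\<close>. The constant depends on \<open>F\<close>,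
  \<open>B\<close> and \<open>b\<close>, but neither on \<open>n\<close> nor on the measure.\<close>

lemma second_moment_density:
  assumes B: "finite B" "b \<in> B" and F: "multigraph F"
  shows "\<exists>C\<ge>0. \<forall>n\<ge>2. \<forall>\<mu>. (\<forall>c\<in>pairs n \<rightarrow>\<^sub>E B. \<mu> c \<ge> 0) \<longrightarrow> (\<forall>a. set_mset a \<subseteq> pairs n \<longrightarrow>
        norm_param (lgraph n a) = (\<Sum>c\<in>pairs n \<rightarrow>\<^sub>E B. \<mu> c * (\<Prod>e\<in>pairs n. c e ^ count a e))) \<longrightarrow>
     (\<Sum>c\<in>pairs n \<rightarrow>\<^sub>E B. \<mu> c * (density n (colour_ext b c) F - norm_param F)\<^sup>2) \<le> C / n"
proof -
  define M where "M = Max ((\<lambda>b. \<bar>b\<bar>) ` B)"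
  have M: "\<bar>x\<bar> \<le> M" if "x \<in> B" for x using B that by (auto simp: M_def)
  then have M0: "M \<ge> 0" using B by (metis abs_ge_zero order_trans)
  define d where "d = Suc (Max (nodes F))"
  define G where "G = rename (\<lambda>v. v + d) F"
  have inj: "inj_on (\<lambda>v. v + d) (nodes F)" by (simp add: inj_on_def)
  have G: "multigraph G" unfolding G_def by (rule multigraph_rename_inj_on[OF F inj])
  have disj: "nodes F \<inter> nodes G = {}"
  proof -
    have "v < d" if "v \<in> nodes F" for v
      using that F by (auto simp: d_def multigraph_def less_Suc_eq_le)
    then show ?thesis by (force simp: G_def rename_def)
  qed
  define FG where "FG = munion F G"
  have FG: "multigraph FG" unfolding FG_def using F G by (rule multigraph_munion)
  have fnFG: "norm_param FG = (norm_param F)\<^sup>2"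
    unfolding FG_def norm_param_munion[OF F G disj] using norm_param_rename[OF F inj] by (simp add: G_def power2_eq_square)
  have dens: "density n g FG = (density n g F)\<^sup>2" for n g
    unfolding FG_def edge_hom_munion[OF F G disj] unfolding G_def edge_hom_rename[OF F inj]
    by (simp add: power2_eq_square)
  define K where "K F = (card (nodes F))\<^sup>2 * (M ^ size (edges F) + \<bar>norm_param F\<bar>)" for F
  have K0: "K F \<ge> 0" for F using M0 by (simp add: K_def)
  show ?thesis
  proof (intro exI[of _ "K FG + 2 * \<bar>norm_param F\<bar> * K F"] conjI allI impI)
    show "K FG + 2 * \<bar>norm_param F\<bar> * K F \<ge> 0" using K0 by simp
    fix n \<mu>
    let ?C = "pairs n \<rightarrow>\<^sub>E B"
    let ?t = "\<lambda>c. density n (colour_ext b c) F"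
    assume n: "2 \<le> (n::nat)" and \<mu>: "\<forall>c\<in>?C. \<mu> c \<ge> 0"
      "\<forall>a. set_mset a \<subseteq> pairs n \<longrightarrow>
        norm_param (lgraph n a) = (\<Sum>c\<in>?C. \<mu> c * (\<Prod>e\<in>pairs n. c e ^ count a e))"
    have *: "\<bar>(\<Sum>c\<in>?C. \<mu> c * density n (colour_ext b c) F) - norm_param F\<bar> \<le> K F / n"
      if "multigraph F" for F
      unfolding K_def by (rule expected_density(1)[OF n B]) (use M \<mu> that in auto)
    note 1 = *[OF F]
    have 2: "\<bar>(\<Sum>c\<in>?C. \<mu> c * (?t c)\<^sup>2) - (norm_param F)\<^sup>2\<bar> \<le> K FG / n"
      using *[OF FG] unfolding dens fnFG .
    have 3: "(\<Sum>c\<in>?C. \<mu> c) = 1"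
      by (rule expected_density(2)[OF n B]) (use M \<mu> F in auto)
    have "(\<Sum>c\<in>?C. \<mu> c * (?t c - norm_param F)\<^sup>2) =
       (\<Sum>c\<in>?C. \<mu> c * (?t c)\<^sup>2) - 2 * norm_param F * (\<Sum>c\<in>?C. \<mu> c * ?t c) + (norm_param F)\<^sup>2 * (\<Sum>c\<in>?C. \<mu> c)"
      unfolding sum_distrib_left sum_subtractf[symmetric] sum.distrib[symmetric]
      by (intro sum.cong) (auto simp: power2_eq_square algebra_simps)
    also have "\<dots> = ((\<Sum>c\<in>?C. \<mu> c * (?t c)\<^sup>2) - (norm_param F)\<^sup>2) - 2 * norm_param F * ((\<Sum>c\<in>?C. \<mu> c * ?t c) - norm_param F)"
      using 3 by (simp add: algebra_simps power2_eq_square)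
    also have "\<dots> \<le> K FG / n + 2 * \<bar>norm_param F\<bar> * (K F / n)"
    proof -
      have "- (2 * norm_param F * ((\<Sum>c\<in>?C. \<mu> c * ?t c) - norm_param F)) \<le> \<bar>2 * norm_param F * ((\<Sum>c\<in>?C. \<mu> c * ?t c) - norm_param F)\<bar>"
        by linarith
      also have "\<dots> \<le> 2 * \<bar>norm_param F\<bar> * (K F / n)"
        using 1 by (simp add: abs_mult mult_left_mono del: times_divide_eq_right)
      finally show ?thesis using 2 by linarith
    qed
    also have "\<dots> = (K FG + 2 * \<bar>norm_param F\<bar> * K F) / n" by (simp add: add_divide_distrib)
    finally show "(\<Sum>c\<in>?C. \<mu> c * (?t c - norm_param F)\<^sup>2) \<le> (K FG + 2 * \<bar>norm_param F\<bar> * K F) / n" .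
  qed
qed

text \<open>The second moments are added over the finite family before a colouring is picked, so
  that a single colouring is good for all its members.\<close>

lemma approximating_colouring:
  assumes B: "finite B" "b \<in> B"
    and meas: "\<And>m. m \<ge> 2 \<Longrightarrow> \<exists>\<mu>. (\<forall>c\<in>pairs m \<rightarrow>\<^sub>E B. \<mu> c \<ge> 0) \<and>
    (\<forall>a. set_mset a \<subseteq> pairs m \<longrightarrow>
      norm_param (lgraph m a) = (\<Sum>c\<in>pairs m \<rightarrow>\<^sub>E B. \<mu> c * (\<Prod>e\<in>pairs m. c e ^ count a e)))"
    and \<F>: "finite \<F>" "\<And>F. F \<in> \<F> \<Longrightarrow> multigraph F" and "\<epsilon> > 0"
  shows "\<exists>n\<ge>2. \<exists>c\<in>pairs n \<rightarrow>\<^sub>E B. \<forall>F\<in>\<F>. \<bar>density n (colour_ext b c) F - norm_param F\<bar> < \<epsilon>"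
proof -
  have "\<forall>F\<in>\<F>. \<exists>C\<ge>0. \<forall>n\<ge>2. \<forall>\<mu>. (\<forall>c\<in>pairs n \<rightarrow>\<^sub>E B. \<mu> c \<ge> 0) \<longrightarrow> (\<forall>a. set_mset a \<subseteq> pairs n \<longrightarrow>
        norm_param (lgraph n a) = (\<Sum>c\<in>pairs n \<rightarrow>\<^sub>E B. \<mu> c * (\<Prod>e\<in>pairs n. c e ^ count a e))) \<longrightarrow>
     (\<Sum>c\<in>pairs n \<rightarrow>\<^sub>E B. \<mu> c * (density n (colour_ext b c) F - norm_param F)\<^sup>2) \<le> C / n"
    using second_moment_density[OF B] \<F> by blast
  then obtain C where C: "\<And>F n \<mu>. F \<in> \<F> \<Longrightarrow> n \<ge> 2 \<Longrightarrow> (\<forall>c\<in>pairs n \<rightarrow>\<^sub>E B. \<mu> c \<ge> 0) \<Longrightarrow>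
      (\<forall>a. set_mset a \<subseteq> pairs n \<longrightarrow>
        norm_param (lgraph n a) = (\<Sum>c\<in>pairs n \<rightarrow>\<^sub>E B. \<mu> c * (\<Prod>e\<in>pairs n. c e ^ count a e))) \<Longrightarrow>
     (\<Sum>c\<in>pairs n \<rightarrow>\<^sub>E B. \<mu> c * (density n (colour_ext b c) F - norm_param F)\<^sup>2) \<le> C F / n"
    unfolding bchoice_iff by blast
  obtain n0 :: nat where n0: "(\<Sum>F\<in>\<F>. C F) / \<epsilon>\<^sup>2 < n0" using reals_Archimedean2 by blast
  define n where "n = max 2 n0"
  have n: "n \<ge> 2" and "(\<Sum>F\<in>\<F>. C F) / \<epsilon>\<^sup>2 < n" using n0 by (auto simp: n_def max_def)
  then have Cn: "(\<Sum>F\<in>\<F>. C F) / n < \<epsilon>\<^sup>2" using \<open>\<epsilon> > 0\<close> by (simp add: field_simps)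
  let ?C = "pairs n \<rightarrow>\<^sub>E B"
  obtain \<mu> where \<mu>: "\<forall>c\<in>?C. \<mu> c \<ge> 0" "\<forall>a. set_mset a \<subseteq> pairs n \<longrightarrow>
      norm_param (lgraph n a) = (\<Sum>c\<in>?C. \<mu> c * (\<Prod>e\<in>pairs n. c e ^ count a e))"
    using meas[OF n] by blast
  obtain M where M: "\<And>x. x \<in> B \<Longrightarrow> \<bar>x\<bar> \<le> M"
    using finite_imp_bounded[OF B(1)] by (auto simp: bounded_iff)
  have sum1: "(\<Sum>c\<in>?C. \<mu> c) = 1"
    using expected_density(2)[OF n B M _ \<mu>(2)[rule_format], of "lgraph 1 {#}"] \<mu>(1)
      multigraph_lgraph[of 1 "{#}"] by simp
  define D where "D c = (\<Sum>F\<in>\<F>. (density n (colour_ext b c) F - norm_param F)\<^sup>2)" for c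
  have "(\<Sum>c\<in>?C. \<mu> c * D c) = (\<Sum>F\<in>\<F>. \<Sum>c\<in>?C. \<mu> c * (density n (colour_ext b c) F - norm_param F)\<^sup>2)"
    unfolding D_def sum_distrib_left by (rule sum.swap)
  also have "\<dots> \<le> (\<Sum>F\<in>\<F>. C F / n)" by (intro sum_mono C n \<mu>)
  also have "\<dots> < \<epsilon>\<^sup>2" using Cn by (simp flip: sum_divide_distrib)
  finally have less: "(\<Sum>c\<in>?C. \<mu> c * D c) < \<epsilon>\<^sup>2" .
  have "\<exists>c\<in>?C. D c < \<epsilon>\<^sup>2"
  proof (rule ccontr)
    assume "\<not> ?thesis"
    then have "(\<Sum>c\<in>?C. \<mu> c * \<epsilon>\<^sup>2) \<le> (\<Sum>c\<in>?C. \<mu> c * D c)"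
      using \<mu>(1) by (intro sum_mono mult_left_mono) (auto simp: not_less)
    then show False using less sum1 by (simp flip: sum_distrib_right)
  qed
  then obtain c where c: "c \<in> ?C" "D c < \<epsilon>\<^sup>2" by blast
  have "\<bar>density n (colour_ext b c) F - norm_param F\<bar> < \<epsilon>" if "F \<in> \<F>" for F
  proof -
    have "(density n (colour_ext b c) F - norm_param F)\<^sup>2 \<le> D c"
      unfolding D_def using \<F> that by (intro member_le_sum) auto
    then have "\<bar>density n (colour_ext b c) F - norm_param F\<bar>\<^sup>2 < \<epsilon>\<^sup>2" using c by simp
    then show ?thesis using \<open>\<epsilon> > 0\<close> by (simp add: power2_less_imp_less)
  qed
  then show ?thesis using n c by blast
qed

lemma convergent_approximation:
  assumes "n \<ge> 2" and "connection_rank f n = enat r"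
  shows "\<exists>B N g. finite B \<and> B \<noteq> {} \<and> (\<forall>s. N s \<ge> 1) \<and> (\<forall>s A. g s A \<in> B) \<and>
    (\<forall>F. multigraph F \<longrightarrow> (\<lambda>s. density (N s) (g s) F) \<longlonglongrightarrow> norm_param F)"
proof -
  obtain B where B: "finite B" "B \<noteq> {}" and meas: "\<And>m. m \<ge> 2 \<Longrightarrow> \<exists>\<mu>. (\<forall>c\<in>pairs m \<rightarrow>\<^sub>E B. \<mu> c \<ge> 0) \<and>
    (\<forall>a. set_mset a \<subseteq> pairs m \<longrightarrow>
      norm_param (lgraph m a) = (\<Sum>c\<in>pairs m \<rightarrow>\<^sub>E B. \<mu> c * (\<Prod>e\<in>pairs m. c e ^ count a e)))"
    using colouring_measure[OF assms] by blast
  obtain b where b: "b \<in> B" using B by blast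
  define En where "En = from_nat_into {F. multigraph F}"
  have ne: "{F. multigraph F} \<noteq> {}" using multigraph_lgraph[of 1 "{#}"] by auto
  have En: "multigraph (En j)" for j using from_nat_into[OF ne] by (auto simp: En_def)
  have "\<exists>n c. n \<ge> 2 \<and> c \<in> pairs n \<rightarrow>\<^sub>E B \<and>
     (\<forall>F\<in>En ` {..s}. \<bar>density n (colour_ext b c) F - norm_param F\<bar> < 1 / Suc s)" for s
  proof -
    have "\<exists>n\<ge>2. \<exists>c\<in>pairs n \<rightarrow>\<^sub>E B. \<forall>F\<in>En ` {..s}. \<bar>density n (colour_ext b c) F - norm_param F\<bar> < 1 / Suc s"
      using En by (intro approximating_colouring[OF B(1) b meas]) auto
    then show ?thesis by blast
  qed
  then obtain N c where Nc: "\<And>s. N s \<ge> 2" "\<And>s. c s \<in> pairs (N s) \<rightarrow>\<^sub>E B"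
    "\<And>s F. F \<in> En ` {..s} \<Longrightarrow> \<bar>density (N s) (colour_ext b (c s)) F - norm_param F\<bar> < 1 / Suc s"
    by metis
  \<comment> \<open>Off the pairs of \<open>{1..N s}\<close> the colour is replaced by the default
    \<open>b\<close> when necessary, so that every value lies in \<open>B\<close>; a density sees
    only values that were in \<open>B\<close> before.\<close>
  define g where "g s A = (if colour_ext b (c s) A \<in> B then colour_ext b (c s) A else b)" for s A
  have g_eq: "density (N s) (g s) F = density (N s) (colour_ext b (c s)) F" if F: "multigraph F" for s F
    unfolding edge_hom_def
  proof (intro sum.cong arg_cong2[where f = "(*)"] prod.cong refl)
    fix \<phi> e assume phi: "\<phi> \<in> nodes F \<rightarrow>\<^sub>E {1..N s}" and e: "e \<in># edges F"
    have "colour_ext b (c s) (\<phi> ` e) \<in> B"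
    proof (cases "card (\<phi> ` e) = 2")
      case True
      have "e \<subseteq> nodes F" using F e by (auto simp: multigraph_def)
      then have "\<phi> ` e \<in> pairs (N s)" using True phi by (auto simp: pairs_def)
      then show ?thesis using True Nc(2) by (auto simp: colour_ext_def PiE_mem)
    qed (use b in \<open>auto simp: colour_ext_def\<close>)
    then show "g s (\<phi> ` e) ^ count (edges F) e = colour_ext b (c s) (\<phi> ` e) ^ count (edges F) e"
      by (simp add: g_def)
  qed
  have "(\<lambda>s. density (N s) (g s) F) \<longlonglongrightarrow> norm_param F" if F: "multigraph F" for F
  proof -
    obtain j where j: "F = En j"
      using F from_nat_into_surj[OF countable_multigraphs, of F] by (auto simp: En_def)
    have "(\<lambda>s. density (N s) (g s) F - norm_param F) \<longlonglongrightarrow> 0"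
    proof (rule Lim_null_comparison)
      show "\<forall>\<^sub>F s in sequentially. norm (density (N s) (g s) F - norm_param F) \<le> 1 / Suc s"
        using eventually_ge_at_top[of j]
      proof eventually_elim
        case (elim s)
        then have "F \<in> En ` {..s}" using j by auto
        from Nc(3)[OF this] show ?case unfolding g_eq[OF F] by simp
      qed
      show "(\<lambda>s. 1 / real (Suc s)) \<longlonglongrightarrow> 0"
        using LIMSEQ_inverse_real_of_nat by (simp add: inverse_eq_divide)
    qed
    then show ?thesis by (simp add: LIM_zero_iff)
  qed
  moreover have "g s A \<in> B" for s A using b by (simp add: g_def)
  moreover have "N s \<ge> 1" for s using Nc(1)[of s] by simp
  ultimately show ?thesis using B by blast
qed

end

section \<open>Codegree distance and bounded partitions\<close>

text \<open>Adding the sample points one at a time, each chosen no worse than average; the cross terms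
  vanish on average.\<close>

lemma greedy_sampling:
  fixes a :: "'t \<Rightarrow> 'u \<Rightarrow> real"
  assumes V: "finite V" "V \<noteq> {}"
  shows "\<exists>r::nat \<Rightarrow> 'u. (\<forall>s. r s \<in> V) \<and>
    (\<Sum>t\<in>T. (\<Sum>s<R. a t (r s) - (\<Sum>u\<in>V. a t u) / card V)\<^sup>2) \<le>
      R * (\<Sum>t\<in>T. (\<Sum>u\<in>V. (a t u)\<^sup>2) / card V)"
proof (induction R)
  case 0
  from V obtain v where "v \<in> V" by blast
  then show ?case by (intro exI[of _ "\<lambda>_. v"]) simp
next
  case (Suc R)
  let ?N = "real (card V)"
  let ?m = "\<lambda>t. (\<Sum>u\<in>V. a t u) / ?N"
  have N: "?N > 0" using V by (simp add: card_gt_0_iff)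
  obtain r where r: "\<And>s. r s \<in> V"
    "(\<Sum>t\<in>T. (\<Sum>s<R. a t (r s) - ?m t)\<^sup>2) \<le> R * (\<Sum>t\<in>T. (\<Sum>u\<in>V. (a t u)\<^sup>2) / ?N)"
    using Suc by blast
  define X where "X t = (\<Sum>s<R. a t (r s) - ?m t)" for t
  define Y where "Y u = (\<Sum>t\<in>T. (X t + (a t u - ?m t))\<^sup>2)" for u
  have one: "(\<Sum>u\<in>V. (X t + (a t u - ?m t))\<^sup>2) \<le> ?N * (X t)\<^sup>2 + (\<Sum>u\<in>V. (a t u)\<^sup>2)" for t
  proof -
    have z: "(\<Sum>u\<in>V. a t u - ?m t) = 0" using N by (simp add: sum_subtractf)
    have "(\<Sum>u\<in>V. (X t + (a t u - ?m t))\<^sup>2) =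
      (\<Sum>u\<in>V. (X t)\<^sup>2 + 2 * X t * (a t u - ?m t) + ((a t u)\<^sup>2 - 2 * ?m t * (a t u - ?m t) - (?m t)\<^sup>2))"
    proof -
      have "(X + (a - m))\<^sup>2 = X\<^sup>2 + 2 * X * (a - m) + (a\<^sup>2 - 2 * m * (a - m) - m\<^sup>2)" for X a m :: real
        by (simp add: power2_eq_square algebra_simps)
      then show ?thesis by (simp only:)
    qed
    also have "\<dots> = ?N * (X t)\<^sup>2 + 2 * X t * (\<Sum>u\<in>V. a t u - ?m t) +
       ((\<Sum>u\<in>V. (a t u)\<^sup>2) - 2 * ?m t * (\<Sum>u\<in>V. a t u - ?m t) - ?N * (?m t)\<^sup>2)"
      by (simp only: sum.distrib sum_subtractf sum_distrib_left[symmetric] sum_constant mult.assoc)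
    also have "\<dots> \<le> ?N * (X t)\<^sup>2 + (\<Sum>u\<in>V. (a t u)\<^sup>2)"
      unfolding z using N by simp
    finally show ?thesis .
  qed
  have "(\<Sum>u\<in>V. Y u) \<le> (\<Sum>t\<in>T. ?N * (X t)\<^sup>2 + (\<Sum>u\<in>V. (a t u)\<^sup>2))"
    unfolding Y_def by (subst sum.swap) (intro sum_mono one)
  also have "\<dots> = ?N * ((\<Sum>t\<in>T. (X t)\<^sup>2) + (\<Sum>t\<in>T. (\<Sum>u\<in>V. (a t u)\<^sup>2) / ?N))"
    using N by (simp add: sum.distrib distrib_left flip: sum_divide_distrib sum_distrib_left)
  also have "\<dots> \<le> ?N * (Suc R * (\<Sum>t\<in>T. (\<Sum>u\<in>V. (a t u)\<^sup>2) / ?N))"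
    using r(2) N by (intro mult_left_mono) (auto simp: X_def algebra_simps)
  finally have le: "(\<Sum>u\<in>V. Y u) \<le> ?N * (Suc R * (\<Sum>t\<in>T. (\<Sum>u\<in>V. (a t u)\<^sup>2) / ?N))" .
  have "\<exists>u\<in>V. Y u \<le> Suc R * (\<Sum>t\<in>T. (\<Sum>u\<in>V. (a t u)\<^sup>2) / ?N)" (is "\<exists>u\<in>V. Y u \<le> ?c")
  proof (rule ccontr)
    assume "\<not> ?thesis"
    then have "(\<Sum>u\<in>V. ?c) < (\<Sum>u\<in>V. Y u)" using V by (intro sum_strict_mono) (auto simp: not_le)
    then show False using le by simp
  qed
  then obtain v where v: "v \<in> V" "Y v \<le> ?c" by blast
  define r' where "r' = r(R := v)"
  have "(\<Sum>s<Suc R. a t (r' s) - ?m t) = X t + (a t v - ?m t)" for t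
  proof -
    have "(\<Sum>s<R. a t (r' s) - ?m t) = X t" unfolding X_def by (intro sum.cong) (auto simp: r'_def)
    then show ?thesis by (simp add: r'_def)
  qed
  then have "(\<Sum>t\<in>T. (\<Sum>s<Suc R. a t (r' s) - ?m t)\<^sup>2) \<le> ?c" using v(2) by (simp only: Y_def)
  moreover have "\<forall>s. r' s \<in> V" using r v by (auto simp: r'_def)
  ultimately show ?case by blast
qed

definition codeg :: "nat set \<Rightarrow> (nat \<Rightarrow> nat \<Rightarrow> real) \<Rightarrow> nat \<Rightarrow> nat \<Rightarrow> real" where
  "codeg V G x y = (\<Sum>u\<in>V. G x u * G u y) / card V"

definition cdist :: "nat set \<Rightarrow> (nat \<Rightarrow> nat \<Rightarrow> real) \<Rightarrow> nat \<Rightarrow> nat \<Rightarrow> real" where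
  "cdist V G x y = (\<Sum>z\<in>V. (codeg V G x z - codeg V G y z)\<^sup>2) / card V"

text \<open>It is used with \<open>m = card B\<close>: the powers below \<open>card B\<close> span
  all functions of the colour, so this distance takes account of each colour class and not only of
  the mean colour.\<close>

definition power_cdist :: "nat \<Rightarrow> nat set \<Rightarrow> (nat \<Rightarrow> nat \<Rightarrow> real) \<Rightarrow> nat \<Rightarrow> nat \<Rightarrow> real" where
  "power_cdist m V g x y = (\<Sum>j<m. cdist V (\<lambda>x y. g x y ^ j) x y)"

lemma cdist_nonneg: "cdist V G x y \<ge> 0"
  by (simp add: cdist_def sum_nonneg)

lemma power_cdist_nonneg: "power_cdist m V g x y \<ge> 0"
  by (simp add: power_cdist_def cdist_nonneg sum_nonneg)

lemma cdist_self: "cdist V G x x = 0"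
  by (simp add: cdist_def)

lemma cdist_triangle: "cdist V G x y \<le> 2 * cdist V G x z + 2 * cdist V G y z"
proof -
  let ?K = "codeg V G"
  have "(a - b)\<^sup>2 \<le> 2 * (a - c)\<^sup>2 + 2 * (b - c)\<^sup>2" for a b c :: real
    using zero_le_power2[of "a + b - 2 * c"] by (simp add: power2_eq_square algebra_simps)
  then have "(\<Sum>w\<in>V. (?K x w - ?K y w)\<^sup>2) \<le> (\<Sum>w\<in>V. 2 * (?K x w - ?K z w)\<^sup>2 + 2 * (?K y w - ?K z w)\<^sup>2)"
    by (intro sum_mono) blast
  also have "\<dots> = 2 * (\<Sum>w\<in>V. (?K x w - ?K z w)\<^sup>2) + 2 * (\<Sum>w\<in>V. (?K y w - ?K z w)\<^sup>2)"
    by (simp add: sum.distrib sum_distrib_left)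
  finally show ?thesis
    unfolding cdist_def using divide_right_mono[of _ _ "real (card V)"]
    by (fastforce simp: add_divide_distrib)
qed

lemma power_cdist_self: "power_cdist m V g x x = 0"
  by (simp add: power_cdist_def cdist_self)

lemma power_cdist_triangle:
  "power_cdist m V g x y \<le> 2 * power_cdist m V g x z + 2 * power_cdist m V g y z"
  unfolding power_cdist_def sum_distrib_left sum.distrib[symmetric]
  by (intro sum_mono cdist_triangle)

text \<open>Rows of the codegree kernel are averages over sample points \<open>u\<close> of functions depending on
  \<open>x\<close> only through \<open>g x u\<close>, hence only boundedly many of them are far apart.\<close>

lemma card_separated_le:
  fixes g :: "nat \<Rightarrow> nat \<Rightarrow> real"
  assumes V: "finite V" "V \<noteq> {}" and gB: "\<And>x y. g x y \<in> B" and B: "finite B"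
    and bound: "\<And>b j. b \<in> B \<Longrightarrow> j < m \<Longrightarrow> \<bar>b ^ j\<bar> \<le> C"
    and X: "X \<subseteq> V" and sep: "\<And>x y. x \<in> X \<Longrightarrow> y \<in> X \<Longrightarrow> x \<noteq> y \<Longrightarrow> power_cdist m V g x y \<ge> \<theta>"
    and R: "R > 0" "real R * \<theta> > 8 * (m * C ^ 4)"
  shows "card X \<le> 2 * card B ^ R"
proof (rule ccontr)
  assume contr: "\<not> ?thesis"
  have finX: "finite X" using V X finite_subset by blast
  let ?N = "real (card V)"
  have N: "?N > 0" using V by (simp add: card_gt_0_iff)
  define T where "T = X \<times> (V \<times> {..<m})"
  define a where "a = (\<lambda>(x, z, j) u. g x u ^ j * g u z ^ j)"
  obtain r where r: "\<And>s. r s \<in> V" and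
    "(\<Sum>t\<in>T. (\<Sum>s<R. a t (r s) - (\<Sum>u\<in>V. a t u) / ?N)\<^sup>2) \<le> R * (\<Sum>t\<in>T. (\<Sum>u\<in>V. (a t u)\<^sup>2) / ?N)"
    using greedy_sampling[OF V, where R = R and T = T and a = a] by blast
  note samp = this(2)
  define S where "S x z j = (\<Sum>s<R. a (x, z, j) (r s)) / R" for x z j
  define K where "K x z j = codeg V (\<lambda>x y. g x y ^ j) x z" for x z j
  define err where "err x = (\<Sum>p\<in>V \<times> {..<m}. (K x (fst p) (snd p) - S x (fst p) (snd p))\<^sup>2) / ?N" for x
  have C0: "C \<ge> 0" if "m > 0"
    using bound[OF gB that] by (metis abs_ge_zero order_trans)
  have "(\<Sum>t\<in>T. (\<Sum>u\<in>V. (a t u)\<^sup>2) / ?N) \<le> (\<Sum>t\<in>T. C ^ 4)"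
  proof (rule sum_mono)
    fix t assume "t \<in> T"
    then obtain x z j where t: "t = (x, z, j)" "j < m" by (auto simp: T_def)
    have "(a t u)\<^sup>2 \<le> C ^ 4" for u
    proof -
      have "\<bar>a t u\<bar> \<le> C * C" unfolding a_def t(1) using bound[OF gB t(2)] C0 t(2)
        by (simp only: prod.case abs_mult) (intro mult_mono; simp)
      then have "\<bar>a t u\<bar>\<^sup>2 \<le> (C * C)\<^sup>2" by (intro power_mono) auto
      then show ?thesis by (simp add: power2_eq_square power4_eq_xxxx mult.assoc)
    qed
    then have "(\<Sum>u\<in>V. (a t u)\<^sup>2) \<le> (\<Sum>u\<in>V. C ^ 4)" by (intro sum_mono) auto
    then show "(\<Sum>u\<in>V. (a t u)\<^sup>2) / ?N \<le> C ^ 4" using N by (simp add: field_simps)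
  qed
  also have "\<dots> = card X * ?N * (m * C ^ 4)" by (simp add: T_def card_cartesian_product)
  finally have samp2: "(\<Sum>t\<in>T. (\<Sum>s<R. a t (r s) - (\<Sum>u\<in>V. a t u) / ?N)\<^sup>2) \<le>
      R * (card X * ?N * (m * C ^ 4))"
    using samp R by (smt (verit) mult_left_mono of_nat_0_le_iff)
  have errsum: "(\<Sum>x\<in>X. err x) \<le> card X * (m * C ^ 4) / R"
  proof -
    have e: "(K x z j - S x z j)\<^sup>2 = (\<Sum>s<R. a (x, z, j) (r s) - (\<Sum>u\<in>V. a (x, z, j) u) / ?N)\<^sup>2 / (real R)\<^sup>2"
      for x z j
    proof -
      have "(\<Sum>s<R. a (x, z, j) (r s) - (\<Sum>u\<in>V. a (x, z, j) u) / ?N) = R * (S x z j - K x z j)"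
        using R by (simp add: sum_subtractf S_def K_def codeg_def a_def algebra_simps)
      then show ?thesis using R by (simp add: power_mult_distrib power2_commute)
    qed
    have "(\<Sum>x\<in>X. err x) = (\<Sum>x\<in>X. \<Sum>p\<in>V \<times> {..<m}. (K x (fst p) (snd p) - S x (fst p) (snd p))\<^sup>2) / ?N"
      by (simp add: err_def sum_divide_distrib)
    also have "\<dots> = (\<Sum>t\<in>T. (\<Sum>s<R. a t (r s) - (\<Sum>u\<in>V. a t u) / ?N)\<^sup>2 / (real R)\<^sup>2) / ?N"
      unfolding T_def sum.cartesian_product
      by (intro arg_cong2[where f = "(/)"] sum.cong refl) (auto simp: e)
    also have "\<dots> \<le> R * (card X * ?N * (m * C ^ 4)) / (real R)\<^sup>2 / ?N"
      using samp2 by (intro divide_right_mono) (auto simp flip: sum_divide_distrib intro: divide_right_mono)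
    also have "\<dots> = card X * (m * C ^ 4) / R" using N R by (simp add: power2_eq_square field_simps)
    finally show ?thesis .
  qed
  \<comment> \<open>Twice the bound on the average error. By Markov at least half of
    \<open>X\<close> has error at most \<open>D\<close>.\<close>
  define D where "D = 2 * (m * C ^ 4) / R"
  define Y where "Y = {x \<in> X. err x \<le> D}"
  have err0: "err x \<ge> 0" for x by (simp add: err_def sum_nonneg)
  have "card X \<le> 2 * card Y"
  proof (rule ccontr)
    assume "\<not> ?thesis"
    then have less: "card X < 2 * card (X - Y)"
      using finX by (simp add: Y_def card_Diff_subset)
    then have ne: "X - Y \<noteq> {}" by (intro notI) simp
    have "D \<ge> 0" using R C0 by (cases "m = 0") (auto simp: D_def)
    have "card X * (m * C ^ 4) / R = card X / 2 * D" by (simp add: D_def)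
    also have "\<dots> \<le> card (X - Y) * D" using less \<open>D \<ge> 0\<close> by (intro mult_right_mono) auto
    also have "\<dots> = (\<Sum>x\<in>X-Y. D)" by simp
    also have "\<dots> < (\<Sum>x\<in>X-Y. err x)"
      using finX ne by (intro sum_strict_mono) (auto simp: Y_def)
    also have "\<dots> \<le> (\<Sum>x\<in>X. err x)" using finX err0 by (intro sum_mono2) auto
    finally show False using errsum by simp
  qed
  then have cY: "card B ^ R < card Y" using contr by simp
  \<comment> \<open>Pigeonhole: the sample averages of \<open>x\<close> depend only on its colours
    to the \<open>R\<close> sample points, and there are \<open>card B ^ R\<close> such patterns.
    Two nodes with the same pattern have distance at most \<open>4 * D\<close>, which is where the
    constant 8 in the choice of \<open>R\<close> comes from.\<close>
  have "\<not> inj_on (\<lambda>x. restrict (\<lambda>s. g x (r s)) {..<R}) Y"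
  proof
    assume "inj_on (\<lambda>x. restrict (\<lambda>s. g x (r s)) {..<R}) Y"
    then have "card Y \<le> card ({..<R} \<rightarrow>\<^sub>E B)"
    proof (rule card_inj_on_le)
      show "(\<lambda>x. restrict (\<lambda>s. g x (r s)) {..<R}) ` Y \<subseteq> {..<R} \<rightarrow>\<^sub>E B"
        using gB by (intro image_subsetI) (simp add: restrict_PiE_iff)
    qed (use B in \<open>auto intro: finite_PiE\<close>)
    then show False using cY by (simp add: card_PiE)
  qed
  then obtain x y where xy: "x \<in> Y" "y \<in> Y" "x \<noteq> y"
    "restrict (\<lambda>s. g x (r s)) {..<R} = restrict (\<lambda>s. g y (r s)) {..<R}"
    by (auto simp: inj_on_def)
  then have "g x (r s) = g y (r s)" if "s < R" for s
    using that by (metis lessThan_iff restrict_apply')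
  then have Sxy: "S x z j = S y z j" for z j
    by (simp add: S_def a_def)
  have "power_cdist m V g x y = (\<Sum>p\<in>V \<times> {..<m}. (K x (fst p) (snd p) - K y (fst p) (snd p))\<^sup>2) / ?N"
    unfolding power_cdist_def cdist_def K_def[symmetric] sum_divide_distrib[symmetric]
    by (subst sum.swap) (simp add: sum.cartesian_product split_def)
  also have "\<dots> \<le> (\<Sum>p\<in>V \<times> {..<m}. 2 * (K x (fst p) (snd p) - S x (fst p) (snd p))\<^sup>2 +
      2 * (K y (fst p) (snd p) - S y (fst p) (snd p))\<^sup>2) / ?N"
  proof (intro divide_right_mono sum_mono)
    fix p
    have "(a - b)\<^sup>2 \<le> 2 * (a - c)\<^sup>2 + 2 * (b - c)\<^sup>2" for a b c :: real
      using zero_le_power2[of "a + b - 2 * c"] by (simp add: power2_eq_square algebra_simps)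
    then show "(K x (fst p) (snd p) - K y (fst p) (snd p))\<^sup>2 \<le> 2 * (K x (fst p) (snd p) - S x (fst p) (snd p))\<^sup>2 +
      2 * (K y (fst p) (snd p) - S y (fst p) (snd p))\<^sup>2" unfolding Sxy .
  qed simp
  also have "\<dots> = 2 * err x + 2 * err y"
    by (simp add: err_def sum.distrib add_divide_distrib flip: sum_distrib_left)
  also have "\<dots> \<le> 4 * D" using xy by (simp add: Y_def)
  also have "\<dots> < \<theta>" using R by (simp add: D_def field_simps)
  finally show False using sep[of x y] xy by (simp add: Y_def)
qed

text \<open>A maximal \<theta>-separated set \<open>X\<close> serves as a set of centres: by
  maximality every node is within \<theta> of one of them. Two nodes with a common centre are at
  distance at most \<open>2 * \<theta> + 2 * \<theta>\<close>, as the triangle inequality for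
  squared distances costs a factor 2.\<close>

lemma bounded_partition:
  fixes g :: "nat \<Rightarrow> nat \<Rightarrow> real"
  assumes V: "finite V" "V \<noteq> {}" and gB: "\<And>x y. g x y \<in> B" and B: "finite B"
    and bound: "\<And>b j. b \<in> B \<Longrightarrow> j < m \<Longrightarrow> \<bar>b ^ j\<bar> \<le> C"
    and R: "R > 0" "real R * \<theta> > 8 * (m * C ^ 4)" and \<theta>: "\<theta> > 0"
  shows "\<exists>\<tau>::nat \<Rightarrow> nat. (\<forall>x\<in>V. \<tau> x < 2 * card B ^ R) \<and>
    (\<forall>x\<in>V. \<forall>y\<in>V. \<tau> x = \<tau> y \<longrightarrow> power_cdist m V g x y \<le> 4 * \<theta>)"
proof -
  let ?D = "power_cdist m V g"
  let ?sep = "\<lambda>X. X \<subseteq> V \<and> (\<forall>x\<in>X. \<forall>y\<in>X. x \<noteq> y \<longrightarrow> ?D x y \<ge> \<theta>)"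
  have "\<exists>X. ?sep X \<and> (\<forall>Y. ?sep Y \<longrightarrow> card Y \<le> card X)"
  proof (rule ex_has_greatest_nat)
    show "?sep {}" by simp
    show "\<forall>Y. ?sep Y \<longrightarrow> card Y < Suc (card V)" using V by (auto simp: less_Suc_eq_le intro: card_mono)
  qed
  then obtain X where X: "?sep X" and max: "\<And>Y. ?sep Y \<Longrightarrow> card Y \<le> card X" by blast
  have finX: "finite X" using V X finite_subset by blast
  have cX: "card X \<le> 2 * card B ^ R"
    using X by (intro card_separated_le[OF V gB B bound _ _ R]) auto
  have Dsym: "?D x y = ?D y x" for x y
    by (simp add: power_cdist_def cdist_def power2_commute)
  have near: "\<exists>x0\<in>X. ?D x x0 \<le> \<theta>" if x: "x \<in> V" for x
  proof (cases "x \<in> X")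
    case True
    then show ?thesis using \<theta> by (intro bexI[of _ x]) (simp_all add: power_cdist_self)
  next
    case False
    have "\<not> ?sep (insert x X)" using max[of "insert x X"] False finX by auto
    then show ?thesis using X x Dsym by (metis insertE insert_subset linorder_le_cases)
  qed
  then obtain c where c: "\<And>x. x \<in> V \<Longrightarrow> c x \<in> X" "\<And>x. x \<in> V \<Longrightarrow> ?D x (c x) \<le> \<theta>" by metis
  obtain h where h: "bij_betw h X {..<card X}" using ex_bij_betw_finite_nat[OF finX] by (auto simp: atLeast0LessThan)
  show ?thesis
  proof (intro exI[of _ "h \<circ> c"] conjI ballI impI)
    fix x assume "x \<in> V"
    then have "h (c x) < card X" using h c by (auto simp: bij_betw_def)
    then show "(h \<circ> c) x < 2 * card B ^ R" using cX by simp
  next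
    fix x y assume xy: "x \<in> V" "y \<in> V" "(h \<circ> c) x = (h \<circ> c) y"
    then have "c x = c y" using h c by (auto simp: bij_betw_def inj_on_def)
    then show "?D x y \<le> 4 * \<theta>"
      using power_cdist_triangle[of m V g x y "c x"] c(2)[OF xy(1)] c(2)[OF xy(2)] by simp
  qed
qed

section \<open>Cut-norm estimates and the counting lemma\<close>

definition part :: "nat set \<Rightarrow> (nat \<Rightarrow> nat) \<Rightarrow> nat \<Rightarrow> nat set" where
  "part V \<tau> x = {y \<in> V. \<tau> y = \<tau> x}"

text \<open>Conditional expectation onto the functions that are constant on the classes of \<tau>;
  in particular it is self-adjoint.\<close>

definition part_avg :: "nat set \<Rightarrow> (nat \<Rightarrow> nat) \<Rightarrow> (nat \<Rightarrow> real) \<Rightarrow> nat \<Rightarrow> real" where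
  "part_avg V \<tau> u x = (\<Sum>y\<in>part V \<tau> x. u y) / card (part V \<tau> x)"

lemma finite_part: "finite V \<Longrightarrow> finite (part V \<tau> x)"
  by (simp add: part_def)

lemma card_part_pos: "finite V \<Longrightarrow> x \<in> V \<Longrightarrow> card (part V \<tau> x) > 0"
  by (auto simp: part_def card_gt_0_iff)

lemma part_avg_adjoint:
  assumes "finite V"
  shows "(\<Sum>x\<in>V. part_avg V \<tau> u x * h x) = (\<Sum>x\<in>V. u x * part_avg V \<tau> h x)"
proof -
  have e: "part_avg V \<tau> w x = (\<Sum>y\<in>V. if \<tau> y = \<tau> x then w y / card (part V \<tau> x) else 0)" for w x
    unfolding part_avg_def part_def sum_divide_distrib using assms
    by (subst sum.inter_filter) auto
  have "(\<Sum>x\<in>V. part_avg V \<tau> u x * h x) =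
     (\<Sum>x\<in>V. \<Sum>y\<in>V. if \<tau> y = \<tau> x then u y * h x / card (part V \<tau> x) else 0)"
    unfolding e sum_distrib_right by (intro sum.cong refl) auto
  also have "\<dots> = (\<Sum>y\<in>V. \<Sum>x\<in>V. if \<tau> y = \<tau> x then u y * h x / card (part V \<tau> x) else 0)"
    by (rule sum.swap)
  also have "\<dots> = (\<Sum>y\<in>V. u y * part_avg V \<tau> h y)"
    unfolding e sum_distrib_left by (intro sum.cong refl) (auto simp: part_def)
  finally show ?thesis .
qed

lemma abs_part_avg_le:
  assumes "finite V" "\<And>y. y \<in> V \<Longrightarrow> \<bar>u y\<bar> \<le> M" "x \<in> V"
  shows "\<bar>part_avg V \<tau> u x\<bar> \<le> M"
proof -
  have "\<bar>\<Sum>y\<in>part V \<tau> x. u y\<bar> \<le> (\<Sum>y\<in>part V \<tau> x. M)"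
    using assms by (intro order_trans[OF sum_abs] sum_mono) (auto simp: part_def)
  then show ?thesis using card_part_pos[OF assms(1,3), of \<tau>]
    by (simp add: part_avg_def abs_divide field_simps)
qed

text \<open>Every nonempty class contributes exactly 1 to the sum.\<close>

lemma sum_inverse_card_part_le:
  assumes "finite V" "\<And>x. x \<in> V \<Longrightarrow> \<tau> x < (q::nat)"
  shows "(\<Sum>x\<in>V. 1 / card (part V \<tau> x)) \<le> real q"
proof -
  have "(\<Sum>x\<in>V. 1 / card (part V \<tau> x)) =
     (\<Sum>i\<in>{..<q}. \<Sum>x\<in>{x\<in>V. \<tau> x = i}. 1 / card (part V \<tau> x))"
    using assms by (subst sum.group) auto
  also have "\<dots> \<le> (\<Sum>i\<in>{..<q}. 1)"
  proof (rule sum_mono)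
    fix i
    have "(\<Sum>x\<in>{x\<in>V. \<tau> x = i}. 1 / card (part V \<tau> x)) =
       (\<Sum>x\<in>{x\<in>V. \<tau> x = i}. 1 / card {x\<in>V. \<tau> x = i})"
      by (intro sum.cong refl) (auto simp: part_def)
    also have "\<dots> \<le> 1" by simp
    finally show "(\<Sum>x\<in>{x\<in>V. \<tau> x = i}. 1 / card (part V \<tau> x)) \<le> 1" .
  qed
  finally show ?thesis by simp
qed

text \<open>Let \<open>u'\<close> be \<open>u\<close> minus its class averages. Cauchy-Schwarz
  reduces the form to the norm of \<open>p = G u'\<close>, whose square is the quadratic form of the
  codegree kernel at \<open>u'\<close>. Self-adjointness moves the centring from \<open>u\<close> to
  the rows of that kernel, and centred rows are small because rows of the same class are close.
  Cauchy-Schwarz is applied three times in this chain, hence the three square roots; the factor 2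
  bounds \<open>u'\<close>.\<close>

lemma centred_bilinear_bound:
  fixes G :: "nat \<Rightarrow> nat \<Rightarrow> real" and \<epsilon> :: real
  assumes V: "finite V" "V \<noteq> {}" and sym: "\<And>x y. G x y = G y x"
    and q: "\<And>x. x \<in> V \<Longrightarrow> \<tau> x < (q::nat)"
    and C: "\<And>x y. x \<in> V \<Longrightarrow> y \<in> V \<Longrightarrow> cdist V G x y \<le> C"
    and eps: "(\<Sum>x\<in>V. \<Sum>y\<in>part V \<tau> x. cdist V G x y) \<le> (card V)\<^sup>2 * \<epsilon>"
    and u: "\<And>x. x \<in> V \<Longrightarrow> \<bar>u x\<bar> \<le> 1" and v: "\<And>x. x \<in> V \<Longrightarrow> \<bar>v x\<bar> \<le> 1"
  shows "\<bar>\<Sum>x\<in>V. \<Sum>y\<in>V. (u x - part_avg V \<tau> u x) * v y * G x y\<bar> \<le>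
    (card V)\<^sup>2 * sqrt (2 * sqrt (sqrt (C * q * \<epsilon>)))"
proof -
  let ?N = "real (card V)"
  have N: "?N > 0" using V by (simp add: card_gt_0_iff)
  let ?c = "\<lambda>x. real (card (part V \<tau> x))"
  let ?D = "cdist V G" and ?K = "codeg V G"
  define u' where "u' x = u x - part_avg V \<tau> u x" for x
  have u2: "\<bar>u' x\<bar> \<le> 2" if "x \<in> V" for x
  proof -
    have "\<bar>part_avg V \<tau> u x\<bar> \<le> 1" by (rule abs_part_avg_le[OF V(1) u that])
    then show ?thesis using u[OF that] unfolding u'_def by linarith
  qed
  \<comment> \<open>This averages over \<open>x\<close> and then over the class of \<open>x\<close>,
    whereas \<open>eps\<close> counts all pairs equally and so gives little weight to small classes.
    Cauchy-Schwarz bridges the two, using that the squares of \<open>1 / ?c x\<close> summed over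
    pairs in a common class give at most \<open>q\<close>.\<close>
  define E1 where "E1 = (\<Sum>x\<in>V. \<Sum>y\<in>part V \<tau> x. ?D x y / ?c x) / ?N"
  have C0: "C \<ge> 0" using V C cdist_nonneg by (metis all_not_in_conv order_trans)
  have E1: "E1 \<le> sqrt (C * q * \<epsilon>)"
  proof -
    let ?P = "Sigma V (part V \<tau>)"
    have finP: "finite ?P" using V finite_part by blast
    have "(\<Sum>p\<in>?P. ?D (fst p) (snd p) * (1 / ?c (fst p)))\<^sup>2 \<le>
      (\<Sum>p\<in>?P. (?D (fst p) (snd p))\<^sup>2) * (\<Sum>p\<in>?P. (1 / ?c (fst p))\<^sup>2)"
      by (rule Cauchy_Schwarz_ineq_sum)
    also have "\<dots> \<le> (C * (?N\<^sup>2 * \<epsilon>)) * real q"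
    proof (rule mult_mono)
      have "(\<Sum>p\<in>?P. (?D (fst p) (snd p))\<^sup>2) \<le> (\<Sum>p\<in>?P. C * ?D (fst p) (snd p))"
        using C cdist_nonneg by (intro sum_mono) (auto simp: part_def power2_eq_square intro!: mult_right_mono)
      also have "\<dots> = C * (\<Sum>x\<in>V. \<Sum>y\<in>part V \<tau> x. ?D x y)"
        using V finite_part by (simp add: sum_distrib_left sum.Sigma split_def)
      also have "\<dots> \<le> C * (?N\<^sup>2 * \<epsilon>)" using eps C0 by (intro mult_left_mono) auto
      finally show le: "(\<Sum>p\<in>?P. (?D (fst p) (snd p))\<^sup>2) \<le> C * (?N\<^sup>2 * \<epsilon>)" .
      then show "0 \<le> C * (?N\<^sup>2 * \<epsilon>)" by (rule order_trans[OF sum_nonneg, rotated]) simp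
      have "(\<Sum>p\<in>?P. (1 / ?c (fst p))\<^sup>2) = (\<Sum>x\<in>V. \<Sum>y\<in>part V \<tau> x. (1 / ?c x)\<^sup>2)"
        by (subst sum.Sigma) (use V finite_part in \<open>auto simp: split_def\<close>)
      also have "\<dots> = (\<Sum>x\<in>V. 1 / ?c x)"
        by (intro sum.cong refl) (simp add: power2_eq_square)
      finally show "(\<Sum>p\<in>?P. (1 / ?c (fst p))\<^sup>2) \<le> real q"
        using sum_inverse_card_part_le[OF V(1) q] by simp
    qed (simp add: sum_nonneg)
    finally have "(\<Sum>p\<in>?P. ?D (fst p) (snd p) * (1 / ?c (fst p)))\<^sup>2 \<le> C * q * \<epsilon> * ?N\<^sup>2"
      by (simp add: mult_ac)
    moreover have "(\<Sum>p\<in>?P. ?D (fst p) (snd p) * (1 / ?c (fst p))) = E1 * ?N"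
      using V finite_part N by (simp add: E1_def sum.Sigma split_def)
    ultimately have "E1\<^sup>2 * ?N\<^sup>2 \<le> C * q * \<epsilon> * ?N\<^sup>2" by (simp add: power_mult_distrib)
    then have "E1\<^sup>2 \<le> C * q * \<epsilon>" using N by simp
    then show ?thesis by (rule real_le_rsqrt)
  qed
  define \<kappa> where "\<kappa> z = (\<Sum>x\<in>V. u' x * ?K x z)" for z
  have kappa: "(\<kappa> z)\<^sup>2 \<le> ?N * (\<Sum>x\<in>V. (\<Sum>y\<in>part V \<tau> x. (?K x z - ?K y z)\<^sup>2) / ?c x)" for z
  proof -
    define w where "w x = ?K x z - part_avg V \<tau> (\<lambda>x. ?K x z) x" for x
    \<comment> \<open>The centring passes from the test function to the column of the codegree
      kernel.\<close>
    have "\<kappa> z = (\<Sum>x\<in>V. u x * w x)"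
      using part_avg_adjoint[OF V(1), of \<tau> u "\<lambda>x. ?K x z"]
      by (simp add: \<kappa>_def u'_def w_def left_diff_distrib right_diff_distrib sum_subtractf)
    then have "(\<kappa> z)\<^sup>2 \<le> (\<Sum>x\<in>V. (u x)\<^sup>2) * (\<Sum>x\<in>V. (w x)\<^sup>2)"
      by (simp add: Cauchy_Schwarz_ineq_sum)
    also have "\<dots> \<le> ?N * (\<Sum>x\<in>V. (w x)\<^sup>2)"
    proof (rule mult_right_mono)
      have "(\<Sum>x\<in>V. (u x)\<^sup>2) \<le> (\<Sum>x\<in>V. 1)"
        using u by (intro sum_mono) (simp add: abs_square_le_1)
      then show "(\<Sum>x\<in>V. (u x)\<^sup>2) \<le> ?N" by simp
    qed (simp add: sum_nonneg)
    also have "\<dots> \<le> ?N * (\<Sum>x\<in>V. (\<Sum>y\<in>part V \<tau> x. (?K x z - ?K y z)\<^sup>2) / ?c x)"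
    proof (intro mult_left_mono sum_mono)
      fix x assume x: "x \<in> V"
      note c = card_part_pos[OF V(1) x, of \<tau>]
      have "w x = (\<Sum>y\<in>part V \<tau> x. ?K x z - ?K y z) / ?c x"
        using c by (simp add: w_def part_avg_def sum_subtractf diff_divide_distrib)
      then have "(w x)\<^sup>2 = (\<Sum>y\<in>part V \<tau> x. ?K x z - ?K y z)\<^sup>2 / (?c x)\<^sup>2" by (simp add: power_divide)
      also have "\<dots> \<le> ((\<Sum>y\<in>part V \<tau> x. (?K x z - ?K y z)\<^sup>2) * ?c x) / (?c x)\<^sup>2"
        by (intro divide_right_mono sum_squared_le_sum_of_squares) simp
      also have "\<dots> = (\<Sum>y\<in>part V \<tau> x. (?K x z - ?K y z)\<^sup>2) / ?c x"
        using c by (simp add: power2_eq_square)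
      finally show "(w x)\<^sup>2 \<le> (\<Sum>y\<in>part V \<tau> x. (?K x z - ?K y z)\<^sup>2) / ?c x" .
    qed simp
    finally show ?thesis .
  qed
  have sumk: "(\<Sum>z\<in>V. (\<kappa> z)\<^sup>2) \<le> ?N ^ 3 * E1"
  proof -
    have "(\<Sum>z\<in>V. (\<kappa> z)\<^sup>2) \<le> (\<Sum>z\<in>V. ?N * (\<Sum>x\<in>V. (\<Sum>y\<in>part V \<tau> x. (?K x z - ?K y z)\<^sup>2) / ?c x))"
      by (intro sum_mono kappa)
    also have "\<dots> = ?N * (\<Sum>x\<in>V. \<Sum>y\<in>part V \<tau> x. (\<Sum>z\<in>V. (?K x z - ?K y z)\<^sup>2) / ?c x)"
      unfolding sum_distrib_left[symmetric] sum_divide_distrib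
      by (subst sum.swap, subst (2) sum.swap) simp
    also have "\<dots> = ?N * (\<Sum>x\<in>V. \<Sum>y\<in>part V \<tau> x. ?N * (?D x y / ?c x))"
      using N by (simp add: cdist_def)
    also have "\<dots> = ?N * (?N * (\<Sum>x\<in>V. \<Sum>y\<in>part V \<tau> x. ?D x y / ?c x))"
      by (simp only: sum_distrib_left)
    also have "\<dots> = ?N ^ 3 * E1"
      using N by (simp add: E1_def power3_eq_cube)
    finally show ?thesis .
  qed
  have E10: "E1 \<ge> 0" by (simp add: E1_def sum_nonneg cdist_nonneg)
  have sumabs: "(\<Sum>z\<in>V. \<bar>\<kappa> z\<bar>) \<le> ?N\<^sup>2 * sqrt E1"
  proof -
    have "(\<Sum>z\<in>V. \<bar>\<kappa> z\<bar>)\<^sup>2 \<le> (\<Sum>z\<in>V. \<bar>\<kappa> z\<bar>\<^sup>2) * ?N" by (rule sum_squared_le_sum_of_squares)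
    also have "\<dots> \<le> ?N ^ 3 * E1 * ?N" using sumk by (intro mult_right_mono) auto
    also have "\<dots> = (?N\<^sup>2 * sqrt E1)\<^sup>2"
      using E10 by (simp add: power_mult_distrib power3_eq_cube power2_eq_square)
    finally show ?thesis by (rule power2_le_imp_le) (use E10 in simp)
  qed
  define p where "p w = (\<Sum>x\<in>V. u' x * G x w)" for w
  have sump: "(\<Sum>w\<in>V. (p w)\<^sup>2) \<le> 2 * ?N ^ 3 * sqrt E1"
  proof -
    have "(\<Sum>w\<in>V. (p w)\<^sup>2) = (\<Sum>w\<in>V. \<Sum>z\<in>V. \<Sum>x\<in>V. u' z * (u' x * (G x w * G w z)))"
      unfolding p_def power2_eq_square sum_product
      by (subst (2) sum.swap) (intro sum.cong refl, simp add: sym mult_ac)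
    also have "\<dots> = (\<Sum>z\<in>V. \<Sum>x\<in>V. \<Sum>w\<in>V. u' z * (u' x * (G x w * G w z)))"
      by (subst sum.swap, subst (2) sum.swap) simp
    also have "\<dots> = ?N * (\<Sum>z\<in>V. u' z * \<kappa> z)"
      using N by (simp add: \<kappa>_def codeg_def flip: sum_distrib_left)
        (simp add: sum_distrib_left sum_divide_distrib)
    also have "(\<Sum>z\<in>V. u' z * \<kappa> z) \<le> (\<Sum>z\<in>V. 2 * \<bar>\<kappa> z\<bar>)"
    proof (rule sum_mono)
      fix z assume "z \<in> V"
      have "u' z * \<kappa> z \<le> \<bar>u' z\<bar> * \<bar>\<kappa> z\<bar>" by (metis abs_ge_self abs_mult)
      also have "\<dots> \<le> 2 * \<bar>\<kappa> z\<bar>" using u2[OF \<open>z \<in> V\<close>] by (intro mult_right_mono) auto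
      finally show "u' z * \<kappa> z \<le> 2 * \<bar>\<kappa> z\<bar>" .
    qed
    also have "\<dots> \<le> 2 * (?N\<^sup>2 * sqrt E1)" using sumabs by (simp flip: sum_distrib_left)
    finally show ?thesis using N by (simp add: power3_eq_cube power2_eq_square mult_ac)
  qed
  have "(\<Sum>x\<in>V. \<Sum>y\<in>V. (u x - part_avg V \<tau> u x) * v y * G x y) = (\<Sum>y\<in>V. v y * p y)"
    unfolding p_def sum_distrib_left u'_def by (subst sum.swap) (simp add: mult_ac)
  moreover have "\<bar>\<Sum>y\<in>V. v y * p y\<bar> \<le> ?N\<^sup>2 * sqrt (2 * sqrt E1)"
  proof -
    have "\<bar>\<Sum>y\<in>V. v y * p y\<bar>\<^sup>2 \<le> (\<Sum>y\<in>V. (v y)\<^sup>2) * (\<Sum>y\<in>V. (p y)\<^sup>2)"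
      by (simp add: Cauchy_Schwarz_ineq_sum)
    also have "\<dots> \<le> ?N * (2 * ?N ^ 3 * sqrt E1)"
    proof (rule mult_mono)
      have "(\<Sum>x\<in>V. (v x)\<^sup>2) \<le> (\<Sum>x\<in>V. 1)"
        using v by (intro sum_mono) (simp add: abs_square_le_1)
      then show "(\<Sum>x\<in>V. (v x)\<^sup>2) \<le> ?N" by simp
    qed (use sump in \<open>auto simp: sum_nonneg\<close>)
    also have "\<dots> = (?N\<^sup>2 * sqrt (2 * sqrt E1))\<^sup>2"
      using E10 by (simp add: power_mult_distrib power3_eq_cube power2_eq_square)
    finally show ?thesis by (rule power2_le_imp_le) (use E10 in simp)
  qed
  moreover have "?N\<^sup>2 * sqrt (2 * sqrt E1) \<le> ?N\<^sup>2 * sqrt (2 * sqrt (sqrt (C * q * \<epsilon>)))"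
    using E1 by (intro mult_left_mono real_sqrt_le_mono) auto
  ultimately show ?thesis by simp
qed

text \<open>By self-adjointness the averaged kernel tested with \<open>u\<close> and
  \<open>v\<close> equals \<open>G\<close> tested with their class averages. The difference splits
  into a part with \<open>u\<close> centred and a part with \<open>v\<close> centred, and symmetry
  of \<open>G\<close> turns the second into the form of the first.\<close>

lemma averaged_bilinear_bound:
  fixes G :: "nat \<Rightarrow> nat \<Rightarrow> real" and \<epsilon> :: real
  assumes V: "finite V" "V \<noteq> {}" and sym: "\<And>x y. G x y = G y x"
    and q: "\<And>x. x \<in> V \<Longrightarrow> \<tau> x < (q::nat)"
    and C: "\<And>x y. x \<in> V \<Longrightarrow> y \<in> V \<Longrightarrow> cdist V G x y \<le> C"
    and eps: "(\<Sum>x\<in>V. \<Sum>y\<in>part V \<tau> x. cdist V G x y) \<le> (card V)\<^sup>2 * \<epsilon>"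
    and u: "\<And>x. x \<in> V \<Longrightarrow> \<bar>u x\<bar> \<le> 1" and v: "\<And>x. x \<in> V \<Longrightarrow> \<bar>v x\<bar> \<le> 1"
  shows "\<bar>\<Sum>x\<in>V. \<Sum>y\<in>V. u x * v y * (G x y - part_avg V \<tau> (\<lambda>x'. part_avg V \<tau> (G x') y) x)\<bar> \<le>
    2 * (card V)\<^sup>2 * sqrt (2 * sqrt (sqrt (C * q * \<epsilon>)))"
proof -
  let ?a = "part_avg V \<tau>"
  have "(\<Sum>x\<in>V. \<Sum>y\<in>V. u x * v y * ?a (\<lambda>x'. ?a (G x') y) x) =
     (\<Sum>y\<in>V. v y * (\<Sum>x\<in>V. u x * ?a (\<lambda>x'. ?a (G x') y) x))"
    unfolding sum_distrib_left by (subst sum.swap) (simp add: mult_ac)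
  also have "\<dots> = (\<Sum>y\<in>V. v y * (\<Sum>x\<in>V. ?a u x * ?a (G x) y))"
    by (simp add: part_avg_adjoint[OF V(1)])
  also have "\<dots> = (\<Sum>x\<in>V. ?a u x * (\<Sum>y\<in>V. v y * ?a (G x) y))"
    unfolding sum_distrib_left by (subst sum.swap) (simp add: mult_ac)
  also have "\<dots> = (\<Sum>x\<in>V. ?a u x * (\<Sum>y\<in>V. ?a v y * G x y))"
    by (simp add: part_avg_adjoint[OF V(1)])
  finally have avg: "(\<Sum>x\<in>V. \<Sum>y\<in>V. u x * v y * ?a (\<lambda>x'. ?a (G x') y) x) =
     (\<Sum>x\<in>V. \<Sum>y\<in>V. ?a u x * ?a v y * G x y)"
    by (simp add: sum_distrib_left mult_ac)
  have swap: "(\<Sum>x\<in>V. \<Sum>y\<in>V. ?a u x * (v y - ?a v y) * G x y) =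
     (\<Sum>x\<in>V. \<Sum>y\<in>V. (v x - ?a v x) * ?a u y * G x y)"
    by (subst sum.swap) (intro sum.cong refl, simp add: sym mult_ac)
  have "(\<Sum>x\<in>V. \<Sum>y\<in>V. u x * v y * (G x y - ?a (\<lambda>x'. ?a (G x') y) x)) =
    (\<Sum>x\<in>V. \<Sum>y\<in>V. u x * v y * G x y) - (\<Sum>x\<in>V. \<Sum>y\<in>V. ?a u x * ?a v y * G x y)"
    by (simp add: right_diff_distrib sum_subtractf avg)
  also have "\<dots> = (\<Sum>x\<in>V. \<Sum>y\<in>V. (u x - ?a u x) * v y * G x y) +
      (\<Sum>x\<in>V. \<Sum>y\<in>V. ?a u x * (v y - ?a v y) * G x y)"
    by (simp add: left_diff_distrib right_diff_distrib sum_subtractf)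
  finally have eq: "(\<Sum>x\<in>V. \<Sum>y\<in>V. u x * v y * (G x y - ?a (\<lambda>x'. ?a (G x') y) x)) =
      (\<Sum>x\<in>V. \<Sum>y\<in>V. (u x - ?a u x) * v y * G x y) +
      (\<Sum>x\<in>V. \<Sum>y\<in>V. (v x - ?a v x) * ?a u y * G x y)" unfolding swap .
  have "\<bar>\<Sum>x\<in>V. \<Sum>y\<in>V. (u x - ?a u x) * v y * G x y\<bar> \<le> (card V)\<^sup>2 * sqrt (2 * sqrt (sqrt (C * q * \<epsilon>)))"
    by (rule centred_bilinear_bound[OF V sym q C eps u v])
  moreover have "\<bar>\<Sum>x\<in>V. \<Sum>y\<in>V. (v x - ?a v x) * ?a u y * G x y\<bar> \<le>
      (card V)\<^sup>2 * sqrt (2 * sqrt (sqrt (C * q * \<epsilon>)))"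
    by (rule centred_bilinear_bound[OF V sym q C eps v]) (use abs_part_avg_le[OF V(1) u] in auto)
  ultimately show ?thesis unfolding eq by linarith
qed

lemma sum_PiE_two:
  assumes "a \<noteq> b"
  shows "(\<Sum>\<xi>\<in>{a, b} \<rightarrow>\<^sub>E V. h (\<xi> a) (\<xi> b)) = (\<Sum>x\<in>V. \<Sum>y\<in>V. h x y)"
  unfolding sum.cartesian_product
  by (rule sum.reindex_bij_witness[where j = "\<lambda>\<xi>. (\<xi> a, \<xi> b)"
        and i = "\<lambda>(x, y) i. if i = a then x else if i = b then y else undefined"])
     (use assms in \<open>auto simp: PiE_iff extensional_def fun_eq_iff\<close>)

text \<open>With the images of all other nodes fixed, every remaining edge contains at most one end
  of \<open>e0\<close>. Their product is a function of the image of \<open>a\<close> times a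
  function of the image of \<open>b\<close>, and after scaling by powers of \<open>M\<close> these
  are admissible test functions for \<open>Y\<close>.\<close>

lemma replace_edge_bound:
  fixes Y :: "nat set \<Rightarrow> real" and M \<eta> :: real
  assumes F: "multigraph F" and V: "finite V" "V \<noteq> {}"
    and e0: "e0 \<in># edges F" and M: "M \<ge> 1" and S: "S = set_mset (edges F) - {e0}"
    and Z: "\<And>e A. \<bar>Z e A\<bar> \<le> M"
    and Y: "\<And>u v. (\<And>x. x \<in> V \<Longrightarrow> \<bar>u x\<bar> \<le> 1) \<Longrightarrow> (\<And>x. x \<in> V \<Longrightarrow> \<bar>v x\<bar> \<le> 1) \<Longrightarrow>
       \<bar>\<Sum>x\<in>V. \<Sum>y\<in>V. u x * v y * Y {x, y}\<bar> \<le> (card V)\<^sup>2 * \<eta>"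
  shows "\<bar>\<Sum>\<phi>\<in>nodes F \<rightarrow>\<^sub>E V. Y (\<phi> ` e0) * (\<Prod>e\<in>S. Z e (\<phi> ` e))\<bar> \<le>
    card V ^ card (nodes F) * (M ^ card S * \<eta>)"
proof -
  obtain a b where ab: "a < b" "e0 = {a, b}" "a \<in> nodes F" "b \<in> nodes F"
    using F e0 by (elim multigraph_edgeE)
  let ?R = "nodes F - {a, b}"
  have finS: "finite S" using S by simp
  have finN: "finite (nodes F)" using F by (simp add: multigraph_def)
  have card2: "card e = 2" if "e \<in> S" for e using that F S by (auto simp: multigraph_def)
  have nb: "b \<notin> e" if "e \<in> S" "a \<in> e" for e
  proof
    assume "b \<in> e"
    then have "{a, b} = e" using that card2[OF that(1)] ab
      by (intro card_subset_eq) (auto intro: card_ge_0_finite)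
    then show False using that S ab by simp
  qed
  \<comment> \<open>The edges that meet neither end are counted with those at \<open>b\<close>; they
    are constant once the other images are fixed.\<close>
  define Sa where "Sa = {e \<in> S. a \<in> e}"
  define Sb where "Sb = {e \<in> S. a \<notin> e}"
  have Sab: "S = Sa \<union> Sb" "Sa \<inter> Sb = {}" "finite Sa" "finite Sb"
    using finS by (auto simp: Sa_def Sb_def)
  have N: "?R \<union> {a, b} = nodes F" using ab by auto
  have one: "\<bar>\<Sum>\<xi>\<in>{a, b} \<rightarrow>\<^sub>E V. Y ((\<lambda>i. if i \<in> ?R then \<zeta> i else \<xi> i) ` e0) *
      (\<Prod>e\<in>S. Z e ((\<lambda>i. if i \<in> ?R then \<zeta> i else \<xi> i) ` e))\<bar> \<le> M ^ card S * ((card V)\<^sup>2 * \<eta>)" for \<zeta>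
  proof -
    define pa where "pa x = (\<Prod>e\<in>Sa. Z e ((\<lambda>i. if i \<in> ?R then \<zeta> i else x) ` e))" for x
    define pb where "pb x = (\<Prod>e\<in>Sb. Z e ((\<lambda>i. if i \<in> ?R then \<zeta> i else x) ` e))" for x
    have prod_le: "\<bar>\<Prod>e\<in>T. Z e (A e)\<bar> \<le> M ^ card T" if "finite T" for T A
    proof -
      have "\<bar>\<Prod>e\<in>T. Z e (A e)\<bar> = (\<Prod>e\<in>T. \<bar>Z e (A e)\<bar>)" by (rule abs_prod)
      also have "\<dots> \<le> (\<Prod>e\<in>T. M)" using Z by (intro prod_mono) auto
      finally show ?thesis by simp
    qed
    have "(\<Sum>\<xi>\<in>{a, b} \<rightarrow>\<^sub>E V. Y ((\<lambda>i. if i \<in> ?R then \<zeta> i else \<xi> i) ` e0) *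
      (\<Prod>e\<in>S. Z e ((\<lambda>i. if i \<in> ?R then \<zeta> i else \<xi> i) ` e))) =
      (\<Sum>\<xi>\<in>{a, b} \<rightarrow>\<^sub>E V. pa (\<xi> a) * pb (\<xi> b) * Y {\<xi> a, \<xi> b})"
    proof (intro sum.cong refl)
      fix \<xi> :: "nat \<Rightarrow> nat"
      let ?c = "\<lambda>i. if i \<in> ?R then \<zeta> i else \<xi> i"
      have 1: "?c ` e0 = {\<xi> a, \<xi> b}" using ab by auto
      have sub: "e \<subseteq> nodes F" if "e \<in> S" for e using that F S by (auto simp: multigraph_def)
      have "(\<Prod>e\<in>S. Z e (?c ` e)) = (\<Prod>e\<in>Sa. Z e (?c ` e)) * (\<Prod>e\<in>Sb. Z e (?c ` e))"
        unfolding Sab(1) by (rule prod.union_disjoint[OF Sab(3,4,2)])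
      also have "(\<Prod>e\<in>Sa. Z e (?c ` e)) = pa (\<xi> a)"
        unfolding pa_def
      proof (intro prod.cong refl arg_cong[where f = "Z _"] image_cong)
        fix e i assume "e \<in> Sa" "i \<in> e"
        then show "?c i = (if i \<in> ?R then \<zeta> i else \<xi> a)"
          using nb[of e] sub[of e] by (auto simp: Sa_def)
      qed
      also have "(\<Prod>e\<in>Sb. Z e (?c ` e)) = pb (\<xi> b)"
        unfolding pb_def
      proof (intro prod.cong refl arg_cong[where f = "Z _"] image_cong)
        fix e i assume "e \<in> Sb" "i \<in> e"
        then show "?c i = (if i \<in> ?R then \<zeta> i else \<xi> b)"
          using sub[of e] by (auto simp: Sb_def)
      qed
      finally show "Y (?c ` e0) * (\<Prod>e\<in>S. Z e (?c ` e)) = pa (\<xi> a) * pb (\<xi> b) * Y {\<xi> a, \<xi> b}"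
        unfolding 1 by simp
    qed
    also have "\<dots> = (\<Sum>x\<in>V. \<Sum>y\<in>V. pa x * pb y * Y {x, y})"
      using ab by (intro sum_PiE_two) simp
    also have "\<dots> = M ^ card S * (\<Sum>x\<in>V. \<Sum>y\<in>V. (pa x / M ^ card Sa) * (pb y / M ^ card Sb) * Y {x, y})"
      using M Sab card_Un_disjoint[OF Sab(3,4,2)]
      by (simp add: sum_distrib_left power_add field_simps)
    finally have eq: "(\<Sum>\<xi>\<in>{a, b} \<rightarrow>\<^sub>E V. Y ((\<lambda>i. if i \<in> ?R then \<zeta> i else \<xi> i) ` e0) *
      (\<Prod>e\<in>S. Z e ((\<lambda>i. if i \<in> ?R then \<zeta> i else \<xi> i) ` e))) =
      M ^ card S * (\<Sum>x\<in>V. \<Sum>y\<in>V. (pa x / M ^ card Sa) * (pb y / M ^ card Sb) * Y {x, y})" .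
    have "\<bar>\<Sum>x\<in>V. \<Sum>y\<in>V. (pa x / M ^ card Sa) * (pb y / M ^ card Sb) * Y {x, y}\<bar> \<le> (card V)\<^sup>2 * \<eta>"
      by (rule Y) (use M prod_le Sab in \<open>auto simp: pa_def pb_def abs_divide divide_le_eq_1\<close>)
    then show ?thesis unfolding eq using M by (simp add: abs_mult mult_left_mono)
  qed
  have "(\<Sum>\<phi>\<in>nodes F \<rightarrow>\<^sub>E V. Y (\<phi> ` e0) * (\<Prod>e\<in>S. Z e (\<phi> ` e))) =
     (\<Sum>\<zeta>\<in>?R \<rightarrow>\<^sub>E V. \<Sum>\<xi>\<in>{a, b} \<rightarrow>\<^sub>E V. Y ((\<lambda>i. if i \<in> ?R then \<zeta> i else \<xi> i) ` e0) *
      (\<Prod>e\<in>S. Z e ((\<lambda>i. if i \<in> ?R then \<zeta> i else \<xi> i) ` e)))"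
    using sum_PiE_Un[of ?R "{a, b}" "\<lambda>\<phi>. Y (\<phi> ` e0) * (\<Prod>e\<in>S. Z e (\<phi> ` e))" V]
    unfolding N by blast
  also have "\<bar>\<dots>\<bar> \<le> (\<Sum>\<zeta>\<in>?R \<rightarrow>\<^sub>E V. M ^ card S * ((card V)\<^sup>2 * \<eta>))"
    by (intro order_trans[OF sum_abs] sum_mono one)
  also have "\<dots> = card V ^ card (nodes F) * (M ^ card S * \<eta>)"
  proof -
    have "card (nodes F) = card ?R + 2"
      using card_Un_disjoint[of ?R "{a, b}"] finN ab unfolding N by simp
    then show ?thesis using finN by (simp add: card_PiE power_add power2_eq_square)
  qed
  finally show ?thesis .
qed

text \<open>Edge weights are exchanged one edge at a time, all parallel edges together. In each
  exchange the difference of the two kernels occurs at a single edge and is small in cut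
  norm.\<close>

lemma counting_lemma:
  fixes U W :: "nat set \<Rightarrow> nat \<Rightarrow> real" and M \<eta> :: real
  assumes F: "multigraph F" and V: "finite V" "V \<noteq> {}" and M: "M \<ge> 1"
    and U: "\<And>e A. e \<in># edges F \<Longrightarrow> \<bar>U A (count (edges F) e)\<bar> \<le> M"
    and W: "\<And>e A. e \<in># edges F \<Longrightarrow> \<bar>W A (count (edges F) e)\<bar> \<le> M"
    and UW: "\<And>e u v. e \<in># edges F \<Longrightarrow> (\<And>x. x \<in> V \<Longrightarrow> \<bar>u x\<bar> \<le> 1) \<Longrightarrow> (\<And>x. x \<in> V \<Longrightarrow> \<bar>v x\<bar> \<le> 1) \<Longrightarrow>
       \<bar>\<Sum>x\<in>V. \<Sum>y\<in>V. u x * v y * (U {x, y} (count (edges F) e) - W {x, y} (count (edges F) e))\<bar>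
       \<le> (card V)\<^sup>2 * \<eta>"
  shows "\<bar>edge_hom V (\<lambda>_. 1 / card V) U F - edge_hom V (\<lambda>_. 1 / card V) W F\<bar> \<le>
    card (set_mset (edges F)) * (M ^ card (set_mset (edges F)) * \<eta>)"
proof -
  let ?E = "set_mset (edges F)" and ?N = "real (card V)" and ?c = "count (edges F)"
  have N: "?N > 0" using V by (simp add: card_gt_0_iff)
  define T where "T S = (\<Sum>\<phi>\<in>nodes F \<rightarrow>\<^sub>E V. \<Prod>e\<in>?E. (if e \<in> S then U else W) (\<phi> ` e) (?c e))" for S
  have step: "\<bar>T S - T {}\<bar> \<le> card S * (?N ^ card (nodes F) * (M ^ card ?E * \<eta>))"
    if "finite S" "S \<subseteq> ?E" for S
    using that
  proof (induction S rule: finite_induct)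
    case empty
    then show ?case by simp
  next
    case (insert e0 S)
    let ?R = "?E - {e0}"
    have e0: "e0 \<in># edges F" using insert by simp
    define Z where "Z e A = (if e \<in># edges F then (if e \<in> S then U else W) A (?c e) else 0)" for e A
    define Y where "Y A = U A (?c e0) - W A (?c e0)" for A
    have "T (insert e0 S) - T S = (\<Sum>\<phi>\<in>nodes F \<rightarrow>\<^sub>E V. Y (\<phi> ` e0) * (\<Prod>e\<in>?R. Z e (\<phi> ` e)))"
      unfolding T_def sum_subtractf[symmetric]
    proof (intro sum.cong refl)
      fix \<phi>
      have 1: "(\<Prod>e\<in>?R. (if e \<in> insert e0 S then U else W) (\<phi> ` e) (?c e)) = (\<Prod>e\<in>?R. Z e (\<phi> ` e))"
        by (intro prod.cong refl) (auto simp: Z_def)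
      have 2: "(\<Prod>e\<in>?R. (if e \<in> S then U else W) (\<phi> ` e) (?c e)) = (\<Prod>e\<in>?R. Z e (\<phi> ` e))"
        by (intro prod.cong refl) (auto simp: Z_def)
      show "(\<Prod>e\<in>?E. (if e \<in> insert e0 S then U else W) (\<phi> ` e) (?c e)) -
        (\<Prod>e\<in>?E. (if e \<in> S then U else W) (\<phi> ` e) (?c e)) = Y (\<phi> ` e0) * (\<Prod>e\<in>?R. Z e (\<phi> ` e))"
        unfolding prod.remove[OF finite_set_mset e0] 1 2 using insert.hyps
        by (simp add: Y_def left_diff_distrib)
    qed
    also have "\<bar>\<dots>\<bar> \<le> card V ^ card (nodes F) * (M ^ card ?R * \<eta>)"
    proof (rule replace_edge_bound[OF F V e0 M refl])
      show "\<bar>Z e A\<bar> \<le> M" for e A using U W M by (auto simp: Z_def)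
      show "\<bar>\<Sum>x\<in>V. \<Sum>y\<in>V. u x * v y * Y {x, y}\<bar> \<le> (card V)\<^sup>2 * \<eta>"
        if "\<And>x. x \<in> V \<Longrightarrow> \<bar>u x\<bar> \<le> 1" "\<And>x. x \<in> V \<Longrightarrow> \<bar>v x\<bar> \<le> 1" for u v
        unfolding Y_def by (rule UW[OF e0 that])
    qed
    also have "\<dots> \<le> ?N ^ card (nodes F) * (M ^ card ?E * \<eta>)"
    proof -
      \<comment> \<open>The hypothesis with zero test functions forces \<eta> to be
        nonnegative.\<close>
      have "0 \<le> ?N\<^sup>2 * \<eta>" using UW[OF e0, of "\<lambda>_. 0" "\<lambda>_. 0"] by simp
      then have "\<eta> \<ge> 0" using N by (simp add: zero_le_mult_iff)
      moreover have "M ^ card ?R \<le> M ^ card ?E" using M by (intro power_increasing card_mono) auto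
      ultimately show ?thesis unfolding of_nat_power by (intro mult_left_mono mult_right_mono) auto
    qed
    finally have "\<bar>T (insert e0 S) - T S\<bar> \<le> ?N ^ card (nodes F) * (M ^ card ?E * \<eta>)" .
    moreover have "\<bar>T S - T {}\<bar> \<le> card S * (?N ^ card (nodes F) * (M ^ card ?E * \<eta>))"
      using insert by simp
    moreover have "real (card (insert e0 S)) = card S + 1" using insert by simp
    ultimately show ?case by (simp add: distrib_right)
  qed
  have hmT: "edge_hom V (\<lambda>_. 1 / card V) X F = (\<Sum>\<phi>\<in>nodes F \<rightarrow>\<^sub>E V. \<Prod>e\<in>?E. X (\<phi> ` e) (?c e)) / ?N ^ card (nodes F)"
    for X by (simp add: edge_hom_def power_divide sum_divide_distrib)
  have TU: "(\<Sum>\<phi>\<in>nodes F \<rightarrow>\<^sub>E V. \<Prod>e\<in>?E. U (\<phi> ` e) (?c e)) = T ?E"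
    unfolding T_def by (intro sum.cong prod.cong refl) simp
  have TW: "(\<Sum>\<phi>\<in>nodes F \<rightarrow>\<^sub>E V. \<Prod>e\<in>?E. W (\<phi> ` e) (?c e)) = T {}"
    unfolding T_def by simp
  have "\<bar>T ?E - T {}\<bar> / ?N ^ card (nodes F) \<le> card ?E * (M ^ card ?E * \<eta>)"
    using step[of ?E] N by (simp add: field_simps)
  then show ?thesis unfolding hmT TU TW using N by (simp add: abs_divide flip: diff_divide_distrib)
qed

section \<open>Kernels with finitely many values in the limit\<close>

text \<open>Convergence in measure to the finite set \<Theta>. It is essential that \<Theta> is
  chosen before \<epsilon> and does not depend on \<open>s\<close>.\<close>

definition finitely_valued :: "(nat \<Rightarrow> 'p set) \<Rightarrow> (nat \<Rightarrow> 'p \<Rightarrow> real) \<Rightarrow> bool" where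
  "finitely_valued P h \<longleftrightarrow> (\<exists>\<Theta>. finite \<Theta> \<and> (\<forall>\<epsilon>>0.
     (\<lambda>s. card {p \<in> P s. \<forall>\<theta>\<in>\<Theta>. \<bar>h s p - \<theta>\<bar> \<ge> \<epsilon>} / card (P s)) \<longlonglongrightarrow> 0))"

lemma finitely_valued_add:
  assumes P: "\<And>s. finite (P s)" and "finitely_valued P h" "finitely_valued P k"
  shows "finitely_valued P (\<lambda>s p. h s p + k s p)"
proof -
  obtain A B where A: "finite A" "\<And>\<epsilon>. \<epsilon> > 0 \<Longrightarrow>
      (\<lambda>s. card {p \<in> P s. \<forall>\<theta>\<in>A. \<bar>h s p - \<theta>\<bar> \<ge> \<epsilon>} / card (P s)) \<longlonglongrightarrow> 0"
    and B: "finite B" "\<And>\<epsilon>. \<epsilon> > 0 \<Longrightarrow>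
      (\<lambda>s. card {p \<in> P s. \<forall>\<theta>\<in>B. \<bar>k s p - \<theta>\<bar> \<ge> \<epsilon>} / card (P s)) \<longlonglongrightarrow> 0"
    using assms(2,3) unfolding finitely_valued_def by blast
  let ?S = "(\<lambda>(a, b). a + b) ` (A \<times> B)"
  have "(\<lambda>s. card {p \<in> P s. \<forall>\<theta>\<in>?S. \<bar>h s p + k s p - \<theta>\<bar> \<ge> \<epsilon>} / card (P s)) \<longlonglongrightarrow> 0"
    if "\<epsilon> > 0" for \<epsilon>
  proof (rule tendsto_sandwich[where f = "\<lambda>_. 0"])
    let ?X = "\<lambda>s. {p \<in> P s. \<forall>\<theta>\<in>A. \<bar>h s p - \<theta>\<bar> \<ge> \<epsilon> / 2}"
    let ?Y = "\<lambda>s. {p \<in> P s. \<forall>\<theta>\<in>B. \<bar>k s p - \<theta>\<bar> \<ge> \<epsilon> / 2}"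
    let ?Z = "\<lambda>s. {p \<in> P s. \<forall>\<theta>\<in>?S. \<bar>h s p + k s p - \<theta>\<bar> \<ge> \<epsilon>}"
    show "\<forall>\<^sub>F s in sequentially. card (?Z s) / card (P s) \<le> card (?X s) / card (P s) + card (?Y s) / card (P s)"
    proof (intro always_eventually allI)
      fix s
      have "?Z s \<subseteq> ?X s \<union> ?Y s"
      proof
        fix p assume p: "p \<in> ?Z s"
        show "p \<in> ?X s \<union> ?Y s"
        proof (rule ccontr)
          assume "p \<notin> ?X s \<union> ?Y s"
          then obtain a b where ab: "a \<in> A" "b \<in> B" "\<bar>h s p - a\<bar> < \<epsilon> / 2" "\<bar>k s p - b\<bar> < \<epsilon> / 2"
            using p by force
          then have "\<bar>h s p + k s p - (a + b)\<bar> < \<epsilon>" by linarith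
          moreover have "a + b \<in> ?S" using ab by force
          ultimately show False using p by fastforce
        qed
      qed
      then have "card (?Z s) \<le> card (?X s \<union> ?Y s)" using P by (intro card_mono) auto
      also have "\<dots> \<le> card (?X s) + card (?Y s)" by (rule card_Un_le)
      finally show "card (?Z s) / card (P s) \<le> card (?X s) / card (P s) + card (?Y s) / card (P s)"
        by (simp add: divide_right_mono flip: add_divide_distrib of_nat_add)
    qed
    show "(\<lambda>s. card (?X s) / card (P s) + card (?Y s) / card (P s)) \<longlonglongrightarrow> 0"
      using tendsto_add[OF A(2)[of "\<epsilon>/2"] B(2)[of "\<epsilon>/2"]] that by simp
  qed (auto intro!: always_eventually)
  then show ?thesis using A(1) B(1) unfolding finitely_valued_def by (intro exI[of _ ?S]) auto
qed

lemma finitely_valued_mult: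
  assumes "finitely_valued P h"
  shows "finitely_valued P (\<lambda>s p. c * h s p)"
proof -
  obtain A where A: "finite A" "\<And>\<epsilon>. \<epsilon> > 0 \<Longrightarrow>
      (\<lambda>s. card {p \<in> P s. \<forall>\<theta>\<in>A. \<bar>h s p - \<theta>\<bar> \<ge> \<epsilon>} / card (P s)) \<longlonglongrightarrow> 0"
    using assms unfolding finitely_valued_def by blast
  show ?thesis
  proof (cases "c = 0")
    case True
    then show ?thesis unfolding finitely_valued_def by (intro exI[of _ "{0}"]) (simp add: not_le[symmetric])
  next
    case False
    have "(\<lambda>s. card {p \<in> P s. \<forall>\<theta>\<in>(*) c ` A. \<bar>c * h s p - \<theta>\<bar> \<ge> \<epsilon>} / card (P s)) \<longlonglongrightarrow> 0"
      if "\<epsilon> > 0" for \<epsilon>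
    proof -
      have "\<bar>c * x - c * a\<bar> \<ge> \<epsilon> \<longleftrightarrow> \<bar>x - a\<bar> \<ge> \<epsilon> / \<bar>c\<bar>" for x a
      proof -
        have "\<bar>c * x - c * a\<bar> = \<bar>c\<bar> * \<bar>x - a\<bar>" by (simp only: abs_mult right_diff_distrib[symmetric])
        then show ?thesis using False by (simp add: field_simps)
      qed
      then show ?thesis using A(2)[of "\<epsilon> / \<bar>c\<bar>"] False that by simp
    qed
    then show ?thesis using A(1) unfolding finitely_valued_def by (intro exI[of _ "(*) c ` A"]) auto
  qed
qed

lemma finitely_valued_0: "finitely_valued P (\<lambda>s p. 0)"
  unfolding finitely_valued_def by (intro exI[of _ "{0}"]) (simp add: not_le[symmetric])

lemma finitely_valued_sum:
  assumes P: "\<And>s. finite (P s)" and "\<And>j. j \<in> J \<Longrightarrow> finitely_valued P (h j)"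
  shows "finitely_valued P (\<lambda>s p. \<Sum>j\<in>J. h j s p)"
  using assms(2)
  by (induction J rule: infinite_finite_induct) (auto intro: finitely_valued_0 finitely_valued_add[OF P])

text \<open>The limit values are the roots of \<open>q\<close>. Off a neighbourhood of the roots, a
  compact set since \<open>h\<close> is bounded, the square of \<open>q\<close> has a positive
  minimum, and Markov's inequality applies.\<close>

lemma finitely_valued_of_polynomial:
  fixes q :: "real poly"
  assumes q: "q \<noteq> 0" and bnd: "\<And>s p. p \<in> P s \<Longrightarrow> \<bar>h s p\<bar> \<le> C" and P: "\<And>s. finite (P s)"
    and lim: "(\<lambda>s. (\<Sum>p\<in>P s. (poly q (h s p))\<^sup>2) / card (P s)) \<longlonglongrightarrow> 0"
  shows "finitely_valued P h"
  unfolding finitely_valued_def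
proof (intro exI[of _ "{x. poly q x = 0}"] conjI allI impI)
  show "finite {x. poly q x = 0}" using q by (rule poly_roots_finite)
  fix \<epsilon> :: real assume \<epsilon>: "\<epsilon> > 0"
  let ?K = "{t \<in> {-C..C}. \<forall>\<theta>\<in>{x. poly q x = 0}. \<bar>t - \<theta>\<bar> \<ge> \<epsilon>}"
  have "\<exists>\<delta>>0. \<forall>t\<in>?K. (poly q t)\<^sup>2 \<ge> \<delta>"
  proof (cases "?K = {}")
    case True
    then show ?thesis by (intro exI[of _ 1]) auto
  next
    case False
    have "?K = {-C..C} \<inter> (\<Inter>\<theta>\<in>{x. poly q x = 0}. {t. \<bar>t - \<theta>\<bar> \<ge> \<epsilon>})" by auto
    moreover have "closed (\<Inter>\<theta>\<in>{x. poly q x = 0}. {t. \<bar>t - \<theta>\<bar> \<ge> \<epsilon>})"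
      by (intro closed_INT ballI closed_Collect_le continuous_intros)
    ultimately have "compact ?K" by (simp add: compact_Int_closed)
    moreover have "continuous_on ?K (\<lambda>t. (poly q t)\<^sup>2)" by (intro continuous_intros)
    ultimately obtain t0 where t0: "t0 \<in> ?K" "\<And>t. t \<in> ?K \<Longrightarrow> (poly q t0)\<^sup>2 \<le> (poly q t)\<^sup>2"
      using continuous_attains_inf[of ?K "\<lambda>t. (poly q t)\<^sup>2"] False by blast
    have "poly q t0 \<noteq> 0" using t0(1) \<epsilon> by force
    then show ?thesis using t0(2) by (intro exI[of _ "(poly q t0)\<^sup>2"]) auto
  qed
  then obtain \<delta> where \<delta>: "\<delta> > 0" "\<And>t. t \<in> ?K \<Longrightarrow> (poly q t)\<^sup>2 \<ge> \<delta>" by blast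
  let ?X = "\<lambda>s. {p \<in> P s. \<forall>\<theta>\<in>{x. poly q x = 0}. \<epsilon> \<le> \<bar>h s p - \<theta>\<bar>}"
  show "(\<lambda>s. card (?X s) / card (P s)) \<longlonglongrightarrow> 0"
  proof (rule tendsto_sandwich[where f = "\<lambda>_. 0"])
    show "\<forall>\<^sub>F s in sequentially. card (?X s) / card (P s) \<le> (\<Sum>p\<in>P s. (poly q (h s p))\<^sup>2) / card (P s) / \<delta>"
    proof (intro always_eventually allI)
      fix s
      have "card (?X s) * \<delta> = (\<Sum>p\<in>?X s. \<delta>)" by simp
      also have "\<dots> \<le> (\<Sum>p\<in>?X s. (poly q (h s p))\<^sup>2)"
        using bnd by (intro sum_mono \<delta>(2)) (auto simp: abs_le_iff minus_le_iff)
      also have "\<dots> \<le> (\<Sum>p\<in>P s. (poly q (h s p))\<^sup>2)" using P by (intro sum_mono2) auto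
      finally have "card (?X s) \<le> (\<Sum>p\<in>P s. (poly q (h s p))\<^sup>2) / \<delta>" using \<delta>(1) by (simp add: field_simps)
      then have "card (?X s) / card (P s) \<le> (\<Sum>p\<in>P s. (poly q (h s p))\<^sup>2) / \<delta> / card (P s)"
        by (intro divide_right_mono) auto
      then show "card (?X s) / card (P s) \<le> (\<Sum>p\<in>P s. (poly q (h s p))\<^sup>2) / card (P s) / \<delta>"
        by (simp add: mult.commute)
    qed
    show "(\<lambda>s. (\<Sum>p\<in>P s. (poly q (h s p))\<^sup>2) / card (P s) / \<delta>) \<longlonglongrightarrow> 0"
      using tendsto_divide[OF lim tendsto_const, of \<delta>] \<delta> by simp
  qed (auto intro!: always_eventually)
qed

text \<open>A value of \<open>D\<close> below half the least positive limit value can be close only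
  to a limit value that is at most 0, hence it is itself nearly 0; the exceptional points have
  vanishing proportion and bounded \<open>D\<close>. The threshold is fixed before \<open>Q\<close>,
  so that \<open>Q\<close> can be a partition built at this very scale.\<close>

lemma finitely_valued_gap:
  assumes P: "\<And>s. finite (P s)" and D: "finitely_valued P D"
  shows "\<exists>\<theta>>0. \<forall>C Q. (\<forall>s. \<forall>p\<in>P s. 0 \<le> D s p \<and> D s p \<le> C) \<longrightarrow> (\<forall>s. \<forall>p\<in>P s. Q s p \<longrightarrow> D s p \<le> \<theta>) \<longrightarrow>
    (\<lambda>s. (\<Sum>p\<in>{p \<in> P s. Q s p}. D s p) / card (P s)) \<longlonglongrightarrow> 0"
proof -
  obtain \<Theta> where \<Theta>: "finite \<Theta>" "\<And>\<epsilon>. \<epsilon> > 0 \<Longrightarrow>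
      (\<lambda>s. card {p \<in> P s. \<forall>\<theta>\<in>\<Theta>. \<bar>D s p - \<theta>\<bar> \<ge> \<epsilon>} / card (P s)) \<longlonglongrightarrow> 0"
    using D unfolding finitely_valued_def by blast
  \<comment> \<open>The element 1 covers the case of no positive limit value.\<close>
  define t where "t = Min (insert 1 {x \<in> \<Theta>. x > 0})"
  have t0: "t > 0" using \<Theta> by (auto simp: t_def)
  have tmin: "x \<ge> t" if "x \<in> \<Theta>" "x > 0" for x using that \<Theta> by (auto simp: t_def)
  show ?thesis
  proof (intro exI[of _ "t / 2"] conjI allI impI)
    show "t / 2 > 0" using t0 by simp
    fix C Q
    assume C: "\<forall>s. \<forall>p\<in>P s. 0 \<le> D s p \<and> D s p \<le> C" and Q: "\<forall>s. \<forall>p\<in>P s. Q s p \<longrightarrow> D s p \<le> t / 2"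
    show "(\<lambda>s. (\<Sum>p\<in>{p \<in> P s. Q s p}. D s p) / card (P s)) \<longlonglongrightarrow> 0"
    proof (rule LIMSEQ_I)
      fix \<epsilon>' :: real assume \<epsilon>': "\<epsilon>' > 0"
      define \<epsilon> where "\<epsilon> = min (\<epsilon>' / 2) (t / 2)"
      have \<epsilon>: "\<epsilon> > 0" "\<epsilon> \<le> \<epsilon>' / 2" "\<epsilon> \<le> t / 2" using \<epsilon>' t0 by (auto simp: \<epsilon>_def)
      let ?X = "\<lambda>s. {p \<in> P s. \<forall>\<theta>\<in>\<Theta>. \<bar>D s p - \<theta>\<bar> \<ge> \<epsilon>}"
      have "(\<lambda>s. \<bar>C\<bar> * (card (?X s) / card (P s))) \<longlonglongrightarrow> \<bar>C\<bar> * 0"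
        by (intro tendsto_mult tendsto_const \<Theta>(2) \<epsilon>)
      from LIMSEQ_D[OF this, of "\<epsilon>' / 2"] \<epsilon>' obtain s0 where
        s0: "\<And>s. s \<ge> s0 \<Longrightarrow> \<bar>C\<bar> * (card (?X s) / card (P s)) < \<epsilon>' / 2" by auto
      have "norm ((\<Sum>p\<in>{p \<in> P s. Q s p}. D s p) / card (P s) - 0) < \<epsilon>'" if "s \<ge> s0" for s
      proof -
        have pt: "D s p \<le> \<epsilon> + (if p \<in> ?X s then \<bar>C\<bar> else 0)" if p: "p \<in> P s" "Q s p" for p
        proof (cases "p \<in> ?X s")
          case True
          then show ?thesis using C \<epsilon>(1) p by force
        next
          case False
          then obtain \<theta> where \<theta>: "\<theta> \<in> \<Theta>" "\<bar>D s p - \<theta>\<bar> < \<epsilon>" using p by force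
          have "D s p \<le> t / 2" using Q p by blast
          then have "\<theta> < t" using \<theta>(2) \<epsilon>(3) by linarith
          then have "\<theta> \<le> 0" using tmin[OF \<theta>(1)] by force
          then show ?thesis using False \<theta>(2) by auto
        qed
        have "(\<Sum>p\<in>{p \<in> P s. Q s p}. D s p) \<le> (\<Sum>p\<in>{p \<in> P s. Q s p}. \<epsilon> + (if p \<in> ?X s then \<bar>C\<bar> else 0))"
          using pt by (intro sum_mono) auto
        also have "\<dots> \<le> (\<Sum>p\<in>P s. \<epsilon> + (if p \<in> ?X s then \<bar>C\<bar> else 0))"
          using P \<epsilon>(1) by (intro sum_mono2) auto
        also have "\<dots> = card (P s) * \<epsilon> + \<bar>C\<bar> * card (?X s)"
        proof -
          have "(\<Sum>p\<in>P s. if p \<in> ?X s then \<bar>C\<bar> else 0) = (\<Sum>p\<in>?X s. \<bar>C\<bar>)"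
            using P by (intro sum.mono_neutral_cong_right) auto
          then show ?thesis by (simp add: sum.distrib)
        qed
        finally have le: "(\<Sum>p\<in>{p \<in> P s. Q s p}. D s p) \<le> card (P s) * \<epsilon> + \<bar>C\<bar> * card (?X s)" .
        have "0 \<le> (\<Sum>p\<in>{p \<in> P s. Q s p}. D s p)" using C by (intro sum_nonneg) auto
        show ?thesis
        proof (cases "card (P s) = 0")
          case True
          then show ?thesis using \<epsilon>' by simp
        next
          case False
          have "(\<Sum>p\<in>{p \<in> P s. Q s p}. D s p) / card (P s) \<le> \<epsilon> + \<bar>C\<bar> * (card (?X s) / card (P s))"
            using le False by (simp add: field_simps)
          also have "\<dots> < \<epsilon>'" using s0[OF that] \<epsilon>(2) by linarith
          finally show ?thesis using \<open>0 \<le> (\<Sum>p\<in>{p \<in> P s. Q s p}. D s p)\<close> by simp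
        qed
      qed
      then show "\<exists>s0. \<forall>s\<ge>s0. norm ((\<Sum>p\<in>{p \<in> P s. Q s p}. D s p) / card (P s) - 0) < \<epsilon>'" by blast
    qed
  qed
qed

section \<open>The codegree distance as a combination of rooted densities\<close>

definition cyc4 :: "nat set \<Rightarrow> (nat \<Rightarrow> nat \<Rightarrow> real) \<Rightarrow> nat \<Rightarrow> nat \<Rightarrow> real" where
  "cyc4 V G x y = (\<Sum>z\<in>V. codeg V G x z * codeg V G z y) / card V"

lemma codeg_sym: "(\<And>x y. G x y = G y x) \<Longrightarrow> codeg V G x y = codeg V G y x"
  unfolding codeg_def by (intro arg_cong2[where f = "(/)"] sum.cong refl) (simp add: mult.commute)

text \<open>Polarization: the inner product of two rows of the codegree kernel is its composition
  with itself, which counts paths with four edges between the two roots.\<close>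

lemma cdist_eq_cyc4:
  assumes "\<And>x y. G x y = G y x"
  shows "cdist V G x y = cyc4 V G x x + cyc4 V G y y + (-2) * cyc4 V G x y"
proof -
  let ?K = "codeg V G"
  have "(\<Sum>z\<in>V. (?K x z - ?K y z)\<^sup>2) =
      (\<Sum>z\<in>V. ?K x z * ?K z x) + (\<Sum>z\<in>V. ?K y z * ?K z y) - 2 * (\<Sum>z\<in>V. ?K x z * ?K z y)"
    unfolding sum_distrib_left sum.distrib[symmetric] sum_subtractf[symmetric]
  proof (intro sum.cong refl)
    fix z
    have "?K z x = ?K x z" "?K z y = ?K y z" using codeg_sym[of G V] assms by blast+
    then show "(?K x z - ?K y z)\<^sup>2 = ?K x z * ?K z x + ?K y z * ?K z y - 2 * (?K x z * ?K z y)"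
      by (simp add: power2_eq_square algebra_simps)
  qed
  then show ?thesis unfolding cdist_def cyc4_def by (simp add: add_divide_distrib diff_divide_distrib)
qed

lemma cyc4_expand:
  "cyc4 V G x y = (\<Sum>u\<in>V. \<Sum>z\<in>V. \<Sum>v\<in>V. G x u * G u z * G z v * G v y) / real (card V) ^ 3"
proof -
  have "cyc4 V G x y = (\<Sum>z\<in>V. \<Sum>u\<in>V. \<Sum>v\<in>V. G x u * G u z * G z v * G v y) / real (card V) ^ 3"
    unfolding cyc4_def codeg_def
    by (simp add: sum_product sum_divide_distrib power3_eq_cube mult.assoc)
  then show ?thesis by (subst sum.swap)
qed

text \<open>A four-cycle if \<open>a = b\<close>, so that the diagonal of \<open>cyc4\<close> is a rooted density as well.\<close>

definition path4 :: "nat \<Rightarrow> nat \<Rightarrow> nat \<Rightarrow> nat \<Rightarrow> mgraph" where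
  "path4 n j a b = \<lparr>nodes = {1..n + 3}, edges = replicate_mset j {a, n + 1} +
     replicate_mset j {n + 1, n + 2} + replicate_mset j {n + 2, n + 3} + replicate_mset j {n + 3, b}\<rparr>"

lemma path4_in_labeled_graphs:
  assumes "a \<in> {1..n}" "b \<in> {1..n}"
  shows "path4 n j a b \<in> labeled_graphs n"
proof -
  have "card {a, n + 1} = 2" "card {n + 1, n + 2} = 2" "card {n + 2, n + 3} = 2" "card {n + 3, b} = 2"
    using assms by auto
  then show ?thesis using assms
    by (auto simp: labeled_graphs_def multigraph_def path4_def split: if_splits)
qed

lemma sum_PiE_three:
  assumes "distinct [a, b, c]"
  shows "(\<Sum>\<xi>\<in>{a, b, c} \<rightarrow>\<^sub>E V. h (\<xi> a) (\<xi> b) (\<xi> c)) = (\<Sum>x\<in>V. \<Sum>y\<in>V. \<Sum>z\<in>V. h x y z)"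
  unfolding sum.cartesian_product
  by (rule sum.reindex_bij_witness[where j = "\<lambda>\<xi>. (\<xi> a, \<xi> b, \<xi> c)"
        and i = "\<lambda>(x, y, z) i. if i = a then x else if i = b then y else if i = c then z else undefined"])
     (use assms in \<open>auto simp: PiE_iff extensional_def fun_eq_iff\<close>)

lemma count_replicate_four:
  assumes "distinct [w, x, y, z]" "e \<in> {w, x, y, z}"
  shows "count (replicate_mset j w + replicate_mset j x + replicate_mset j y + replicate_mset j z) e = j"
  using assms by auto

lemma prod_four:
  fixes h :: "'a \<Rightarrow> real"
  assumes "distinct [w, x, y, z]"
  shows "(\<Prod>e\<in>{w, x, y, z}. h e) = h w * (h x * (h y * h z))"
  using assms by simp

lemma rooted_hom_path4:
  assumes ab: "a \<in> {1..n}" "b \<in> {1..n}" and V: "card V > 0"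
  shows "rooted_hom {1..n} V (\<lambda>_. c / card V) (\<lambda>A k. g A ^ k) \<psi> \<rho> (path4 n j a b) =
    c ^ 3 * cyc4 V (\<lambda>x y. g {x, y} ^ j) (\<psi> a) (\<psi> b)"
proof -
  let ?L = "{1..n}"
  let ?R = "{n + 1, n + 2, n + 3}"
  let ?E = "{{a, n + 1}, {n + 1, n + 2}, {n + 2, n + 3}, {n + 3, b}}"
  let ?X = "edges (path4 n j a b)"
  have N: "nodes (path4 n j a b) - ?L = ?R" by (auto simp: path4_def)
  \<comment> \<open>The four edges differ even if \<open>a = b\<close>, because the inner nodes
    differ.\<close>
  have dist: "distinct [{a, n + 1}, {n + 1, n + 2}, {n + 2, n + 3}, {n + 3, b}]"
    using ab by (auto simp: doubleton_eq_iff)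
  have cnt: "count ?X e = j" if "e \<in> ?E" for e
    using count_replicate_four[OF dist that, of j] by (simp only: path4_def mgraph.simps)
  have sub: "set_mset ?X \<subseteq> ?E" by (auto simp: path4_def split: if_splits)
  have out: "\<not> e \<subseteq> ?L" if "e \<in> ?E" for e using that by auto
  have "rooted_hom ?L V (\<lambda>_. c / card V) (\<lambda>A k. g A ^ k) \<psi> \<rho> (path4 n j a b) =
     (\<Sum>\<phi>\<in>?R \<rightarrow>\<^sub>E V. (c / card V) ^ 3 * (\<Prod>e\<in>?E. g ((\<lambda>i. if i \<in> ?L then \<psi> i else \<phi> i) ` e) ^ j))"
    unfolding rooted_hom_def N
  proof (intro sum.cong refl arg_cong2[where f = "(*)"])
    fix \<phi> :: "nat \<Rightarrow> nat"
    let ?m = "\<lambda>i. if i \<in> ?L then \<psi> i else \<phi> i"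
    have "card ?R = 3" by simp
    then show "(\<Prod>i\<in>?R. c / card V) = (c / card V) ^ 3" by (simp only: prod_constant)
    have "(\<Prod>e\<in>set_mset ?X. if e \<subseteq> ?L then \<rho> e (count ?X e) else g (?m ` e) ^ count ?X e) =
      (\<Prod>e\<in>?E. g (?m ` e) ^ count ?X e)"
      using sub out by (intro prod.mono_neutral_cong_left) (auto simp: not_in_iff)
    also have "\<dots> = (\<Prod>e\<in>?E. g (?m ` e) ^ j)" by (intro prod.cong refl) (simp only: cnt)
    finally show "(\<Prod>e\<in>set_mset ?X. if e \<subseteq> ?L then \<rho> e (count ?X e) else g (?m ` e) ^ count ?X e) =
      (\<Prod>e\<in>?E. g (?m ` e) ^ j)" .
  qed
  also have "\<dots> = (\<Sum>\<phi>\<in>?R \<rightarrow>\<^sub>E V. (c / card V) ^ 3 * (g {\<psi> a, \<phi> (n + 1)} ^ j *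
     g {\<phi> (n + 1), \<phi> (n + 2)} ^ j * g {\<phi> (n + 2), \<phi> (n + 3)} ^ j * g {\<phi> (n + 3), \<psi> b} ^ j))"
  proof (intro sum.cong refl arg_cong2[where f = "(*)"])
    fix \<phi> :: "nat \<Rightarrow> nat"
    let ?m = "\<lambda>i. if i \<in> ?L then \<psi> i else \<phi> i"
    have "(\<Prod>e\<in>?E. g (?m ` e) ^ j) =
      g (?m ` {a, n + 1}) ^ j * (g (?m ` {n + 1, n + 2}) ^ j * (g (?m ` {n + 2, n + 3}) ^ j * g (?m ` {n + 3, b}) ^ j))"
      by (rule prod_four[OF dist])
    moreover have "?m ` {a, n + 1} = {\<psi> a, \<phi> (n + 1)}" "?m ` {n + 1, n + 2} = {\<phi> (n + 1), \<phi> (n + 2)}"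
      "?m ` {n + 2, n + 3} = {\<phi> (n + 2), \<phi> (n + 3)}" "?m ` {n + 3, b} = {\<phi> (n + 3), \<psi> b}"
      using ab by (simp_all del: if_image_distrib)
    ultimately show "(\<Prod>e\<in>?E. g (?m ` e) ^ j) = g {\<psi> a, \<phi> (n + 1)} ^ j *
     g {\<phi> (n + 1), \<phi> (n + 2)} ^ j * g {\<phi> (n + 2), \<phi> (n + 3)} ^ j * g {\<phi> (n + 3), \<psi> b} ^ j"
      by (simp only: mult.assoc)
  qed
  also have "\<dots> = (c / card V) ^ 3 * (\<Sum>x\<in>V. \<Sum>y\<in>V. \<Sum>z\<in>V. g {\<psi> a, x} ^ j * g {x, y} ^ j * g {y, z} ^ j * g {z, \<psi> b} ^ j)"
    unfolding sum_distrib_left[symmetric]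
    by (subst sum_PiE_three[where h = "\<lambda>x y z. g {\<psi> a, x} ^ j * g {x, y} ^ j * g {y, z} ^ j * g {z, \<psi> b} ^ j"]) auto
  also have "\<dots> = c ^ 3 * cyc4 V (\<lambda>x y. g {x, y} ^ j) (\<psi> a) (\<psi> b)"
    unfolding cyc4_expand by (simp add: power_divide)
  finally show ?thesis .
qed

lemma sum_PiE_first_two:
  assumes "n \<ge> 2" "finite V"
  shows "(\<Sum>\<psi>\<in>{1..n} \<rightarrow>\<^sub>E V. h (\<psi> 1) (\<psi> 2)) = real (card V) ^ (n - 2) * (\<Sum>x\<in>V. \<Sum>y\<in>V. h x y)"
proof -
  have U: "{3..n} \<union> {1, 2} = {1..n}" using assms by auto
  have d: "{3..n} \<inter> {1, 2} = {}" by auto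
  have "(\<Sum>\<psi>\<in>({3..n} \<union> {1, 2}) \<rightarrow>\<^sub>E V. h (\<psi> 1) (\<psi> 2)) =
    (\<Sum>\<phi>\<in>{3..n} \<rightarrow>\<^sub>E V. \<Sum>\<xi>\<in>{1, 2::nat} \<rightarrow>\<^sub>E V. h (\<xi> 1) (\<xi> 2))"
    by (subst sum_PiE_Un[OF d]) simp
  also have "\<dots> = real (card V) ^ (n - 2) * (\<Sum>x\<in>V. \<Sum>y\<in>V. h x y)"
    using sum_PiE_two[of "1::nat" 2 h V] by (simp add: card_PiE)
  finally show ?thesis unfolding U .
qed

section \<open>Step-function models\<close>

lemma abs_rooted_hom_le:
  assumes F: "multigraph F" and V: "finite V" "card V > 0" and c: "c \<ge> 0" and g: "\<And>A. \<bar>g A\<bar> \<le> M"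
  shows "\<bar>rooted_hom L V (\<lambda>_. c / card V) (\<lambda>A k. g A ^ k) \<psi> (\<lambda>e k. g (\<psi> ` e) ^ k) F\<bar> \<le>
    c ^ card (nodes F - L) * M ^ size (edges F)"
proof -
  let ?R = "nodes F - L"
  have fin: "finite ?R" using F by (simp add: multigraph_def)
  define w where "w \<phi> e = (if e \<subseteq> L then g (\<psi> ` e) else g ((\<lambda>i. if i \<in> L then \<psi> i else \<phi> i) ` e))" for \<phi> e
  have rooted_hom: "rooted_hom L V (\<lambda>_. c / card V) (\<lambda>A k. g A ^ k) \<psi> (\<lambda>e k. g (\<psi> ` e) ^ k) F =
    (\<Sum>\<phi>\<in>?R \<rightarrow>\<^sub>E V. (c / card V) ^ card ?R * (\<Prod>e\<in>set_mset (edges F). w \<phi> e ^ count (edges F) e))"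
    unfolding rooted_hom_def
    by (intro sum.cong refl arg_cong2[where f = "(*)"] prod.cong) (auto simp: w_def)
  have "\<bar>\<dots>\<bar> \<le> (\<Sum>\<phi>\<in>?R \<rightarrow>\<^sub>E V. (c / card V) ^ card ?R * M ^ size (edges F))"
  proof (intro order_trans[OF sum_abs] sum_mono)
    fix \<phi>
    have "\<bar>\<Prod>e\<in>set_mset (edges F). w \<phi> e ^ count (edges F) e\<bar> \<le> M ^ size (edges F)"
      by (rule abs_prod_edges_le) (simp add: w_def g)
    then show "\<bar>(c / card V) ^ card ?R * (\<Prod>e\<in>set_mset (edges F). w \<phi> e ^ count (edges F) e)\<bar> \<le>
      (c / card V) ^ card ?R * M ^ size (edges F)"
      using c by (simp add: abs_mult mult_left_mono del: times_divide_eq_left)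
  qed
  also have "\<dots> = c ^ card ?R * M ^ size (edges F)"
    using fin V by (auto simp: card_PiE power_divide)
  finally show ?thesis unfolding rooted_hom .
qed

lemma rooted_hom_edgeless: "rooted_hom {1..n} V \<alpha> \<mu> \<psi> \<rho> (lgraph n {#}) = 1"
  by (simp add: rooted_hom_def lgraph_def)

text \<open>The distribution of the edges between classes \<open>i\<close> and \<open>j\<close> is indexed by the set \<open>{i, j}\<close>, so that
  it is symmetric.\<close>

definition fibre :: "nat set \<Rightarrow> (nat \<Rightarrow> nat) \<Rightarrow> nat \<Rightarrow> nat set" where
  "fibre V \<tau> i = {x \<in> V. \<tau> x = i}"

definition edge_freq :: "nat set \<Rightarrow> (nat \<Rightarrow> nat) \<Rightarrow> (nat set \<Rightarrow> real) \<Rightarrow> nat set \<Rightarrow> real \<Rightarrow> real" where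
  "edge_freq V \<tau> g A b = card {(x, y) \<in> fibre V \<tau> (Min A) \<times> fibre V \<tau> (Max A). g {x, y} = b} /
     (card (fibre V \<tau> (Min A)) * card (fibre V \<tau> (Max A)))"

lemma finite_fibre: "finite V \<Longrightarrow> finite (fibre V \<tau> i)"
  by (simp add: fibre_def)

lemma edge_freq_nonneg: "edge_freq V \<tau> g A b \<ge> 0"
  by (simp add: edge_freq_def)

lemma sum_edge_freq:
  assumes V: "finite V" and B: "finite B" "\<And>A. g A \<in> B"
  shows "(\<Sum>b\<in>B. edge_freq V \<tau> g A b * h b) =
    (\<Sum>x\<in>fibre V \<tau> (Min A). \<Sum>y\<in>fibre V \<tau> (Max A). h (g {x, y})) /
      (card (fibre V \<tau> (Min A)) * card (fibre V \<tau> (Max A)))"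
proof -
  let ?P = "fibre V \<tau> (Min A) \<times> fibre V \<tau> (Max A)"
  have fin: "finite ?P" using V by (simp add: finite_fibre)
  have "(\<Sum>x\<in>fibre V \<tau> (Min A). \<Sum>y\<in>fibre V \<tau> (Max A). h (g {x, y})) = (\<Sum>p\<in>?P. h (g {fst p, snd p}))"
    by (simp add: sum.cartesian_product split_def)
  also have "\<dots> = (\<Sum>b\<in>B. \<Sum>p\<in>{p \<in> ?P. g {fst p, snd p} = b}. h (g {fst p, snd p}))"
    using fin B by (subst sum.group) auto
  also have "\<dots> = (\<Sum>b\<in>B. card {(x, y) \<in> ?P. g {x, y} = b} * h b)"
  proof (intro sum.cong refl)
    fix b
    have "{(x, y) \<in> ?P. g {x, y} = b} = {p \<in> ?P. g {fst p, snd p} = b}" by auto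
    then show "(\<Sum>p\<in>{p \<in> ?P. g {fst p, snd p} = b}. h (g {fst p, snd p})) =
      card {(x, y) \<in> ?P. g {x, y} = b} * h b" by simp
  qed
  finally show ?thesis by (simp add: edge_freq_def sum_divide_distrib)
qed

lemma edge_freq_le_1:
  assumes V: "finite V"
  shows "edge_freq V \<tau> g A b \<le> 1"
proof -
  let ?P = "fibre V \<tau> (Min A) \<times> fibre V \<tau> (Max A)"
  have fin: "finite ?P" using V by (simp add: finite_fibre)
  have "card {(x, y) \<in> ?P. g {x, y} = b} \<le> card ?P" using fin by (intro card_mono) auto
  then have "real (card {(x, y) \<in> ?P. g {x, y} = b}) \<le> card (fibre V \<tau> (Min A)) * card (fibre V \<tau> (Max A))"
    unfolding card_cartesian_product of_nat_mult[symmetric] of_nat_le_iff .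
  moreover have "r / t \<le> 1" if "r \<le> t" "t \<ge> 0" for r t :: real
    using that by (cases "t = 0") auto
  ultimately show ?thesis unfolding edge_freq_def by simp
qed

lemma sum_edge_freq_eq_1:
  assumes V: "finite V" and B: "finite B" "\<And>A. g A \<in> B"
    and "fibre V \<tau> (Min A) \<noteq> {}" "fibre V \<tau> (Max A) \<noteq> {}"
  shows "(\<Sum>b\<in>B. edge_freq V \<tau> g A b) = 1"
  using sum_edge_freq[OF V B, where \<tau> = \<tau> and A = A and h = "\<lambda>_. 1"] assms(4,5) V
  by (simp add: finite_fibre)

lemma abs_sum_edge_freq_le:
  assumes V: "finite V" and B: "finite B" "\<And>A. g A \<in> B" and h: "\<And>b. b \<in> B \<Longrightarrow> \<bar>h b\<bar> \<le> M" and M: "M \<ge> 0"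
  shows "\<bar>\<Sum>b\<in>B. edge_freq V \<tau> g A b * h b\<bar> \<le> M"
proof -
  let ?X = "fibre V \<tau> (Min A)" and ?Y = "fibre V \<tau> (Max A)"
  have "\<bar>\<Sum>x\<in>?X. \<Sum>y\<in>?Y. h (g {x, y})\<bar> \<le> (\<Sum>x\<in>?X. \<Sum>y\<in>?Y. M)"
    by (intro order_trans[OF sum_abs] sum_mono h B(2))
  also have "\<dots> = card ?X * card ?Y * M" by simp
  finally show ?thesis
    unfolding sum_edge_freq[OF V B] using M
    by (cases "card ?X = 0 \<or> card ?Y = 0") (auto simp: abs_divide field_simps)
qed

text \<open>This is the origin of the random edge weights: averaging the \<open>k\<close>-th power
  of the colour over two classes gives the \<open>k\<close>-th moment of one distribution, the same
  for all \<open>k\<close>.\<close>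

lemma double_part_avg_eq_edge_freq:
  assumes V: "finite V" and B: "finite B" "\<And>A. g A \<in> B" and xy: "x \<in> V" "y \<in> V"
  shows "part_avg V \<tau> (\<lambda>x'. part_avg V \<tau> (\<lambda>y'. g {x', y'} ^ k) y) x =
    (\<Sum>b\<in>B. edge_freq V \<tau> g (\<tau> ` {x, y}) b * b ^ k)"
proof -
  let ?X = "fibre V \<tau> (\<tau> x)" and ?Y = "fibre V \<tau> (\<tau> y)"
  have part: "part V \<tau> z = fibre V \<tau> (\<tau> z)" for z by (simp add: part_def fibre_def)
  have L: "part_avg V \<tau> (\<lambda>x'. part_avg V \<tau> (\<lambda>y'. g {x', y'} ^ k) y) x =
     (\<Sum>x'\<in>?X. \<Sum>y'\<in>?Y. g {x', y'} ^ k) / (card ?X * card ?Y)"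
    unfolding part_avg_def part by (simp add: sum_divide_distrib mult.commute)
  have "(\<Sum>x'\<in>?X. \<Sum>y'\<in>?Y. g {x', y'} ^ k) = (\<Sum>x'\<in>?Y. \<Sum>y'\<in>?X. g {x', y'} ^ k)"
    by (subst sum.swap) (simp add: insert_commute)
  then show ?thesis unfolding L sum_edge_freq[OF V B]
    by (cases "\<tau> x \<le> \<tau> y") (auto simp: min_def max_def mult.commute)
qed

text \<open>Maps into \<open>V\<close> are grouped by the classes of their values; each class
  becomes one node that carries the total weight of its members.\<close>

lemma edge_hom_quotient:
  assumes V: "finite V" and \<tau>: "\<And>x. x \<in> V \<Longrightarrow> \<tau> x < (q::nat)" and F: "multigraph F"
  shows "edge_hom V (\<lambda>_. c) (\<lambda>A k. \<mu> (\<tau> ` A) k) F = edge_hom {..<q} (\<lambda>i. c * card (fibre V \<tau> i)) \<mu> F"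
proof -
  let ?A = "nodes F"
  have finA: "finite ?A" using F by (simp add: multigraph_def)
  let ?r = "\<lambda>\<phi>. restrict (\<tau> \<circ> \<phi>) ?A"
  let ?t = "\<lambda>\<phi>. c ^ card ?A * (\<Prod>e\<in>set_mset (edges F). \<mu> (\<tau> ` \<phi> ` e) (count (edges F) e))"
  have "edge_hom V (\<lambda>_. c) (\<lambda>A k. \<mu> (\<tau> ` A) k) F = (\<Sum>\<phi>\<in>?A \<rightarrow>\<^sub>E V. ?t \<phi>)"
    by (simp add: edge_hom_def)
  also have "\<dots> = (\<Sum>\<psi>\<in>?A \<rightarrow>\<^sub>E {..<q}. \<Sum>\<phi>\<in>{\<phi> \<in> ?A \<rightarrow>\<^sub>E V. ?r \<phi> = \<psi>}. ?t \<phi>)"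
  proof (rule sum.group[symmetric])
    show "?r ` (?A \<rightarrow>\<^sub>E V) \<subseteq> ?A \<rightarrow>\<^sub>E {..<q}"
      by (intro image_subsetI) (simp add: restrict_PiE_iff PiE_iff \<tau>)
  qed (use V finA in \<open>auto intro: finite_PiE\<close>)
  also have "\<dots> = (\<Sum>\<psi>\<in>?A \<rightarrow>\<^sub>E {..<q}. (\<Prod>i\<in>?A. c * card (fibre V \<tau> (\<psi> i))) *
     (\<Prod>e\<in>set_mset (edges F). \<mu> (\<psi> ` e) (count (edges F) e)))"
  proof (intro sum.cong refl)
    fix \<psi> assume \<psi>: "\<psi> \<in> ?A \<rightarrow>\<^sub>E {..<q}"
    have S: "{\<phi> \<in> ?A \<rightarrow>\<^sub>E V. ?r \<phi> = \<psi>} = (\<Pi>\<^sub>E i\<in>?A. fibre V \<tau> (\<psi> i))" (is "?S = ?T")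
    proof (intro set_eqI iffI)
      fix \<phi> assume "\<phi> \<in> ?S"
      then show "\<phi> \<in> ?T" by (auto simp: fibre_def PiE_iff)
    next
      fix \<phi> assume p: "\<phi> \<in> ?T"
      then have "?r \<phi> = \<psi>"
        using \<psi> by (intro extensionalityI[of _ ?A]) (auto simp: fibre_def PiE_iff)
      then show "\<phi> \<in> ?S" using p by (auto simp: fibre_def PiE_iff)
    qed
    have "?t \<phi> = c ^ card ?A * (\<Prod>e\<in>set_mset (edges F). \<mu> (\<psi> ` e) (count (edges F) e))"
      if "\<phi> \<in> ?S" for \<phi>
    proof -
      have "\<tau> ` \<phi> ` e = \<psi> ` e" if "e \<in># edges F" for e
        unfolding image_image
      proof (intro image_cong refl)
        fix i assume "i \<in> e"
        then have "i \<in> ?A" using that F by (auto simp: multigraph_def)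
        moreover have "\<psi> = ?r \<phi>" using \<open>\<phi> \<in> ?S\<close> by simp
        ultimately show "\<tau> (\<phi> i) = \<psi> i" by simp
      qed
      then show ?thesis by simp
    qed
    then have "(\<Sum>\<phi>\<in>?S. ?t \<phi>) =
       (\<Sum>\<phi>\<in>?T. c ^ card ?A * (\<Prod>e\<in>set_mset (edges F). \<mu> (\<psi> ` e) (count (edges F) e)))"
      unfolding S by (intro sum.cong refl) (simp only: S)
    also have "\<dots> = (\<Prod>i\<in>?A. c * card (fibre V \<tau> (\<psi> i))) *
      (\<Prod>e\<in>set_mset (edges F). \<mu> (\<psi> ` e) (count (edges F) e))"
      using finA by (simp add: card_PiE prod.distrib)
    finally show "(\<Sum>\<phi>\<in>?S. ?t \<phi>) = (\<Prod>i\<in>?A. c * card (fibre V \<tau> (\<psi> i))) *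
      (\<Prod>e\<in>set_mset (edges F). \<mu> (\<psi> ` e) (count (edges F) e))" .
  qed
  finally show ?thesis by (simp add: edge_hom_def)
qed

text \<open>Some classes may have size tending to 0 relative to the whole. They are discarded in the
  limit, where node weights have to be positive and the frequencies have to sum to 1.\<close>

lemma edge_hom_drop_zero_weights:
  assumes F: "multigraph F" and V: "finite V"
  shows "edge_hom V \<alpha> \<mu> F = edge_hom {i \<in> V. \<alpha> i \<noteq> 0} \<alpha> \<mu> F"
proof -
  have finA: "finite (nodes F)" using F by (simp add: multigraph_def)
  show ?thesis unfolding edge_hom_def
  proof (rule sum.mono_neutral_right)
    show "\<forall>\<phi>\<in>(nodes F \<rightarrow>\<^sub>E V) - (nodes F \<rightarrow>\<^sub>E {i \<in> V. \<alpha> i \<noteq> 0}). (\<Prod>i\<in>nodes F. \<alpha> (\<phi> i)) *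
       (\<Prod>e\<in>set_mset (edges F). \<mu> (\<phi> ` e) (count (edges F) e)) = 0"
    proof
      fix \<phi> assume p: "\<phi> \<in> (nodes F \<rightarrow>\<^sub>E V) - (nodes F \<rightarrow>\<^sub>E {i \<in> V. \<alpha> i \<noteq> 0})"
      then have "\<exists>i\<in>nodes F. \<alpha> (\<phi> i) = 0" by (auto simp: PiE_iff)
      then have "(\<Prod>i\<in>nodes F. \<alpha> (\<phi> i)) = 0" using finA by (simp add: prod_zero_iff)
      then show "(\<Prod>i\<in>nodes F. \<alpha> (\<phi> i)) *
       (\<Prod>e\<in>set_mset (edges F). \<mu> (\<phi> ` e) (count (edges F) e)) = 0" by simp
    qed
  qed (use finA V in \<open>auto intro: finite_PiE\<close>)
qed

text \<open>All powers of \<open>g\<close> are combinations of the first \<open>card B\<close> ones, so controlling these is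
  enough.\<close>

lemma power_bilinear_bound:
  fixes \<epsilon> :: real
  assumes V: "finite V" "V \<noteq> {}" and B: "finite B" "\<And>A. g A \<in> B"
    and q: "\<And>x. x \<in> V \<Longrightarrow> \<tau> x < (q::nat)"
    and C: "\<And>j x y. j < card B \<Longrightarrow> cdist V (\<lambda>x y. g {x, y} ^ j) x y \<le> C"
    and eps: "(\<Sum>x\<in>V. \<Sum>y\<in>part V \<tau> x. power_cdist (card B) V (\<lambda>x y. g {x, y}) x y) \<le> (card V)\<^sup>2 * \<epsilon>"
    and c: "\<And>b. b \<in> B \<Longrightarrow> b ^ k = (\<Sum>j<card B. c j * b ^ j)"
    and u: "\<And>x. x \<in> V \<Longrightarrow> \<bar>u x\<bar> \<le> 1" and v: "\<And>x. x \<in> V \<Longrightarrow> \<bar>v x\<bar> \<le> 1"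
  shows "\<bar>\<Sum>x\<in>V. \<Sum>y\<in>V. u x * v y * (g {x, y} ^ k - (\<Sum>b\<in>B. edge_freq V \<tau> g (\<tau> ` {x, y}) b * b ^ k))\<bar>
    \<le> (card V)\<^sup>2 * ((\<Sum>j<card B. \<bar>c j\<bar>) * (2 * sqrt (2 * sqrt (sqrt (C * q * \<epsilon>)))))"
proof -
  let ?h = "\<lambda>k x y. g {x, y} ^ k - (\<Sum>b\<in>B. edge_freq V \<tau> g (\<tau> ` {x, y}) b * b ^ k)"
  let ?s = "2 * sqrt (2 * sqrt (sqrt (C * q * \<epsilon>)))"
  have one: "\<bar>\<Sum>x\<in>V. \<Sum>y\<in>V. u x * v y * ?h j x y\<bar> \<le> (card V)\<^sup>2 * ?s" if j: "j < card B" for j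
  proof -
    let ?G = "\<lambda>x y. g {x, y} ^ j"
    have "\<bar>\<Sum>x\<in>V. \<Sum>y\<in>V. u x * v y * (?G x y - part_avg V \<tau> (\<lambda>x'. part_avg V \<tau> (?G x') y) x)\<bar> \<le>
       2 * (card V)\<^sup>2 * sqrt (2 * sqrt (sqrt (C * q * \<epsilon>)))"
    proof (rule averaged_bilinear_bound[OF V _ q C[OF j] _ u v])
      show "g {x, y} ^ j = g {y, x} ^ j" for x y by (simp add: insert_commute)
      have "cdist V ?G x y \<le> power_cdist (card B) V (\<lambda>x y. g {x, y}) x y" for x y
        unfolding power_cdist_def using j cdist_nonneg by (intro member_le_sum) auto
      then have "(\<Sum>x\<in>V. \<Sum>y\<in>part V \<tau> x. cdist V ?G x y) \<le>
         (\<Sum>x\<in>V. \<Sum>y\<in>part V \<tau> x. power_cdist (card B) V (\<lambda>x y. g {x, y}) x y)"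
        by (intro sum_mono)
      then show "(\<Sum>x\<in>V. \<Sum>y\<in>part V \<tau> x. cdist V ?G x y) \<le> (card V)\<^sup>2 * \<epsilon>" using eps by simp
    qed
    moreover have "(\<Sum>x\<in>V. \<Sum>y\<in>V. u x * v y * (?G x y - part_avg V \<tau> (\<lambda>x'. part_avg V \<tau> (?G x') y) x)) =
       (\<Sum>x\<in>V. \<Sum>y\<in>V. u x * v y * ?h j x y)"
      using double_part_avg_eq_edge_freq[of V B g, OF V(1) B] by (intro sum.cong refl) simp
    ultimately show ?thesis by (simp add: mult_ac)
  qed
  have "?h k x y = (\<Sum>j<card B. c j * ?h j x y)" for x y
  proof -
    have "(\<Sum>b\<in>B. edge_freq V \<tau> g (\<tau> ` {x, y}) b * b ^ k) =
       (\<Sum>b\<in>B. \<Sum>j<card B. c j * (edge_freq V \<tau> g (\<tau> ` {x, y}) b * b ^ j))"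
      using c by (intro sum.cong refl) (simp add: sum_distrib_left mult.left_commute)
    also have "\<dots> = (\<Sum>j<card B. c j * (\<Sum>b\<in>B. edge_freq V \<tau> g (\<tau> ` {x, y}) b * b ^ j))"
      by (subst sum.swap) (simp add: sum_distrib_left)
    finally show ?thesis
      using c[OF B(2), of "{x, y}"] by (simp add: right_diff_distrib sum_subtractf)
  qed
  then have "(\<Sum>x\<in>V. \<Sum>y\<in>V. u x * v y * ?h k x y) =
     (\<Sum>x\<in>V. \<Sum>y\<in>V. \<Sum>j<card B. c j * (u x * v y * ?h j x y))"
    by (simp add: sum_distrib_left mult.left_commute)
  also have "\<dots> = (\<Sum>x\<in>V. \<Sum>j<card B. \<Sum>y\<in>V. c j * (u x * v y * ?h j x y))"
    by (intro sum.cong refl sum.swap)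
  also have "\<dots> = (\<Sum>j<card B. \<Sum>x\<in>V. \<Sum>y\<in>V. c j * (u x * v y * ?h j x y))"
    by (rule sum.swap)
  also have "\<dots> = (\<Sum>j<card B. c j * (\<Sum>x\<in>V. \<Sum>y\<in>V. u x * v y * ?h j x y))"
    by (simp only: sum_distrib_left)
  also have "\<bar>\<dots>\<bar> \<le> (\<Sum>j<card B. \<bar>c j\<bar> * ((card V)\<^sup>2 * ?s))"
    using one by (intro order_trans[OF sum_abs] sum_mono) (simp add: abs_mult mult_left_mono)
  also have "\<dots> = (card V)\<^sup>2 * ((\<Sum>j<card B. \<bar>c j\<bar>) * ?s)"
    by (simp only: sum_distrib_right[symmetric] mult_ac)
  finally show ?thesis .
qed

lemma cdist_le:
  assumes V: "finite V" "V \<noteq> {}" and G: "\<And>x y. \<bar>G x y\<bar> \<le> M"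
  shows "cdist V G x y \<le> 4 * M ^ 4"
proof -
  let ?N = "real (card V)"
  have N: "?N > 0" using V by (simp add: card_gt_0_iff)
  have M0: "M \<ge> 0" using G by (metis abs_ge_zero order_trans)
  have K: "\<bar>codeg V G x z\<bar> \<le> M\<^sup>2" for x z
  proof -
    have "\<bar>\<Sum>u\<in>V. G x u * G u z\<bar> \<le> (\<Sum>u\<in>V. M * M)"
      using G M0 by (intro order_trans[OF sum_abs] sum_mono) (simp add: abs_mult mult_mono)
    then show ?thesis using N by (simp add: codeg_def abs_divide field_simps power2_eq_square)
  qed
  have "(codeg V G x z - codeg V G y z)\<^sup>2 \<le> 4 * M ^ 4" for z
  proof -
    have "\<bar>codeg V G x z - codeg V G y z\<bar> \<le> 2 * M\<^sup>2" using K[of x z] K[of y z] by linarith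
    then have "\<bar>codeg V G x z - codeg V G y z\<bar>\<^sup>2 \<le> (2 * M\<^sup>2)\<^sup>2" by (intro power_mono) auto
    then show ?thesis by (simp add: power_mult_distrib)
  qed
  then have "(\<Sum>z\<in>V. (codeg V G x z - codeg V G y z)\<^sup>2) \<le> (\<Sum>z\<in>V. 4 * M ^ 4)" by (intro sum_mono)
  then show ?thesis using N by (simp add: cdist_def field_simps)
qed

section \<open>From the approximating colourings to a finite limit model\<close>

locale approximated_parameter = reflection_positive_parameter +
  fixes n r :: nat and B :: "real set" and N :: "nat \<Rightarrow> nat" and g :: "nat \<Rightarrow> nat set \<Rightarrow> real"
  assumes n: "n \<ge> 2" and rank: "connection_rank f n = enat r"
    and B: "finite B" and N: "\<And>s. N s \<ge> 1" and g: "\<And>s A. g s A \<in> B"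
    and conv: "\<And>F. multigraph F \<Longrightarrow> (\<lambda>s. density (N s) (g s) F) \<longlonglongrightarrow> norm_param F"
begin

abbreviation V :: "nat \<Rightarrow> nat set" where "V s \<equiv> {1..N s}"
abbreviation P :: "nat \<Rightarrow> (nat \<Rightarrow> nat) set" where "P s \<equiv> {1..n} \<rightarrow>\<^sub>E V s"
abbreviation rooted :: "nat \<Rightarrow> (nat \<Rightarrow> nat) \<Rightarrow> mgraph \<Rightarrow> real" where
  "rooted s \<psi> \<equiv> rooted_hom {1..n} (V s) (\<lambda>_. K1 / card (V s)) (\<lambda>A k. g s A ^ k) \<psi> (\<lambda>e k. g s (\<psi> ` e) ^ k)"

lemma N_pos: "real (N s) > 0"
  using N[of s] by simp

lemma finite_P: "finite (P s)"
  by (intro finite_PiE) auto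

lemma B_bounded: "\<exists>M\<ge>1. \<forall>b\<in>B. \<bar>b\<bar> \<le> M"
proof -
  obtain M where "\<And>x. x \<in> B \<Longrightarrow> \<bar>x\<bar> \<le> M"
    using finite_imp_bounded[OF B] by (auto simp: bounded_iff)
  then show ?thesis by (intro exI[of _ "max 1 M"]) (auto simp: le_max_iff_disj)
qed

text \<open>With node weights \<open>K1 / card (V s)\<close> the limit is \<open>f\<close> itself,
  the parameter to which the rank hypothesis refers.\<close>

lemma conv_f:
  assumes F: "multigraph F"
  shows "(\<lambda>s. edge_hom (V s) (\<lambda>_. K1 / card (V s)) (\<lambda>A k. g s A ^ k) F) \<longlonglongrightarrow> f F"
proof -
  have "edge_hom (V s) (\<lambda>_. K1 / card (V s)) (\<lambda>A k. g s A ^ k) F = K1 ^ card (nodes F) * density (N s) (g s) F" for s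
    by (simp add: edge_hom_def power_divide sum_distrib_left)
  moreover have "(\<lambda>s. K1 ^ card (nodes F) * density (N s) (g s) F) \<longlonglongrightarrow> K1 ^ card (nodes F) * norm_param F"
    by (intro tendsto_mult tendsto_const conv F)
  moreover have "K1 ^ card (nodes F) * norm_param F = f F" using K1_pos by (simp add: norm_param_def)
  ultimately show ?thesis by simp
qed

text \<open>The powers of \<open>y\<close> under gluing are \<open>r + 1\<close> dependent rows.
  Evaluating the square of the dependency on the colourings gives, up to the factor
  \<open>K1 ^ n\<close>, the mean of the square of \<open>p\<close> at the rooted densities of
  \<open>y\<close>, and this tends to 0. Positivity comes from the colourings, so \<open>y\<close>
  may have unlabeled nodes.\<close>

lemma finitely_valued_rooted:
  assumes y: "y \<in> labeled_graphs n"
  shows "finitely_valued P (\<lambda>s \<psi>. rooted s \<psi> y)"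
proof -
  define ypow where "ypow k = (glue n y ^^ k) (lgraph n {#})" for k
  have ypow: "ypow k \<in> labeled_graphs n" for k
    using n y by (induction k) (auto simp: ypow_def intro: glue_in_labeled_graphs lgraph_in_labeled_graphs)
  have rooted_glue: "rooted s \<psi> (glue n F G) = rooted s \<psi> F * rooted s \<psi> G"
    if "F \<in> labeled_graphs n" "G \<in> labeled_graphs n" for s \<psi> F G
    using that by (intro rooted_hom_glue) (auto simp: power_add)
  have rooted_ypow: "rooted s \<psi> (ypow k) = rooted s \<psi> y ^ k" for s \<psi> k
  proof (induction k)
    case 0
    show ?case by (simp add: ypow_def rooted_hom_edgeless del: One_nat_def)
  next
    case (Suc k)
    have "ypow (Suc k) = glue n y (ypow k)" by (simp add: ypow_def)
    then show ?case using Suc rooted_glue[OF y ypow] by simp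
  qed
  obtain u where u: "\<exists>k\<le>r. u k \<noteq> 0"
    "\<And>G. G \<in> labeled_graphs n \<Longrightarrow> (\<Sum>k\<le>r. u k * connection_matrix f n (ypow k) G) = 0"
    using rank_finite_imp_dependent[OF rank[unfolded connection_rank_def], of ypow] ypow by blast
  define p where "p = (\<Sum>k\<le>r. monom (u k) k)"
  have "coeff p k = u k" if "k \<le> r" for k
    using that by (simp add: p_def coeff_sum)
  then have p0: "p \<noteq> 0" using u(1) by auto
  have poly_p: "poly p x = (\<Sum>k\<le>r. u k * x ^ k)" for x
    by (simp add: p_def poly_sum poly_monom)
  let ?h = "\<lambda>s F. edge_hom (V s) (\<lambda>_. K1 / card (V s)) (\<lambda>A k. g s A ^ k) F"
  have glue_kl: "glue n (ypow k) (ypow l) \<in> labeled_graphs n" for k l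
    by (intro glue_in_labeled_graphs ypow)
  have h_glue: "?h s (glue n (ypow k) (ypow l)) =
      (K1 / card (V s)) ^ n * (\<Sum>\<psi>\<in>P s. rooted s \<psi> y ^ k * rooted s \<psi> y ^ l)" for s k l
  proof -
    have "?h s (glue n (ypow k) (ypow l)) =
       (\<Sum>\<psi>\<in>P s. (\<Prod>i\<in>{1..n}. K1 / card (V s)) * rooted s \<psi> (glue n (ypow k) (ypow l)))"
      using glue_kl by (intro edge_hom_expand) (auto simp: labeled_graphs_def)
    then show ?thesis using rooted_glue[OF ypow ypow] rooted_ypow
      by (simp add: sum_distrib_left del: One_nat_def)
  qed
  have "(\<lambda>s. \<Sum>l\<le>r. u l * (\<Sum>k\<le>r. u k * ?h s (glue n (ypow k) (ypow l)))) \<longlonglongrightarrow>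
      (\<Sum>l\<le>r. u l * (\<Sum>k\<le>r. u k * f (glue n (ypow k) (ypow l))))"
    using glue_kl by (intro tendsto_intros conv_f) (auto simp: labeled_graphs_def)
  also have "(\<Sum>l\<le>r. u l * (\<Sum>k\<le>r. u k * f (glue n (ypow k) (ypow l)))) = 0"
    using u(2)[OF ypow] by (simp add: connection_matrix_def)
  finally have lim: "(\<lambda>s. \<Sum>l\<le>r. u l * (\<Sum>k\<le>r. u k * ?h s (glue n (ypow k) (ypow l)))) \<longlonglongrightarrow> 0" .
  have eq: "(\<Sum>l\<le>r. u l * (\<Sum>k\<le>r. u k * ?h s (glue n (ypow k) (ypow l)))) =
      K1 ^ n * ((\<Sum>\<psi>\<in>P s. (poly p (rooted s \<psi> y))\<^sup>2) / card (P s))" for s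
  proof -
    have "(\<Sum>l\<le>r. u l * (\<Sum>k\<le>r. u k * ?h s (glue n (ypow k) (ypow l)))) =
      (\<Sum>l\<le>r. \<Sum>k\<le>r. \<Sum>\<psi>\<in>P s. (K1 / card (V s)) ^ n * (u l * rooted s \<psi> y ^ l * (u k * rooted s \<psi> y ^ k)))"
      unfolding h_glue by (simp add: sum_distrib_left mult_ac del: One_nat_def)
    also have "\<dots> = (\<Sum>l\<le>r. \<Sum>\<psi>\<in>P s. \<Sum>k\<le>r. (K1 / card (V s)) ^ n * (u l * rooted s \<psi> y ^ l * (u k * rooted s \<psi> y ^ k)))"
      by (intro sum.cong refl sum.swap)
    also have "\<dots> = (\<Sum>\<psi>\<in>P s. \<Sum>l\<le>r. \<Sum>k\<le>r. (K1 / card (V s)) ^ n * (u l * rooted s \<psi> y ^ l * (u k * rooted s \<psi> y ^ k)))"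
      by (rule sum.swap)
    also have "\<dots> = (\<Sum>\<psi>\<in>P s. (K1 / card (V s)) ^ n * (poly p (rooted s \<psi> y))\<^sup>2)"
      unfolding poly_p power2_eq_square sum_product by (simp only: sum_distrib_left)
    also have "\<dots> = K1 ^ n * ((\<Sum>\<psi>\<in>P s. (poly p (rooted s \<psi> y))\<^sup>2) / card (P s))"
      by (simp add: card_PiE power_divide sum_distrib_left sum_divide_distrib del: One_nat_def)
    finally show ?thesis .
  qed
  have lim0: "(\<lambda>s. (\<Sum>\<psi>\<in>P s. (poly p (rooted s \<psi> y))\<^sup>2) / card (P s)) \<longlonglongrightarrow> 0"
    using tendsto_mult[OF tendsto_const[of "1 / K1 ^ n"] lim] K1_pos unfolding eq by simp
  obtain M where M: "\<And>b. b \<in> B \<Longrightarrow> \<bar>b\<bar> \<le> M" using B_bounded by blast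
  have "\<bar>rooted s \<psi> y\<bar> \<le> K1 ^ card (nodes y - {1..n}) * M ^ size (edges y)" for s \<psi>
    using y K1_pos N[of s] g M
    by (intro abs_rooted_hom_le) (auto simp: labeled_graphs_def)
  from finitely_valued_of_polynomial[OF p0 this finite_P lim0] show ?thesis .
qed

definition dst :: "nat \<Rightarrow> nat \<Rightarrow> nat \<Rightarrow> real" where
  "dst s = power_cdist (card B) (V s) (\<lambda>x y. g s {x, y})"

text \<open>Two roots are available since \<open>n \<ge> 2\<close>. Up to the factor
  \<open>K1 ^ 3\<close> the values of \<open>cyc4\<close> are rooted densities of
  \<open>path4\<close>.\<close>

lemma finitely_valued_dst: "finitely_valued P (\<lambda>s \<psi>. dst s (\<psi> 1) (\<psi> 2))"
proof -
  have cyc: "finitely_valued P (\<lambda>s \<psi>. cyc4 (V s) (\<lambda>x y. g s {x, y} ^ j) (\<psi> a) (\<psi> b))"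
    if "a \<in> {1, 2}" "b \<in> {1, 2}" for j a b
  proof -
    have ab: "a \<in> {1..n}" "b \<in> {1..n}" using that n by auto
    have "rooted s \<psi> (path4 n j a b) = K1 ^ 3 * cyc4 (V s) (\<lambda>x y. g s {x, y} ^ j) (\<psi> a) (\<psi> b)" for s \<psi>
      using ab N[of s] by (intro rooted_hom_path4) auto
    then show ?thesis
      using finitely_valued_mult[OF finitely_valued_rooted[OF path4_in_labeled_graphs[OF ab, of j]], of "1 / K1 ^ 3"] K1_pos
      by simp
  qed
  have "finitely_valued P (\<lambda>s \<psi>. cdist (V s) (\<lambda>x y. g s {x, y} ^ j) (\<psi> 1) (\<psi> 2))" for j
  proof -
    let ?c = "\<lambda>s. cyc4 (V s) (\<lambda>x y. g s {x, y} ^ j)"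
    have "finitely_valued P (\<lambda>s \<psi>. ?c s (\<psi> 1) (\<psi> 1) + ?c s (\<psi> 2) (\<psi> 2) + (-2) * ?c s (\<psi> 1) (\<psi> 2))"
      by (intro finitely_valued_add[OF finite_P] finitely_valued_mult cyc) auto
    moreover have "cdist (V s) (\<lambda>x y. g s {x, y} ^ j) x y = ?c s x x + ?c s y y + (-2) * ?c s x y" for s x y
      by (rule cdist_eq_cyc4) (simp add: insert_commute)
    ultimately show ?thesis by (simp only:)
  qed
  then show ?thesis unfolding dst_def power_cdist_def by (intro finitely_valued_sum finite_P)
qed

text \<open>The gap \<theta> is taken first, then a partition with all distances inside classes at
  most \<theta>. The number of classes depends only on \<theta> and \<open>B\<close>, hence not on
  \<open>s\<close>, and yet the average distance inside classes tends to 0 by the gap.\<close>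

lemma exists_partition:
  "\<exists>q \<tau>. (\<forall>s. \<forall>x\<in>V s. \<tau> s x < (q::nat)) \<and>
    (\<lambda>s. (\<Sum>x\<in>V s. \<Sum>y\<in>part (V s) (\<tau> s) x. dst s x y) / (real (N s))\<^sup>2) \<longlonglongrightarrow> 0"
proof -
  obtain \<theta> where \<theta>: "\<theta> > 0" and gap: "\<And>C Q. (\<forall>s. \<forall>p\<in>P s. 0 \<le> dst s (p 1) (p 2) \<and> dst s (p 1) (p 2) \<le> C) \<Longrightarrow>
     (\<forall>s. \<forall>p\<in>P s. Q s p \<longrightarrow> dst s (p 1) (p 2) \<le> \<theta>) \<Longrightarrow>
     (\<lambda>s. (\<Sum>p\<in>{p \<in> P s. Q s p}. dst s (p 1) (p 2)) / card (P s)) \<longlonglongrightarrow> 0"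
    using finitely_valued_gap[OF finite_P finitely_valued_dst] by blast
  obtain M where M: "M \<ge> 1" "\<And>b. b \<in> B \<Longrightarrow> \<bar>b\<bar> \<le> M" using B_bounded by blast
  have powM: "\<bar>b ^ j\<bar> \<le> M ^ card B" if "b \<in> B" "j < card B" for b j
  proof -
    have "\<bar>b ^ j\<bar> \<le> M ^ j" using M that by (simp add: power_abs power_mono)
    also have "\<dots> \<le> M ^ card B" using M that by (intro power_increasing) auto
    finally show ?thesis .
  qed
  \<comment> \<open>The threshold is \<open>\<theta> / 4\<close> because distances inside the
    classes of \<open>bounded_partition\<close> reach four times the threshold.\<close>
  obtain R0 :: nat where "8 * (card B * (M ^ card B) ^ 4) / (\<theta> / 4) < real R0"
    using reals_Archimedean2 by blast
  then have "8 * (card B * (M ^ card B) ^ 4) / (\<theta> / 4) < real (Suc R0)" by simp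
  then have R: "Suc R0 > 0" "real (Suc R0) * (\<theta> / 4) > 8 * (card B * (M ^ card B) ^ 4)"
    using \<theta> by (simp_all add: field_simps)
  define q where "q = 2 * card B ^ Suc R0"
  have "\<exists>\<tau>::nat \<Rightarrow> nat. (\<forall>x\<in>V s. \<tau> x < q) \<and>
    (\<forall>x\<in>V s. \<forall>y\<in>V s. \<tau> x = \<tau> y \<longrightarrow> dst s x y \<le> 4 * (\<theta> / 4))" for s
    unfolding q_def dst_def
    using N[of s] g B powM R \<theta> by (intro bounded_partition[where C = "M ^ card B"]) auto
  then obtain \<tau> where \<tau>: "\<And>s x. x \<in> V s \<Longrightarrow> \<tau> s x < q"
    "\<And>s x y. x \<in> V s \<Longrightarrow> y \<in> V s \<Longrightarrow> \<tau> s x = \<tau> s y \<Longrightarrow> dst s x y \<le> \<theta>"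
    by (metis mult.commute nonzero_eq_divide_eq zero_neq_numeral)
  define Q where "Q s p \<longleftrightarrow> \<tau> s (p 1) = \<tau> s (p 2)" for s and p :: "nat \<Rightarrow> nat"
  have memP: "p 1 \<in> V s" "p 2 \<in> V s" if "p \<in> P s" for s p
    using that n by (auto intro: PiE_mem)
  define C where "C = card B * (4 * (M ^ card B) ^ 4)"
  have bnd: "0 \<le> dst s x y \<and> dst s x y \<le> C" for s x y
  proof
    show "0 \<le> dst s x y" by (simp add: dst_def power_cdist_nonneg)
    have "dst s x y \<le> (\<Sum>j<card B. 4 * (M ^ card B) ^ 4)"
      unfolding dst_def power_cdist_def using N[of s] g powM by (intro sum_mono cdist_le) auto
    then show "dst s x y \<le> C" by (simp add: C_def)
  qed
  have "(\<lambda>s. (\<Sum>p\<in>{p \<in> P s. Q s p}. dst s (p 1) (p 2)) / card (P s)) \<longlonglongrightarrow> 0"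
    using bnd \<tau>(2) memP by (intro gap[of C]) (auto simp: Q_def)
  moreover have "(\<Sum>p\<in>{p \<in> P s. Q s p}. dst s (p 1) (p 2)) / card (P s) =
     (\<Sum>x\<in>V s. \<Sum>y\<in>part (V s) (\<tau> s) x. dst s x y) / (real (N s))\<^sup>2" for s
  proof -
    let ?d = "\<lambda>x y. if \<tau> s x = \<tau> s y then dst s x y else 0"
    have "(\<Sum>p\<in>{p \<in> P s. Q s p}. dst s (p 1) (p 2)) = (\<Sum>p\<in>P s. ?d (p 1) (p 2))"
      unfolding sum.inter_filter[OF finite_P] Q_def ..
    \<comment> \<open>The labels other than 1 and 2 are free; their number of choices cancels
      against \<open>card (P s)\<close>.\<close>
    also have "\<dots> = real (card (V s)) ^ (n - 2) * (\<Sum>x\<in>V s. \<Sum>y\<in>V s. ?d x y)"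
      using n by (intro sum_PiE_first_two) auto
    also have "(\<Sum>x\<in>V s. \<Sum>y\<in>V s. ?d x y) = (\<Sum>x\<in>V s. \<Sum>y\<in>part (V s) (\<tau> s) x. dst s x y)"
      unfolding part_def sum.inter_filter[OF finite_atLeastAtMost] by (intro sum.cong refl) auto
    finally have "(\<Sum>p\<in>{p \<in> P s. Q s p}. dst s (p 1) (p 2)) =
      real (N s) ^ (n - 2) * (\<Sum>x\<in>V s. \<Sum>y\<in>part (V s) (\<tau> s) x. dst s x y)" by simp
    moreover have "real (card (P s)) = real (N s) ^ (n - 2) * (real (N s))\<^sup>2"
    proof -
      have m: "n - 2 + 2 = n" using n by simp
      have "real (card (P s)) = real (N s) ^ n" by (simp add: card_PiE)
      then show ?thesis using power_add[of "real (N s)" "n - 2" 2] unfolding m by (simp only:)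
    qed
    ultimately show ?thesis using N_pos[of s] by simp
  qed
  ultimately show ?thesis using \<tau>(1) by (intro exI[of _ q] exI[of _ \<tau>]) simp
qed

text \<open>With \<open>q\<close> and the bound \<open>C\<close> fixed, the nested roots of the
  cut-norm estimate tend to 0 along with \<epsilon>, and the counting lemma carries this over to the
  densities of each fixed \<open>F\<close>.\<close>

lemma step_model_approximation:
  "\<exists>q \<tau>. (\<forall>s. \<forall>x\<in>V s. \<tau> s x < (q::nat)) \<and> (\<forall>F. multigraph F \<longrightarrow>
    (\<lambda>s. edge_hom {..<q} (\<lambda>i. 1 / N s * card (fibre (V s) (\<tau> s) i))
       (\<lambda>A k. \<Sum>b\<in>B. edge_freq (V s) (\<tau> s) (g s) A b * b ^ k) F) \<longlonglongrightarrow> norm_param F)"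
proof -
  obtain q \<tau> where \<tau>: "\<And>s x. x \<in> V s \<Longrightarrow> \<tau> s x < (q::nat)" and
    lim: "(\<lambda>s. (\<Sum>x\<in>V s. \<Sum>y\<in>part (V s) (\<tau> s) x. dst s x y) / (real (N s))\<^sup>2) \<longlonglongrightarrow> 0"
    using exists_partition by blast
  define \<epsilon> where "\<epsilon> s = (\<Sum>x\<in>V s. \<Sum>y\<in>part (V s) (\<tau> s) x. dst s x y) / (real (N s))\<^sup>2" for s
  obtain M where M: "M \<ge> 1" "\<And>b. b \<in> B \<Longrightarrow> \<bar>b\<bar> \<le> M" using B_bounded by blast
  define C where "C = 4 * (M ^ card B) ^ 4"
  have cd: "cdist (V s) (\<lambda>x y. g s {x, y} ^ j) x y \<le> C" if j: "j < card B" for s j x y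
    unfolding C_def
  proof (rule cdist_le)
    fix x y
    have "\<bar>g s {x, y} ^ j\<bar> \<le> M ^ j" using M g by (simp add: power_abs power_mono)
    also have "\<dots> \<le> M ^ card B" using M j by (intro power_increasing) auto
    finally show "\<bar>g s {x, y} ^ j\<bar> \<le> M ^ card B" .
  qed (use N[of s] in auto)
  define \<eta> where "\<eta> s = 2 * sqrt (2 * sqrt (sqrt (C * q * \<epsilon> s)))" for s
  have \<eta>: "\<eta> \<longlonglongrightarrow> 0"
  proof -
    have "\<epsilon> \<longlonglongrightarrow> 0" using lim unfolding \<epsilon>_def .
    then have "(\<lambda>s. 2 * sqrt (2 * sqrt (sqrt (C * q * \<epsilon> s)))) \<longlonglongrightarrow> 2 * sqrt (2 * sqrt (sqrt (C * q * 0)))"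
      by (intro tendsto_intros)
    then show ?thesis by (simp add: \<eta>_def[abs_def])
  qed
  have "(\<lambda>s. edge_hom {..<q} (\<lambda>i. 1 / N s * card (fibre (V s) (\<tau> s) i))
       (\<lambda>A k. \<Sum>b\<in>B. edge_freq (V s) (\<tau> s) (g s) A b * b ^ k) F) \<longlonglongrightarrow> norm_param F" if F: "multigraph F" for F
  proof -
    let ?E = "set_mset (edges F)"
    have "\<forall>k. \<exists>c. \<forall>b\<in>B. b ^ k = (\<Sum>j<card B. c j * b ^ j)"
      using lagrange_interpolation[OF B, of "\<lambda>b. b ^ k" for k] by blast
    then obtain c where c: "\<And>k b. b \<in> B \<Longrightarrow> b ^ k = (\<Sum>j<card B. c k j * b ^ j)"
      by metis
    \<comment> \<open>Summing the interpolation coefficients over all edges gives one cut-norm bound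
      valid for every multiplicity that occurs in \<open>F\<close>.\<close>
    define c0 where "c0 = (\<Sum>e\<in>?E. \<Sum>j<card B. \<bar>c (count (edges F) e) j\<bar>)"
    define W where "W s A k = (\<Sum>b\<in>B. edge_freq (V s) (\<tau> s) (g s) (\<tau> s ` A) b * b ^ k)" for s A k
    let ?M = "M ^ size (edges F)"
    have powle: "\<bar>b ^ count (edges F) e\<bar> \<le> ?M" if "b \<in> B" "e \<in># edges F" for b e
    proof -
      have "\<bar>b ^ count (edges F) e\<bar> \<le> M ^ count (edges F) e" using M that by (simp add: power_abs power_mono)
      also have "\<dots> \<le> ?M" using M by (intro power_increasing count_le_size) auto
      finally show ?thesis .
    qed
    have diff: "\<bar>density (N s) (g s) F - edge_hom (V s) (\<lambda>_. 1 / card (V s)) (W s) F\<bar> \<le>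
       card ?E * (?M ^ card ?E * (c0 * \<eta> s))" for s
    proof -
      have "\<bar>edge_hom (V s) (\<lambda>_. 1 / card (V s)) (\<lambda>A k. g s A ^ k) F - edge_hom (V s) (\<lambda>_. 1 / card (V s)) (W s) F\<bar> \<le>
         card ?E * (?M ^ card ?E * (c0 * \<eta> s))"
      proof (rule counting_lemma[OF F])
        show "finite (V s)" "V s \<noteq> {}" using N[of s] by auto
        show "1 \<le> ?M" using M by simp
        show "\<bar>g s A ^ count (edges F) e\<bar> \<le> ?M" if "e \<in># edges F" for e A using powle g that by blast
        show "\<bar>W s A (count (edges F) e)\<bar> \<le> ?M" if "e \<in># edges F" for e A
          unfolding W_def using powle[OF _ that] g B M by (intro abs_sum_edge_freq_le) auto
        fix e and u v :: "nat \<Rightarrow> real"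
        assume e: "e \<in># edges F" and u: "\<And>x. x \<in> V s \<Longrightarrow> \<bar>u x\<bar> \<le> 1" and v: "\<And>x. x \<in> V s \<Longrightarrow> \<bar>v x\<bar> \<le> 1"
        have "\<bar>\<Sum>x\<in>V s. \<Sum>y\<in>V s. u x * v y * (g s {x, y} ^ count (edges F) e - W s {x, y} (count (edges F) e))\<bar>
          \<le> (card (V s))\<^sup>2 * ((\<Sum>j<card B. \<bar>c (count (edges F) e) j\<bar>) * \<eta> s)"
          unfolding W_def \<eta>_def
        proof (rule power_bilinear_bound[where g = "g s" and \<tau> = "\<tau> s" and q = q])
          show "(\<Sum>x\<in>V s. \<Sum>y\<in>part (V s) (\<tau> s) x. power_cdist (card B) (V s) (\<lambda>x y. g s {x, y}) x y) \<le>
             (card (V s))\<^sup>2 * \<epsilon> s"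
            using N_pos[of s] by (simp add: \<epsilon>_def dst_def)
          show "b ^ count (edges F) e = (\<Sum>j<card B. c (count (edges F) e) j * b ^ j)" if "b \<in> B" for b
            using that by (rule c)
        qed (use N[of s] B g \<tau> cd u v in auto)
        also have "\<dots> \<le> (card (V s))\<^sup>2 * (c0 * \<eta> s)"
        proof (intro mult_left_mono mult_right_mono)
          show "(\<Sum>j<card B. \<bar>c (count (edges F) e) j\<bar>) \<le> c0"
            unfolding c0_def by (rule member_le_sum[OF e]) (auto simp: sum_nonneg)
          have "C * q * \<epsilon> s \<ge> 0"
            by (auto simp: C_def \<epsilon>_def dst_def intro!: mult_nonneg_nonneg divide_nonneg_nonneg sum_nonneg power_cdist_nonneg)
          then show "\<eta> s \<ge> 0" by (simp add: \<eta>_def)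
        qed simp
        finally show "\<bar>\<Sum>x\<in>V s. \<Sum>y\<in>V s. u x * v y * (g s {x, y} ^ count (edges F) e - W s {x, y} (count (edges F) e))\<bar>
          \<le> (card (V s))\<^sup>2 * (c0 * \<eta> s)" .
      qed
      then show ?thesis by simp
    qed
    have "(\<lambda>s. density (N s) (g s) F - edge_hom (V s) (\<lambda>_. 1 / card (V s)) (W s) F) \<longlonglongrightarrow> 0"
    proof (rule Lim_null_comparison)
      show "\<forall>\<^sub>F s in sequentially. norm (density (N s) (g s) F - edge_hom (V s) (\<lambda>_. 1 / card (V s)) (W s) F) \<le>
         card ?E * (?M ^ card ?E * (c0 * \<eta> s))"
        using diff by (intro always_eventually allI) (simp only: real_norm_def)
      have "(\<lambda>s. card ?E * (?M ^ card ?E * (c0 * \<eta> s))) \<longlonglongrightarrow> card ?E * (?M ^ card ?E * (c0 * 0))"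
        by (intro tendsto_intros \<eta>)
      then show "(\<lambda>s. card ?E * (?M ^ card ?E * (c0 * \<eta> s))) \<longlonglongrightarrow> 0" by simp
    qed
    from tendsto_diff[OF conv[OF F] this]
    have lim': "(\<lambda>s. edge_hom (V s) (\<lambda>_. 1 / card (V s)) (W s) F) \<longlonglongrightarrow> norm_param F" by simp
    have "edge_hom (V s) (\<lambda>_. 1 / card (V s)) (W s) F = edge_hom {..<q} (\<lambda>i. 1 / card (V s) * card (fibre (V s) (\<tau> s) i))
       (\<lambda>A k. \<Sum>b\<in>B. edge_freq (V s) (\<tau> s) (g s) A b * b ^ k) F" for s
      unfolding W_def by (rule edge_hom_quotient[OF _ \<tau> F]) auto
    then show ?thesis using lim' by simp
  qed
  then show ?thesis using \<tau> by blast
qed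

end

context approximated_parameter
begin

text \<open>Since \<open>q\<close> is fixed, the step models range over a compact finite-dimensional
  cube, and \<open>edge_hom\<close> is a polynomial in their parameters.\<close>

lemma limit_model:
  "\<exists>V \<alpha> \<pi>. finite V \<and> (\<forall>i\<in>V. \<alpha> i > 0) \<and> (\<forall>i\<in>V. \<forall>j\<in>V. \<forall>b\<in>B. \<pi> {i, j} b \<ge> 0) \<and>
    (\<forall>i\<in>V. \<forall>j\<in>V. (\<Sum>b\<in>B. \<pi> {i, j} b) = 1) \<and>
    (\<forall>F. multigraph F \<longrightarrow> f F = edge_hom V \<alpha> (\<lambda>A k. \<Sum>b\<in>B. \<pi> A b * b ^ k) F)"
proof -
  obtain q \<tau> where \<tau>: "\<And>s x. x \<in> V s \<Longrightarrow> \<tau> s x < (q::nat)" and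
    lim: "\<And>F. multigraph F \<Longrightarrow> (\<lambda>s. edge_hom {..<q} (\<lambda>i. 1 / N s * card (fibre (V s) (\<tau> s) i))
       (\<lambda>A k. \<Sum>b\<in>B. edge_freq (V s) (\<tau> s) (g s) A b * b ^ k) F) \<longlonglongrightarrow> norm_param F"
    using step_model_approximation by blast
  define a where "a i s = 1 / N s * card (fibre (V s) (\<tau> s) i)" for i s
  define p where "p A b s = edge_freq (V s) (\<tau> s) (g s) A b" for A b s
  have a01: "0 \<le> a i s" "a i s \<le> 1" for i s
  proof -
    have "card (fibre (V s) (\<tau> s) i) \<le> card (V s)" by (intro card_mono) (auto simp: fibre_def)
    then show "a i s \<le> 1" using N_pos[of s] by (simp add: a_def)
  qed (simp add: a_def)
  have p01: "0 \<le> p A b s" "p A b s \<le> 1" for A b s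
    by (simp_all add: p_def edge_freq_nonneg edge_freq_le_1)
  define I where "I = Inl ` {..<q} \<union> Inr ` (Pow {..<q} \<times> B)"
  define X where "X = case_sum a (\<lambda>(A, b). p A b)"
  have "\<exists>C. \<forall>s. \<bar>X i s\<bar> \<le> C" if "i \<in> I" for i
    using that a01 p01 by (intro exI[of _ 1]) (auto simp: I_def X_def)
  moreover have "finite I" using B by (simp add: I_def)
  ultimately obtain t :: "nat \<Rightarrow> nat" where t: "strict_mono t" "\<And>i. i \<in> I \<Longrightarrow> convergent (\<lambda>s. X i (t s))"
    using bounded_family_convergent_subsequence[of I X] by blast
  define \<alpha> where "\<alpha> i = lim (\<lambda>s. a i (t s))" for i
  define \<pi> where "\<pi> A b = lim (\<lambda>s. p A b (t s))" for A b
  have lim_a: "(\<lambda>s. a i (t s)) \<longlonglongrightarrow> \<alpha> i" if "i < q" for i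
    using t(2)[of "Inl i"] that unfolding \<alpha>_def by (simp add: I_def X_def convergent_LIMSEQ_iff)
  have lim_p: "(\<lambda>s. p A b (t s)) \<longlonglongrightarrow> \<pi> A b" if "A \<subseteq> {..<q}" "b \<in> B" for A b
    using t(2)[of "Inr (A, b)"] that unfolding \<pi>_def by (force simp: I_def X_def convergent_LIMSEQ_iff)
  let ?\<mu> = "\<lambda>A k. \<Sum>b\<in>B. \<pi> A b * b ^ k"
  have norm_param_eq: "norm_param F = edge_hom {..<q} \<alpha> ?\<mu> F" if F: "multigraph F" for F
  proof -
    have "(\<lambda>s. edge_hom {..<q} (\<lambda>i. a i (t s)) (\<lambda>A k. \<Sum>b\<in>B. p A b (t s) * b ^ k) F) \<longlonglongrightarrow> edge_hom {..<q} \<alpha> ?\<mu> F"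
      unfolding edge_hom_def
    proof (intro tendsto_sum tendsto_mult tendsto_prod tendsto_const)
      fix \<phi> i assume "\<phi> \<in> nodes F \<rightarrow>\<^sub>E {..<q}" "i \<in> nodes F"
      then show "(\<lambda>s. a (\<phi> i) (t s)) \<longlonglongrightarrow> \<alpha> (\<phi> i)" by (intro lim_a) (auto dest: PiE_mem)
    next
      fix \<phi> e b assume "\<phi> \<in> nodes F \<rightarrow>\<^sub>E {..<q}" "e \<in># edges F" "b \<in> B"
      moreover have "e \<subseteq> nodes F" using F \<open>e \<in># edges F\<close> by (auto simp: multigraph_def)
      ultimately show "(\<lambda>s. p (\<phi> ` e) b (t s)) \<longlonglongrightarrow> \<pi> (\<phi> ` e) b"
        by (intro lim_p) (auto dest: PiE_mem)
    qed
    moreover have "(\<lambda>s. edge_hom {..<q} (\<lambda>i. a i (t s)) (\<lambda>A k. \<Sum>b\<in>B. p A b (t s) * b ^ k) F) \<longlonglongrightarrow> norm_param F"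
      using LIMSEQ_subseq_LIMSEQ[OF lim[OF F] t(1)] by (simp add: a_def p_def o_def)
    ultimately show ?thesis using LIMSEQ_unique by blast
  qed
  \<comment> \<open>The factor \<open>K1\<close> per node undoes the normalization of
    \<open>norm_param\<close>.\<close>
  define \<alpha>' where "\<alpha>' i = K1 * \<alpha> i" for i
  define W where "W = {i \<in> {..<q}. \<alpha>' i \<noteq> 0}"
  have a0: "\<alpha> i \<ge> 0" if "i < q" for i
    using LIMSEQ_le_const[OF lim_a[OF that]] a01 by auto
  have "f F = edge_hom W \<alpha>' ?\<mu> F" if F: "multigraph F" for F
  proof -
    have "f F = K1 ^ card (nodes F) * norm_param F" using K1_pos by (simp add: norm_param_def)
    also have "\<dots> = edge_hom {..<q} \<alpha>' ?\<mu> F"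
      unfolding norm_param_eq[OF F] by (simp add: edge_hom_def \<alpha>'_def prod.distrib sum_distrib_left mult.assoc)
    also have "\<dots> = edge_hom W \<alpha>' ?\<mu> F" unfolding W_def using F by (intro edge_hom_drop_zero_weights) auto
    finally show ?thesis .
  qed
  moreover have "\<alpha>' i > 0" if "i \<in> W" for i
    using that a0[of i] K1_pos by (auto simp: W_def \<alpha>'_def less_le)
  moreover have "\<pi> {i, j} b \<ge> 0" if "i \<in> W" "j \<in> W" "b \<in> B" for i j b
    using LIMSEQ_le_const[OF lim_p[of "{i, j}" b]] that p01 by (auto simp: W_def)
  moreover have "(\<Sum>b\<in>B. \<pi> {i, j} b) = 1" if ij: "i \<in> W" "j \<in> W" for i j
  proof -
    \<comment> \<open>The frequencies of an empty class are 0 by the convention for division; a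
      class with positive limit weight is eventually nonempty, so its frequencies do sum to
      1.\<close>
    have ne: "\<forall>\<^sub>F s in sequentially. fibre (V (t s)) (\<tau> (t s)) i \<noteq> {}" if "i \<in> W" for i
    proof -
      have iq: "i < q" and "\<alpha> i \<noteq> 0" using that by (auto simp: W_def \<alpha>'_def)
      then have "\<alpha> i > 0" using a0[OF iq] by simp
      from order_tendstoD(1)[OF lim_a[OF iq] this] show ?thesis
        by eventually_elim (auto simp: a_def)
    qed
    have "\<forall>\<^sub>F s in sequentially. (\<Sum>b\<in>B. p {i, j} b (t s)) = 1"
      using ne[OF ij(1)] ne[OF ij(2)]
    proof eventually_elim
      case (elim s)
      have "Min {i, j} = i \<or> Min {i, j} = j" "Max {i, j} = i \<or> Max {i, j} = j"
        by (auto simp: min_def max_def)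
      then have "fibre (V (t s)) (\<tau> (t s)) (Min {i, j}) \<noteq> {}" "fibre (V (t s)) (\<tau> (t s)) (Max {i, j}) \<noteq> {}"
        using elim by metis+
      then show ?case unfolding p_def
        by (rule sum_edge_freq_eq_1[OF finite_atLeastAtMost B g])
    qed
    then have "(\<lambda>s. \<Sum>b\<in>B. p {i, j} b (t s)) \<longlonglongrightarrow> 1" by (rule tendsto_eventually)
    moreover have "(\<lambda>s. \<Sum>b\<in>B. p {i, j} b (t s)) \<longlonglongrightarrow> (\<Sum>b\<in>B. \<pi> {i, j} b)"
      using ij by (intro tendsto_sum lim_p) (auto simp: W_def)
    ultimately show ?thesis using LIMSEQ_unique by blast
  qed
  moreover have "finite W" by (simp add: W_def)
  ultimately show ?thesis
    by (intro exI[of _ W] exI[of _ \<alpha>'] exI[of _ \<pi>] conjI ballI allI impI) simp_all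
qed

end

lemma (in reflection_positive_parameter) finite_rank_imp_model:
  assumes "n \<ge> 2" "connection_rank f n \<noteq> \<infinity>"
  shows "\<exists>V \<alpha> \<pi> B. finite V \<and> finite B \<and> (\<forall>i\<in>V. \<alpha> i > 0) \<and>
    (\<forall>i\<in>V. \<forall>j\<in>V. \<forall>b\<in>B. \<pi> {i, j} b \<ge> 0) \<and> (\<forall>i\<in>V. \<forall>j\<in>V. (\<Sum>b\<in>B. \<pi> {i, j} b) = 1) \<and>
    (\<forall>F. multigraph F \<longrightarrow> f F = edge_hom V \<alpha> (\<lambda>A k. \<Sum>b\<in>B. \<pi> A b * b ^ k) F)"
proof -
  obtain r where r: "connection_rank f n = enat r" using assms by auto
  obtain B N g where BNg: "finite B" "\<And>s. N s \<ge> 1" "\<And>s A. g s A \<in> B"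
    "\<And>F. multigraph F \<Longrightarrow> (\<lambda>s. density (N s) (g s) F) \<longlonglongrightarrow> norm_param F"
    using convergent_approximation[OF assms(1) r] by blast
  interpret approximated_parameter f n r B N g
    by unfold_locales (use assms r BNg in auto)
  show ?thesis using limit_model BNg(1) by blast
qed

section \<open>Connection ranks of randomly weighted graphs\<close>

lemma matrix_rank_le:
  assumes I: "finite I" and A: "\<And>x y. x \<in> R \<Longrightarrow> y \<in> C \<Longrightarrow> A x y = (\<Sum>i\<in>I. a x i * b i y)"
  shows "matrix_rank R C A \<le> enat (card I)"
  unfolding matrix_rank_def
proof (rule Sup_least)
  fix k assume "k \<in> {enat (card S) |S. finite S \<and> S \<subseteq> R \<and> rows_independent S C A}"
  then obtain S where S: "k = enat (card S)" "finite S" "S \<subseteq> R" "rows_independent S C A" by blast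
  have "card S \<le> card I"
  proof (rule ccontr)
    assume "\<not> card S \<le> card I"
    then obtain u where u: "\<exists>x\<in>S. u x \<noteq> 0" "\<And>i. i \<in> I \<Longrightarrow> (\<Sum>x\<in>S. u x * a x i) = 0"
      using homogeneous_system_nontrivial[OF I S(2), of a] by auto
    have "(\<Sum>x\<in>S. u x * A x y) = 0" if "y \<in> C" for y
    proof -
      have "(\<Sum>x\<in>S. u x * A x y) = (\<Sum>x\<in>S. \<Sum>i\<in>I. u x * a x i * b i y)"
        using S that by (intro sum.cong refl) (auto simp: A sum_distrib_left mult.assoc)
      also have "\<dots> = (\<Sum>i\<in>I. (\<Sum>x\<in>S. u x * a x i) * b i y)"
        by (subst sum.swap) (simp add: sum_distrib_right)
      finally show ?thesis using u(2) by simp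
    qed
    then show False using S(4) u(1) by (auto simp: rows_independent_def)
  qed
  then show "k \<le> enat (card I)" by (simp add: S)
qed

text \<open>Edges between labels form a factor that does not involve the unlabeled nodes. The value
  1 at multiplicity 0 lets this factor range over all pairs of labels, whether or not they are edges
  of \<open>F\<close>.\<close>

lemma rooted_hom_split:
  assumes F: "multigraph F" and \<rho>: "\<And>e. e \<in> pairs n \<Longrightarrow> \<rho> e 0 = 1"
  shows "rooted_hom {1..n} V \<alpha> \<mu> \<psi> \<rho> F =
    (\<Prod>e\<in>pairs n. \<rho> e (count (edges F) e)) * rooted_hom {1..n} V \<alpha> \<mu> \<psi> (\<lambda>_ _. 1) F"
proof -
  let ?L = "{1..n}" and ?E = "set_mset (edges F)"
  have "(\<Prod>e\<in>?E. if e \<subseteq> ?L then \<rho> e (count (edges F) e) else h e) =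
     (\<Prod>e\<in>pairs n. \<rho> e (count (edges F) e)) * (\<Prod>e\<in>?E. if e \<subseteq> ?L then 1 else h e)" for h :: "nat set \<Rightarrow> real"
  proof -
    have "(\<Prod>e\<in>?E. if e \<subseteq> ?L then \<rho> e (count (edges F) e) else h e) =
      (\<Prod>e\<in>?E. (if e \<subseteq> ?L then \<rho> e (count (edges F) e) else 1) * (if e \<subseteq> ?L then 1 else h e))"
      by (intro prod.cong) auto
    also have "\<dots> = (\<Prod>e\<in>?E. if e \<subseteq> ?L then \<rho> e (count (edges F) e) else 1) *
       (\<Prod>e\<in>?E. if e \<subseteq> ?L then 1 else h e)" by (rule prod.distrib)
    also have "(\<Prod>e\<in>?E. if e \<subseteq> ?L then \<rho> e (count (edges F) e) else 1) =
       (\<Prod>e\<in>?E \<inter> pairs n. \<rho> e (count (edges F) e))"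
      using F by (intro prod.mono_neutral_cong_right) (auto simp: pairs_def multigraph_def)
    also have "\<dots> = (\<Prod>e\<in>pairs n. \<rho> e (count (edges F) e))"
    proof (rule prod.mono_neutral_left[OF finite_pairs], blast, rule ballI)
      fix e assume e: "e \<in> pairs n - ?E \<inter> pairs n"
      then have "e \<notin># edges F" by blast
      then have "count (edges F) e = 0" by (simp add: not_in_iff)
      then show "\<rho> e (count (edges F) e) = 1" using \<rho> e by simp
    qed
    finally show ?thesis .
  qed
  then show ?thesis by (simp add: rooted_hom_def sum_distrib_left mult.left_commute)
qed

locale random_model =
  fixes f :: "mgraph \<Rightarrow> real" and V :: "nat set" and \<alpha> :: "nat \<Rightarrow> real"
    and \<pi> :: "nat set \<Rightarrow> real \<Rightarrow> real" and B :: "real set"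
  assumes V: "finite V" and B: "finite B" and \<alpha>: "\<And>i. i \<in> V \<Longrightarrow> \<alpha> i > 0"
    and \<pi>: "\<And>i j b. i \<in> V \<Longrightarrow> j \<in> V \<Longrightarrow> b \<in> B \<Longrightarrow> \<pi> {i, j} b \<ge> 0"
    and \<pi>_sum: "\<And>i j. i \<in> V \<Longrightarrow> j \<in> V \<Longrightarrow> (\<Sum>b\<in>B. \<pi> {i, j} b) = 1"
    and model: "\<And>F. multigraph F \<Longrightarrow> f F = edge_hom V \<alpha> (\<lambda>A k. \<Sum>b\<in>B. \<pi> A b * b ^ k) F"
    and nontrivial: "\<exists>F. multigraph F \<and> f F \<noteq> 0"
begin

definition supp :: "nat set \<Rightarrow> real set" where "supp A = {b \<in> B. \<pi> A b \<noteq> 0}"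

abbreviation \<mu> :: "nat set \<Rightarrow> nat \<Rightarrow> real" where "\<mu> \<equiv> \<lambda>A k. \<Sum>b\<in>B. \<pi> A b * b ^ k"

lemma finite_supp: "finite (supp A)"
  using B by (simp add: supp_def)

lemma V_nonempty: "V \<noteq> {}"
proof
  assume "V = {}"
  obtain F where F: "multigraph F" "f F \<noteq> 0" using nontrivial by blast
  then have "nodes F \<rightarrow>\<^sub>E V = {}" using \<open>V = {}\<close> by (auto simp: PiE_eq_empty_iff multigraph_def)
  then show False using F model[OF F(1)] by (simp add: edge_hom_def)
qed

lemma \<mu>_supp: "\<mu> A k = (\<Sum>b\<in>supp A. \<pi> A b * b ^ k)"
  using B by (intro sum.mono_neutral_right) (auto simp: supp_def)

lemma image_pair:
  assumes "\<psi> \<in> {1..n} \<rightarrow>\<^sub>E V" "e \<in> pairs n"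
  obtains i j where "i \<in> V" "j \<in> V" "\<psi> ` e = {i, j}"
proof -
  obtain x y where "e = {x, y}" "x \<in> {1..n}" "y \<in> {1..n}"
    using assms(2) by (auto simp: pairs_def card_2_iff)
  then show thesis using that[of "\<psi> x" "\<psi> y"] PiE_mem[OF assms(1)] by simp
qed

lemma card_supp_pos: "i \<in> V \<Longrightarrow> j \<in> V \<Longrightarrow> card (supp {i, j}) \<ge> 1"
proof -
  assume ij: "i \<in> V" "j \<in> V"
  have "supp {i, j} \<noteq> {}"
    using \<mu>_supp[of "{i, j}" 0] \<pi>_sum[OF ij] by (intro notI) simp
  then show ?thesis using finite_supp by (simp add: Suc_le_eq card_gt_0_iff)
qed

definition W :: "nat \<Rightarrow> ((nat \<Rightarrow> nat) \<times> (nat set \<Rightarrow> real)) set" where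
  "W n = (SIGMA \<psi>:{1..n} \<rightarrow>\<^sub>E V. \<Pi>\<^sub>E e\<in>pairs n. supp (\<psi> ` e))"

definition weight :: "nat \<Rightarrow> (nat \<Rightarrow> nat) \<times> (nat set \<Rightarrow> real) \<Rightarrow> real" where
  "weight n p = (\<Prod>i\<in>{1..n}. \<alpha> (fst p i)) * (\<Prod>e\<in>pairs n. \<pi> (fst p ` e) (snd p e))"

definition state :: "nat \<Rightarrow> (nat \<Rightarrow> nat) \<times> (nat set \<Rightarrow> real) \<Rightarrow> mgraph \<Rightarrow> real" where
  "state n p = rooted_hom {1..n} V \<alpha> \<mu> (fst p) (\<lambda>e k. snd p e ^ k)"

lemma finite_W: "finite (W n)"
  unfolding W_def using V finite_pairs finite_supp by (intro finite_SigmaI finite_PiE) auto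

lemma card_W: "card (W n) = (\<Sum>\<psi>\<in>{1..n} \<rightarrow>\<^sub>E V. \<Prod>e\<in>pairs n. card (supp (\<psi> ` e)))"
  unfolding W_def using V finite_pairs finite_supp
  by (subst card_SigmaI) (auto simp: card_PiE intro!: finite_PiE)

lemma weight_pos:
  assumes "p \<in> W n"
  shows "weight n p > 0"
proof -
  obtain \<psi> c where p: "p = (\<psi>, c)" "\<psi> \<in> {1..n} \<rightarrow>\<^sub>E V" "c \<in> (\<Pi>\<^sub>E e\<in>pairs n. supp (\<psi> ` e))"
    using assms by (auto simp: W_def)
  have "\<pi> (\<psi> ` e) (c e) > 0" if e: "e \<in> pairs n" for e
  proof -
    have "c e \<in> supp (\<psi> ` e)" using p(3) e by (auto dest: PiE_mem)
    moreover obtain i j where "i \<in> V" "j \<in> V" "\<psi> ` e = {i, j}" using image_pair[OF p(2) e] .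
    ultimately show ?thesis using \<pi>[of i j "c e"] by (auto simp: supp_def less_le)
  qed
  moreover have "\<alpha> (\<psi> i) > 0" if "i \<in> {1..n}" for i using p(2) that \<alpha> by (auto dest: PiE_mem)
  ultimately show ?thesis unfolding weight_def p(1) by (auto intro!: mult_pos_pos prod_pos)
qed

text \<open>Moments are not multiplicative under gluing if the edge is random. Conditioning on the
  values \<open>c\<close> of the edges between labels repairs this, while edges with an unlabeled
  end are never shared by two glued graphs and can stay averaged.\<close>

lemma f_eq_sum_states:
  assumes F: "F \<in> labeled_graphs n"
  shows "f F = (\<Sum>p\<in>W n. weight n p * state n p F)"
proof -
  have mF: "multigraph F" and sub: "{1..n} \<subseteq> nodes F" using F by (auto simp: labeled_graphs_def)
  have "rooted_hom {1..n} V \<alpha> \<mu> \<psi> (\<lambda>e k. \<mu> (\<psi> ` e) k) F =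
     (\<Sum>c\<in>(\<Pi>\<^sub>E e\<in>pairs n. supp (\<psi> ` e)). (\<Prod>e\<in>pairs n. \<pi> (\<psi> ` e) (c e)) * state n (\<psi>, c) F)"
    if \<psi>: "\<psi> \<in> {1..n} \<rightarrow>\<^sub>E V" for \<psi>
  proof -
    let ?r = "rooted_hom {1..n} V \<alpha> \<mu> \<psi> (\<lambda>_ _. 1) F"
    have "\<mu> (\<psi> ` e) 0 = 1" if "e \<in> pairs n" for e
      using image_pair[OF \<psi> that] \<pi>_sum by (metis (no_types, lifting) mult.right_neutral power_0 sum.cong)
    then have "rooted_hom {1..n} V \<alpha> \<mu> \<psi> (\<lambda>e k. \<mu> (\<psi> ` e) k) F = (\<Prod>e\<in>pairs n. \<mu> (\<psi> ` e) (count (edges F) e)) * ?r"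
      by (rule rooted_hom_split[OF mF])
    also have "(\<Prod>e\<in>pairs n. \<mu> (\<psi> ` e) (count (edges F) e)) =
       (\<Sum>c\<in>(\<Pi>\<^sub>E e\<in>pairs n. supp (\<psi> ` e)). \<Prod>e\<in>pairs n. \<pi> (\<psi> ` e) (c e) * c e ^ count (edges F) e)"
      unfolding \<mu>_supp using finite_pairs finite_supp by (rule prod_sum_PiE)
    also have "\<dots> * ?r = (\<Sum>c\<in>(\<Pi>\<^sub>E e\<in>pairs n. supp (\<psi> ` e)). (\<Prod>e\<in>pairs n. \<pi> (\<psi> ` e) (c e)) * state n (\<psi>, c) F)"
      unfolding sum_distrib_right
    proof (intro sum.cong refl)
      fix c
      have "state n (\<psi>, c) F = (\<Prod>e\<in>pairs n. c e ^ count (edges F) e) * ?r"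
        unfolding state_def fst_conv snd_conv by (rule rooted_hom_split[OF mF]) simp
      then show "(\<Prod>e\<in>pairs n. \<pi> (\<psi> ` e) (c e) * c e ^ count (edges F) e) * ?r =
        (\<Prod>e\<in>pairs n. \<pi> (\<psi> ` e) (c e)) * state n (\<psi>, c) F"
        by (simp only: prod.distrib mult.assoc)
    qed
    finally show ?thesis .
  qed
  then have "f F = (\<Sum>\<psi>\<in>{1..n} \<rightarrow>\<^sub>E V. \<Sum>c\<in>(\<Pi>\<^sub>E e\<in>pairs n. supp (\<psi> ` e)). weight n (\<psi>, c) * state n (\<psi>, c) F)"
    unfolding model[OF mF] edge_hom_expand[OF sub mF]
    by (intro sum.cong refl) (simp only: sum_distrib_left weight_def fst_conv snd_conv mult.assoc)
  also have "\<dots> = (\<Sum>p\<in>W n. weight n p * state n p F)"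
    unfolding W_def using V finite_pairs finite_supp
    by (subst sum.Sigma) (auto intro!: finite_PiE simp: split_def)
  finally show ?thesis .
qed

lemma connection_matrix_eq:
  assumes "F \<in> labeled_graphs n" "G \<in> labeled_graphs n"
  shows "connection_matrix f n F G = (\<Sum>p\<in>W n. weight n p * (state n p F * state n p G))"
proof -
  have "state n p (glue n F G) = state n p F * state n p G" for p
    unfolding state_def by (rule rooted_hom_glue[OF assms]) (simp_all add: power_add)
  then show ?thesis unfolding connection_matrix_def
    using f_eq_sum_states[OF glue_in_labeled_graphs[OF assms]] by simp
qed

text \<open>States that give the same functional are merged before counting. The key is the identity
  for random weights and the tuple of twin representatives for deterministic ones.\<close>

lemma connection_rank_le:
  assumes "\<And>p F. p \<in> W n \<Longrightarrow> F \<in> labeled_graphs n \<Longrightarrow> state n p F = st (key p) F"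
  shows "connection_rank f n \<le> enat (card (key ` W n))"
  unfolding connection_rank_def
proof (rule matrix_rank_le)
  show "finite (key ` W n)" using finite_W by simp
  fix F G assume FG: "F \<in> labeled_graphs n" "G \<in> labeled_graphs n"
  have "connection_matrix f n F G = (\<Sum>p\<in>W n. weight n p * (st (key p) F * st (key p) G))"
    using connection_matrix_eq[OF FG] assms FG by simp
  also have "\<dots> = (\<Sum>k\<in>key ` W n. \<Sum>p\<in>{p \<in> W n. key p = k}. weight n p * (st (key p) F * st (key p) G))"
    using finite_W by (subst sum.group) auto
  also have "\<dots> = (\<Sum>k\<in>key ` W n. st k F * (\<Sum>p\<in>{p \<in> W n. key p = k}. weight n p * st k G))"
    by (simp add: sum_distrib_left mult.left_commute)
  finally show "connection_matrix f n F G =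
    (\<Sum>k\<in>key ` W n. st k F * (\<Sum>p\<in>{p \<in> W n. key p = k}. weight n p * st k G))" .
qed

text \<open>On fully labeled graphs a state is a monomial in the values \<open>c\<close>. Monomials
  separate distinct \<open>c\<close>, so there are as many graphs with independent evaluation
  vectors as there are values of \<open>c\<close>, and positivity of the weights carries this
  independence over to their rows.\<close>

lemma connection_rank_ge:
  assumes n: "n \<ge> 1"
  shows "enat (card (snd ` W n)) \<le> connection_rank f n"
proof -
  let ?P = "snd ` W n"
  let ?M = "{a. set_mset a \<subseteq> pairs n}"
  define ev where "ev a c = (\<Prod>e\<in>pairs n. c e ^ count a e)" for a :: "nat set multiset" and c :: "nat set \<Rightarrow> real"
  have "\<exists>S\<subseteq>?M. finite S \<and> card S = card ?P \<and>
    (\<forall>u. (\<forall>c\<in>?P. (\<Sum>a\<in>S. u a * ev a c) = 0) \<longrightarrow> (\<forall>a\<in>S. u a = 0))"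
  proof (rule independent_functions_on_points)
    show "finite ?P" using finite_W by simp
    fix v assume v: "\<forall>a\<in>?M. (\<Sum>c\<in>?P. v c * ev a c) = 0"
    show "\<forall>c\<in>?P. v c = 0"
    proof (rule monomials_separate_points[OF finite_pairs])
      show "finite ?P" using finite_W by simp
      show "?P \<subseteq> extensional (pairs n)" by (auto simp: W_def PiE_def)
      fix k :: "nat set \<Rightarrow> nat"
      define a where "a = (\<Sum>e\<in>pairs n. replicate_mset (k e) e)"
      have cnt: "count a e = k e" if "e \<in> pairs n" for e
        using that finite_pairs by (simp add: a_def count_sum)
      have "a \<in> ?M" using finite_pairs by (auto simp: a_def set_mset_sum split: if_splits)
      then have "(\<Sum>c\<in>?P. v c * ev a c) = 0" using v by blast
      then show "(\<Sum>c\<in>?P. v c * (\<Prod>e\<in>pairs n. c e ^ k e)) = 0" using cnt by (simp add: ev_def)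
    qed
  qed
  then obtain S where S: "S \<subseteq> ?M" "finite S" "card S = card ?P"
    "\<And>u. (\<forall>c\<in>?P. (\<Sum>a\<in>S. u a * ev a c) = 0) \<Longrightarrow> (\<forall>a\<in>S. u a = 0)" by blast
  have lab: "lgraph n a \<in> labeled_graphs n" if "a \<in> S" for a
    using that S(1) n by (intro lgraph_in_labeled_graphs) auto
  have st: "state n p (lgraph n a) = ev a (snd p)" if "a \<in> S" for a p
  proof -
    have "multigraph (lgraph n a)" using lab[OF that] by (simp add: labeled_graphs_def)
    then have "state n p (lgraph n a) = ev a (snd p) * rooted_hom {1..n} V \<alpha> \<mu> (fst p) (\<lambda>_ _. 1) (lgraph n a)"
      unfolding state_def ev_def by (subst rooted_hom_split) (simp_all add: lgraph_def)
    moreover have "rooted_hom {1..n} V \<alpha> \<mu> (fst p) (\<lambda>_ _. 1) (lgraph n a) = 1"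
    proof -
      have N: "nodes (lgraph n a) - {1..n} = {}" "edges (lgraph n a) = a" by (simp_all add: lgraph_def)
      have "e \<subseteq> {1..n}" if "e \<in># a" for e using that \<open>a \<in> S\<close> S(1) by (auto simp: pairs_def)
      then have "(\<Prod>e\<in>set_mset a. if e \<subseteq> {1..n} then 1 else h e) = 1" for h :: "nat set \<Rightarrow> real"
        by (intro prod.neutral) auto
      then show ?thesis unfolding rooted_hom_def N by simp
    qed
    ultimately show ?thesis by simp
  qed
  have inj: "inj_on (lgraph n) S" by (auto simp: inj_on_def lgraph_def)
  have "rows_independent (lgraph n ` S) (labeled_graphs n) (connection_matrix f n)"
    unfolding rows_independent_def
  proof (intro allI impI)
    fix u assume u: "\<forall>G\<in>labeled_graphs n. (\<Sum>F\<in>lgraph n ` S. u F * connection_matrix f n F G) = 0"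
    let ?u = "\<lambda>a. u (lgraph n a)"
    let ?s = "\<lambda>c. \<Sum>a\<in>S. ?u a * ev a c"
    \<comment> \<open>The dependency is paired with itself, which yields a positive combination of
      squares.\<close>
    have "0 = (\<Sum>b\<in>S. ?u b * (\<Sum>a\<in>S. ?u a * connection_matrix f n (lgraph n a) (lgraph n b)))"
      using u lab inj by (simp add: sum.reindex)
    also have "\<dots> = (\<Sum>b\<in>S. \<Sum>a\<in>S. \<Sum>p\<in>W n. weight n p * ((?u a * ev a (snd p)) * (?u b * ev b (snd p))))"
      unfolding sum_distrib_left
      by (intro sum.cong refl) (simp add: connection_matrix_eq lab st sum_distrib_left mult_ac)
    also have "\<dots> = (\<Sum>b\<in>S. \<Sum>p\<in>W n. \<Sum>a\<in>S. weight n p * ((?u a * ev a (snd p)) * (?u b * ev b (snd p))))"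
      by (intro sum.cong refl sum.swap)
    also have "\<dots> = (\<Sum>p\<in>W n. \<Sum>b\<in>S. \<Sum>a\<in>S. weight n p * ((?u a * ev a (snd p)) * (?u b * ev b (snd p))))"
      by (rule sum.swap)
    also have "\<dots> = (\<Sum>p\<in>W n. weight n p * (?s (snd p))\<^sup>2)"
      unfolding power2_eq_square sum_product
      by (subst (2) sum.swap) (simp only: sum_distrib_left)
    finally have "(\<Sum>p\<in>W n. weight n p * (?s (snd p))\<^sup>2) = 0" by simp
    then have "\<forall>p\<in>W n. weight n p * (?s (snd p))\<^sup>2 = 0"
      using weight_pos finite_W by (subst (asm) sum_nonneg_eq_0_iff) (auto simp: less_imp_le)
    then have "\<forall>c\<in>?P. ?s c = 0" using weight_pos by force
    from S(4)[OF this] show "\<forall>F\<in>lgraph n ` S. u F = 0" by auto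
  qed
  then have "enat (card (lgraph n ` S)) \<le> connection_rank f n"
    unfolding connection_rank_def matrix_rank_def using S(2) lab by (intro Sup_upper) blast
  then show ?thesis using inj S(3) by (simp add: card_image)
qed

end

section \<open>Rank growth: deterministic edge weights\<close>

text \<open>The upper bound makes the rank finite from \<open>start\<close> on, so the claim reduces
  to a sandwich of real sequences.\<close>

lemma enat_root_tendsto:
  assumes lo: "\<And>n. n \<ge> start \<Longrightarrow> enat (lo n) \<le> R n" and hi: "\<And>n. n \<ge> start \<Longrightarrow> R n \<le> enat (hi n)"
    and k: "\<And>n. n \<ge> start \<Longrightarrow> k n > 0"
    and "(\<lambda>n. root (k n) (real (lo n))) \<longlonglongrightarrow> c" "(\<lambda>n. root (k n) (real (hi n))) \<longlonglongrightarrow> c"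
  shows "(\<lambda>n. enat_root (k n) (R n)) \<longlonglongrightarrow> ereal c"
proof -
  define m where "m n = the_enat (R n)" for n
  have R: "R n = enat (m n)" if "n \<ge> start" for n
    using hi[OF that] by (cases "R n") (auto simp: m_def)
  have "(\<lambda>n. root (k n) (real (m n))) \<longlonglongrightarrow> c"
  proof (rule tendsto_sandwich[OF _ _ assms(4,5)])
    show "\<forall>\<^sub>F n in sequentially. root (k n) (real (lo n)) \<le> root (k n) (real (m n))"
      using eventually_ge_at_top[of start]
      by eventually_elim (use lo R k in \<open>force intro!: real_root_le_mono\<close>)
    show "\<forall>\<^sub>F n in sequentially. root (k n) (real (m n)) \<le> root (k n) (real (hi n))"
      using eventually_ge_at_top[of start]
      by eventually_elim (use hi R k in \<open>force intro!: real_root_le_mono\<close>)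
  qed
  then have "(\<lambda>n. ereal (root (k n) (real (m n)))) \<longlonglongrightarrow> ereal c" by (intro tendsto_intros)
  moreover have "\<forall>\<^sub>F n in sequentially. ereal (root (k n) (real (m n))) = enat_root (k n) (R n)"
    using eventually_ge_at_top[of start] by eventually_elim (simp add: R enat_root_def)
  ultimately show ?thesis by (rule Lim_transform_eventually)
qed

lemma root_eq_exp: "n > 0 \<Longrightarrow> x > 0 \<Longrightarrow> root n x = exp (ln x / n)"
  by (simp add: root_powr_inverse powr_def)

context random_model
begin

context
  assumes det: "\<And>i j. i \<in> V \<Longrightarrow> j \<in> V \<Longrightarrow> card (supp {i, j}) = 1"
begin

definition det_weight :: "nat set \<Rightarrow> real" where "det_weight A = the_elem (supp A)"

lemma supp_eq: "i \<in> V \<Longrightarrow> j \<in> V \<Longrightarrow> supp {i, j} = {det_weight {i, j}}"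
proof -
  assume "i \<in> V" "j \<in> V"
  then obtain b where "supp {i, j} = {b}" using det card_1_singletonE by blast
  then show ?thesis by (simp add: det_weight_def)
qed

lemma \<mu>_det: "i \<in> V \<Longrightarrow> j \<in> V \<Longrightarrow> \<mu> {i, j} k = det_weight {i, j} ^ k"
  using \<mu>_supp[of "{i, j}" 0] \<mu>_supp[of "{i, j}" k] \<pi>_sum[of i j] supp_eq[of i j] by simp

lemma \<mu>_det_image:
  assumes "\<And>i. i \<in> e \<Longrightarrow> m i \<in> V" "card e = 2"
  shows "\<mu> (m ` e) k = det_weight (m ` e) ^ k"
proof -
  obtain x y where "e = {x, y}" using assms(2) by (auto simp: card_2_iff)
  then show ?thesis using assms(1) \<mu>_det[of "m x" "m y"] by simp
qed

lemma f_eq_hom: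
  assumes F: "multigraph F"
  shows "f F = hom F \<lparr>wnodes = V, nodeweight = \<alpha>, edgeweight = \<lambda>i j. det_weight {i, j}\<rparr>"
  unfolding model[OF F] edge_hom_def hom_def wgraph.simps
proof (intro sum.cong refl arg_cong2[where f = "(*)"])
  fix \<phi> assume \<phi>: "\<phi> \<in> nodes F \<rightarrow>\<^sub>E V"
  have "(\<Prod>(i, j)\<in>{(i, j). i \<in> nodes F \<and> j \<in> nodes F \<and> i < j}. det_weight {\<phi> i, \<phi> j} ^ mult F i j) =
    (\<Prod>e\<in>set_mset (edges F). det_weight {Min (\<phi> ` e), Max (\<phi> ` e)} ^ count (edges F) e)"
    using \<phi> by (intro prod_ordered_pairs_eq_prod_edges[OF F, where V = V]) (auto simp: insert_commute)
  also have "\<dots> = (\<Prod>e\<in>set_mset (edges F). \<mu> (\<phi> ` e) (count (edges F) e))"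
  proof (intro prod.cong refl)
    fix e assume e: "e \<in># edges F"
    obtain i j where ij: "e = {i, j}" "i \<in> nodes F" "j \<in> nodes F"
      using F e by (elim multigraph_edgeE)
    have "\<phi> i \<in> V" "\<phi> j \<in> V" using \<phi> ij by auto
    then have "\<mu> (\<phi> ` e) (count (edges F) e) = det_weight (\<phi> ` e) ^ count (edges F) e" using ij \<mu>_det by simp
    moreover have "{Min (\<phi> ` e), Max (\<phi> ` e)} = \<phi> ` e" using ij by (auto simp: min_def max_def)
    ultimately show "det_weight {Min (\<phi> ` e), Max (\<phi> ` e)} ^ count (edges F) e = \<mu> (\<phi> ` e) (count (edges F) e)"
      by simp
  qed
  finally show "(\<Prod>e\<in>set_mset (edges F). \<mu> (\<phi> ` e) (count (edges F) e)) =
    (\<Prod>(i, j)\<in>{(i, j). i \<in> nodes F \<and> j \<in> nodes F \<and> i < j}. det_weight {\<phi> i, \<phi> j} ^ mult F i j)" by simp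
qed

text \<open>The growth rate of the rank is the number of twin classes, not the number of nodes.\<close>

definition twin :: "nat \<Rightarrow> nat \<Rightarrow> bool" where "twin i j \<longleftrightarrow> (\<forall>a\<in>V. det_weight {a, i} = det_weight {a, j})"

definition rep :: "nat \<Rightarrow> nat" where "rep i = (LEAST j. j \<in> V \<and> twin i j)"

lemma rep: "i \<in> V \<Longrightarrow> rep i \<in> V" "i \<in> V \<Longrightarrow> twin i (rep i)"
proof -
  assume "i \<in> V"
  moreover have "twin i i" by (simp add: twin_def)
  ultimately have "rep i \<in> V \<and> twin i (rep i)"
    unfolding rep_def by (rule LeastI[where P = "\<lambda>j. j \<in> V \<and> twin i j", OF conjI])
  then show "rep i \<in> V" "twin i (rep i)" by auto
qed

lemma rep_image: "x \<in> rep ` V \<Longrightarrow> x \<in> V"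
  by (erule imageE) (simp add: rep(1))

lemma rep_cong: "twin i j \<Longrightarrow> rep i = rep j"
  by (simp add: rep_def twin_def)

lemma rep_rep: "i \<in> V \<Longrightarrow> rep (rep i) = rep i"
  using rep_cong[OF rep(2)] by simp

lemma det_weight_rep: "i \<in> V \<Longrightarrow> j \<in> V \<Longrightarrow> det_weight {rep i, rep j} = det_weight {i, j}"
proof -
  assume ij: "i \<in> V" "j \<in> V"
  have "det_weight {i, j} = det_weight {i, rep j}" using rep(2)[OF ij(2)] ij(1) by (simp add: twin_def)
  moreover have "det_weight {rep j, i} = det_weight {rep j, rep i}"
    using rep(2)[OF ij(1)] rep(1)[OF ij(2)] by (simp add: twin_def)
  ultimately show ?thesis by (simp add: insert_commute)
qed

lemma det_weight_rep_image:
  assumes "\<And>i. i \<in> e \<Longrightarrow> m i \<in> V" "\<And>i. i \<in> e \<Longrightarrow> m' i \<in> V" "\<And>i. i \<in> e \<Longrightarrow> rep (m i) = rep (m' i)" "card e = 2"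
  shows "det_weight (m ` e) = det_weight (m' ` e)"
proof -
  obtain x y where "e = {x, y}" using assms(4) by (auto simp: card_2_iff)
  then show ?thesis using assms det_weight_rep[of "m x" "m y"] det_weight_rep[of "m' x" "m' y"] by simp
qed

text \<open>With deterministic weights the values \<open>c\<close> are forced by the images of the
  labels, and replacing an image by its twin representative changes no edge weight.\<close>

lemma state_rep:
  assumes p: "p \<in> W n" and F: "F \<in> labeled_graphs n"
  shows "state n p F = rooted_hom {1..n} V \<alpha> \<mu> (restrict (rep \<circ> fst p) {1..n})
    (\<lambda>e k. det_weight ((restrict (rep \<circ> fst p) {1..n}) ` e) ^ k) F"
proof -
  obtain \<psi> c where pc: "p = (\<psi>, c)" "\<psi> \<in> {1..n} \<rightarrow>\<^sub>E V" "c \<in> (\<Pi>\<^sub>E e\<in>pairs n. supp (\<psi> ` e))"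
    using p by (auto simp: W_def)
  let ?\<psi> = "restrict (rep \<circ> \<psi>) {1..n}"
  have \<psi>V: "\<psi> i \<in> V" if "i \<in> {1..n}" for i using pc(2) that by (rule PiE_mem)
  have \<psi>V': "?\<psi> i \<in> V" "rep (\<psi> i) = rep (?\<psi> i)" if "i \<in> {1..n}" for i
    using that rep(1)[OF \<psi>V[OF that]] rep_rep[OF \<psi>V[OF that]] by auto
  have mF: "multigraph F" using F by (simp add: labeled_graphs_def)
  have "state n (\<psi>, c) F = rooted_hom {1..n} V \<alpha> \<mu> ?\<psi> (\<lambda>e k. det_weight (?\<psi> ` e) ^ k) F"
    unfolding state_def rooted_hom_def fst_conv snd_conv
  proof (intro sum.cong prod.cong arg_cong2[where f = "(*)"] refl)
    fix \<phi> e assume \<phi>: "\<phi> \<in> (nodes F - {1..n}) \<rightarrow>\<^sub>E V" and e: "e \<in># edges F"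
    have e2: "card e = 2" "e \<subseteq> nodes F" using mF e by (auto simp: multigraph_def)
    show "(if e \<subseteq> {1..n} then c e ^ count (edges F) e
          else \<mu> ((\<lambda>i. if i \<in> {1..n} then \<psi> i else \<phi> i) ` e) (count (edges F) e)) =
      (if e \<subseteq> {1..n} then det_weight (?\<psi> ` e) ^ count (edges F) e
          else \<mu> ((\<lambda>i. if i \<in> {1..n} then ?\<psi> i else \<phi> i) ` e) (count (edges F) e))"
    proof (cases "e \<subseteq> {1..n}")
      case True
      then have ep: "e \<in> pairs n" using e2 by (simp add: pairs_def)
      obtain i j where ij: "i \<in> V" "j \<in> V" "\<psi> ` e = {i, j}" using image_pair[OF pc(2) ep] .
      have "c e \<in> supp (\<psi> ` e)" using pc(3) ep by (rule PiE_mem)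
      then have "c e = det_weight (\<psi> ` e)" using supp_eq ij by simp
      also have "\<dots> = det_weight (?\<psi> ` e)"
        by (rule det_weight_rep_image[OF _ _ _ e2(1)]) (use True \<psi>V \<psi>V' in blast)+
      finally show ?thesis using True by simp
    next
      case False
      let ?m = "\<lambda>i. if i \<in> {1..n} then \<psi> i else \<phi> i"
      let ?m' = "\<lambda>i. if i \<in> {1..n} then ?\<psi> i else \<phi> i"
      have m: "?m i \<in> V" "?m' i \<in> V" "rep (?m i) = rep (?m' i)" if "i \<in> e" for i
      proof -
        have "\<phi> i \<in> V" if "i \<notin> {1..n}" using \<phi> e2 \<open>i \<in> e\<close> that by (intro PiE_mem[OF \<phi>]) auto
        then show "?m i \<in> V" "?m' i \<in> V" "rep (?m i) = rep (?m' i)" using \<psi>V \<psi>V' by presburger+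
      qed
      have "det_weight (?m ` e) = det_weight (?m' ` e)" by (rule det_weight_rep_image[OF m e2(1)])
      then have "\<mu> (?m ` e) k = \<mu> (?m' ` e) k" for k
        using \<mu>_det_image[of e ?m, OF m(1) e2(1)] \<mu>_det_image[of e ?m', OF m(2) e2(1)] by simp
      then show ?thesis unfolding if_not_P[OF False] .
    qed
  qed
  then show ?thesis by (simp only: pc(1) fst_conv)
qed

lemma rank_upper_det: "connection_rank f n \<le> enat (card (rep ` V) ^ n)"
proof -
  let ?key = "\<lambda>p. restrict (rep \<circ> fst p) {1..n}"
  have "connection_rank f n \<le> enat (card (?key ` W n))"
    by (rule connection_rank_le) (rule state_rep)
  also have "card (?key ` W n) \<le> card ({1..n} \<rightarrow>\<^sub>E rep ` V)"
  proof (rule card_mono)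
    show "?key ` W n \<subseteq> {1..n} \<rightarrow>\<^sub>E rep ` V"
    proof (rule image_subsetI)
      fix p assume "p \<in> W n"
      then have "fst p \<in> {1..n} \<rightarrow>\<^sub>E V" by (auto simp: W_def)
      then show "?key p \<in> {1..n} \<rightarrow>\<^sub>E rep ` V" by (simp add: restrict_PiE_iff PiE_iff)
    qed
  qed (use V in \<open>auto intro: finite_PiE\<close>)
  finally show ?thesis by (simp add: card_PiE)
qed

text \<open>The first \<open>r\<close> labels are placed on all twin representatives, the other
  \<open>n - r\<close> labels freely on them. The values of the edges from the first
  \<open>r\<close> labels to a further label determine its row of edge weights, hence its twin
  class, so all these placements give different \<open>c\<close>.\<close>

lemma rank_lower_det:
  defines "r \<equiv> card (rep ` V)"
  assumes n: "n \<ge> r" "n \<ge> 1"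
  shows "enat (r ^ (n - r)) \<le> connection_rank f n"
proof -
  have "finite (rep ` V)" using V by simp
  from finite_same_card_bij[of "{1..r}" "rep ` V"] this obtain h where h: "bij_betw h {1..r} (rep ` V)"
    by (auto simp: r_def)
  have hV: "h l \<in> V" if "l \<in> {1..r}" for l
    using bij_betwE[OF h] that by (intro rep_image) simp
  let ?X = "{r + 1..n} \<rightarrow>\<^sub>E rep ` V"
  define ps where "ps \<eta> = (\<lambda>i. if i \<in> {1..r} then h i else if i \<in> {1..n} then \<eta> i else undefined)" for \<eta> :: "nat \<Rightarrow> nat"
  define cs where "cs \<eta> = restrict (\<lambda>e. det_weight (ps \<eta> ` e)) (pairs n)" for \<eta>
  have psV: "ps \<eta> \<in> {1..n} \<rightarrow>\<^sub>E V" if "\<eta> \<in> ?X" for \<eta>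
  proof (rule PiE_I)
    fix i assume "i \<in> {1..n}"
    moreover have "\<eta> i \<in> V" if "i \<in> {r + 1..n}" using PiE_mem[OF \<open>\<eta> \<in> ?X\<close> that] by (rule rep_image)
    ultimately show "ps \<eta> i \<in> V" using hV by (auto simp: ps_def)
  qed (use n in \<open>auto simp: ps_def\<close>)
  have "cs \<eta> \<in> snd ` W n" if "\<eta> \<in> ?X" for \<eta>
  proof -
    have "det_weight (ps \<eta> ` e) \<in> supp (ps \<eta> ` e)" if e: "e \<in> pairs n" for e
    proof -
      obtain i j where "i \<in> V" "j \<in> V" "ps \<eta> ` e = {i, j}" using image_pair[OF psV[OF \<open>\<eta> \<in> ?X\<close>] e] .
      then show ?thesis using supp_eq by simp
    qed
    then have "(ps \<eta>, cs \<eta>) \<in> W n" using psV[OF that] by (auto simp: W_def cs_def)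
    then show ?thesis by force
  qed
  moreover have "inj_on cs ?X"
  proof (rule inj_onI)
    fix \<eta> \<eta>' assume X: "\<eta> \<in> ?X" "\<eta>' \<in> ?X" and eq: "cs \<eta> = cs \<eta>'"
    show "\<eta> = \<eta>'"
    proof (rule extensionalityI[of _ "{r + 1..n}"])
      fix i assume i: "i \<in> {r + 1..n}"
      have R: "\<eta> i \<in> rep ` V" "\<eta>' i \<in> rep ` V" using PiE_mem[OF X(1) i] PiE_mem[OF X(2) i] by auto
      then have iV: "\<eta> i \<in> V" "\<eta>' i \<in> V" by (simp_all only: rep_image)
      have "det_weight {a, \<eta> i} = det_weight {a, \<eta>' i}" if a: "a \<in> V" for a
      proof -
        have "rep a \<in> h ` {1..r}" using h a by (auto simp: bij_betw_def)
        then obtain l where l: "l \<in> {1..r}" "h l = rep a" by auto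
        have "{l, i} \<in> pairs n" using l i by (auto simp: pairs_def)
        then have "det_weight (ps \<eta> ` {l, i}) = det_weight (ps \<eta>' ` {l, i})" using fun_cong[OF eq, of "{l, i}"] by (simp add: cs_def)
        then have e: "det_weight {rep a, \<eta> i} = det_weight {rep a, \<eta>' i}" using l i by (simp add: ps_def insert_commute)
        have "det_weight {rep a, x} = det_weight {a, x}" if "x \<in> V" for x
        proof -
          have "det_weight {x, a} = det_weight {x, rep a}" using rep(2)[OF a] that by (simp add: twin_def)
          then show ?thesis unfolding insert_commute[of "rep a" x] insert_commute[of a x] by simp
        qed
        then show ?thesis using e iV by simp
      qed
      then have eqr: "rep (\<eta> i) = rep (\<eta>' i)" by (intro rep_cong) (simp add: twin_def)
      have fixed: "rep x = x" if "x \<in> rep ` V" for x using that by (elim imageE) (simp add: rep_rep)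
      show "\<eta> i = \<eta>' i" using eqr unfolding fixed[OF R(1)] fixed[OF R(2)] .
    qed (use X in \<open>auto simp: PiE_def\<close>)
  qed
  ultimately have le: "card ?X \<le> card (snd ` W n)"
    using finite_W by (intro card_inj_on_le[of cs]) auto
  have "enat (r ^ (n - r)) = enat (card ?X)" by (simp add: card_PiE r_def)
  also have "\<dots> \<le> enat (card (snd ` W n))" using le by simp
  also note connection_rank_ge[OF n(2)]
  finally show ?thesis .
qed

lemma rank_growth_det:
  "\<exists>c::real. c \<ge> 1 \<and> (\<lambda>n. enat_root n (connection_rank f n)) \<longlonglongrightarrow> ereal c"
proof -
  define r where "r = card (rep ` V)"
  have r: "r \<ge> 1" using V V_nonempty by (simp add: r_def Suc_le_eq card_gt_0_iff)
  have "(\<lambda>n. enat_root n (connection_rank f n)) \<longlonglongrightarrow> ereal (real r)"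
  proof (rule enat_root_tendsto[where lo = "\<lambda>n. r ^ (n - r)" and hi = "\<lambda>n. r ^ n" and start = "max r 1"])
    have "(\<lambda>n. exp ((real n - real r) / real n * ln r)) \<longlonglongrightarrow> exp (1 * ln r)"
      by (intro tendsto_intros) real_asymp
    then have "(\<lambda>n. exp ((real n - real r) / real n * ln r)) \<longlonglongrightarrow> real r" using r by simp
    moreover have "\<forall>\<^sub>F n in sequentially. exp ((real n - real r) / real n * ln r) = root n (real (r ^ (n - r)))"
      using eventually_ge_at_top[of "max r 1"]
    proof eventually_elim
      case (elim n)
      then have "root n (real (r ^ (n - r))) = exp (ln (real r ^ (n - r)) / n)"
        using r by (subst root_eq_exp) auto
      also have "\<dots> = exp ((real n - real r) / real n * ln r)"
        using r elim by (simp add: ln_realpow of_nat_diff)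
      finally show ?case by simp
    qed
    ultimately show "(\<lambda>n. root n (real (r ^ (n - r)))) \<longlonglongrightarrow> real r" by (rule Lim_transform_eventually)
    have "\<forall>\<^sub>F n in sequentially. real r = root n (real (r ^ n))"
      using eventually_ge_at_top[of 1] by eventually_elim (simp add: real_root_power_cancel)
    then show "(\<lambda>n. root n (real (r ^ n))) \<longlonglongrightarrow> real r"
      by (rule Lim_transform_eventually[OF tendsto_const])
  qed (use rank_lower_det rank_upper_det in \<open>auto simp: r_def\<close>)
  then show ?thesis using r by (intro exI[of _ "real r"]) simp
qed

end

end

section \<open>Rank growth: random edge weights\<close>

context random_model
begin

definition dprod :: "nat set \<Rightarrow> (nat \<Rightarrow> nat) \<Rightarrow> nat" where
  "dprod U \<psi> = (\<Prod>e\<in>{e. e \<subseteq> U \<and> card e = 2}. card (supp (\<psi> ` e)))"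

definition maxprod :: "nat \<Rightarrow> nat" where
  "maxprod n = Max (dprod {1..n} ` ({1..n} \<rightarrow>\<^sub>E V))"

lemma finite_subsets2: "finite U \<Longrightarrow> finite {e. e \<subseteq> U \<and> card e = 2}"
  by (rule finite_subset[of _ "Pow U"]) auto

text \<open>Transport along a bijection with \<open>{1..card U}\<close>, so that labels can be
  deleted from an arbitrary position.\<close>

lemma dprod_le_maxprod:
  assumes U: "finite U" and \<psi>: "\<And>i. i \<in> U \<Longrightarrow> \<psi> i \<in> V"
  shows "dprod U \<psi> \<le> maxprod (card U)"
proof -
  let ?n = "card U"
  obtain h where h: "bij_betw h {1..?n} U"
    using finite_same_card_bij[of "{1..?n}" U] U by auto
  let ?\<psi> = "restrict (\<psi> \<circ> h) {1..?n}"
  have inj: "inj_on h {1..?n}" and im: "h ` {1..?n} = U" using h by (auto simp: bij_betw_def)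
  have "dprod U \<psi> = dprod {1..?n} ?\<psi>"
    unfolding dprod_def
  proof (rule prod.reindex_cong[where l = "(`) h"])
    show "inj_on ((`) h) {e. e \<subseteq> {1..?n} \<and> card e = 2}"
      by (rule inj_onI) (use inj_on_image_eq_iff[OF inj] in auto)
    show "{e. e \<subseteq> U \<and> card e = 2} = (`) h ` {e. e \<subseteq> {1..?n} \<and> card e = 2}"
    proof (intro set_eqI iffI)
      fix e assume "e \<in> {e. e \<subseteq> U \<and> card e = 2}"
      then have e: "e \<subseteq> h ` {1..?n}" "card e = 2" unfolding im by auto
      then obtain e' where e': "e' \<subseteq> {1..?n}" "e = h ` e'" by (auto simp: subset_image_iff)
      then have "card e' = 2" using e inj by (metis card_image inj_on_subset)
      then show "e \<in> (`) h ` {e. e \<subseteq> {1..?n} \<and> card e = 2}" using e' by auto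
    next
      fix e assume "e \<in> (`) h ` {e. e \<subseteq> {1..?n} \<and> card e = 2}"
      then obtain e' where e': "e' \<subseteq> {1..?n}" "card e' = 2" "e = h ` e'" by auto
      then show "e \<in> {e. e \<subseteq> U \<and> card e = 2}"
        using im card_image[OF inj_on_subset[OF inj e'(1)]] by auto
    qed
    fix e assume "e \<in> {e. e \<subseteq> {1..?n} \<and> card e = 2}"
    then have "\<psi> ` h ` e = ?\<psi> ` e" unfolding image_image by (intro image_cong) auto
    then show "card (supp (\<psi> ` h ` e)) = card (supp (?\<psi> ` e))" by simp
  qed
  also have "\<dots> \<le> maxprod ?n"
    unfolding maxprod_def
  proof (rule Max_ge)
    show "finite (dprod {1..?n} ` ({1..?n} \<rightarrow>\<^sub>E V))" using V by (auto intro: finite_PiE)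
    have "h i \<in> U" if "i \<in> {1..?n}" for i using im that by blast
    then show "dprod {1..?n} ?\<psi> \<in> dprod {1..?n} ` ({1..?n} \<rightarrow>\<^sub>E V)"
      using \<psi> by (intro imageI, subst restrict_PiE_iff) auto
  qed
  finally show ?thesis .
qed

lemma maxprod_attained: "\<exists>\<psi>\<in>{1..n} \<rightarrow>\<^sub>E V. maxprod n = dprod {1..n} \<psi>"
proof -
  have "maxprod n \<in> dprod {1..n} ` ({1..n} \<rightarrow>\<^sub>E V)"
    unfolding maxprod_def using V V_nonempty
    by (intro Max_in) (auto intro: finite_PiE simp: PiE_eq_empty_iff)
  then show ?thesis by auto
qed

lemma dprod_pos:
  assumes \<psi>: "\<psi> \<in> {1..n} \<rightarrow>\<^sub>E V" and e: "e \<in> pairs n"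
  shows "card (supp (\<psi> ` e)) \<ge> 1"
proof -
  obtain i j where "i \<in> V" "j \<in> V" "\<psi> ` e = {i, j}" using image_pair[OF \<psi> e] .
  then show ?thesis using card_supp_pos by simp
qed

lemma maxprod_pos: "maxprod n \<ge> 1"
proof -
  obtain \<psi> where \<psi>: "\<psi> \<in> {1..n} \<rightarrow>\<^sub>E V" "maxprod n = dprod {1..n} \<psi>" using maxprod_attained by blast
  then show ?thesis using dprod_pos[OF \<psi>(1)] unfolding \<psi>(2) dprod_def pairs_def
    by (intro prod_ge_1) auto
qed

lemma rank_upper: "connection_rank f n \<le> enat (card V ^ n * maxprod n)"
proof -
  have "connection_rank f n \<le> enat (card ((\<lambda>p. p) ` W n))"
    by (rule connection_rank_le) simp
  also have "card ((\<lambda>p. p) ` W n) = (\<Sum>\<psi>\<in>{1..n} \<rightarrow>\<^sub>E V. dprod {1..n} \<psi>)"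
    by (simp add: card_W dprod_def pairs_def)
  also have "\<dots> \<le> (\<Sum>\<psi>\<in>{1..n} \<rightarrow>\<^sub>E V. maxprod n)"
  proof (rule sum_mono)
    fix \<psi> assume "\<psi> \<in> {1..n} \<rightarrow>\<^sub>E V"
    then have "dprod {1..n} \<psi> \<le> maxprod (card {1..n})"
      by (intro dprod_le_maxprod[OF finite_atLeastAtMost]) (rule PiE_mem)
    then show "dprod {1..n} \<psi> \<le> maxprod n" by simp
  qed
  finally show ?thesis by (simp add: card_PiE)
qed

lemma rank_lower:
  assumes "n \<ge> 1"
  shows "enat (maxprod n) \<le> connection_rank f n"
proof -
  obtain \<psi> where \<psi>: "\<psi> \<in> {1..n} \<rightarrow>\<^sub>E V" "maxprod n = dprod {1..n} \<psi>" using maxprod_attained by blast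
  have "(\<Pi>\<^sub>E e\<in>pairs n. supp (\<psi> ` e)) \<subseteq> snd ` W n"
  proof
    fix c assume "c \<in> (\<Pi>\<^sub>E e\<in>pairs n. supp (\<psi> ` e))"
    then have "(\<psi>, c) \<in> W n" using \<psi> by (simp add: W_def)
    then show "c \<in> snd ` W n" by force
  qed
  then have "card (\<Pi>\<^sub>E e\<in>pairs n. supp (\<psi> ` e)) \<le> card (snd ` W n)"
    using finite_W by (intro card_mono) auto
  moreover have "card (\<Pi>\<^sub>E e\<in>pairs n. supp (\<psi> ` e)) = maxprod n"
    using card_PiE[OF finite_pairs] by (simp add: \<psi>(2) dprod_def pairs_def)
  ultimately have "enat (maxprod n) \<le> enat (card (snd ` W n))" by simp
  also note connection_rank_ge[OF assms]
  finally show ?thesis .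
qed

text \<open>Deleting each of the \<open>n + 1\<close> nodes in turn covers every pair \<open>n - 1\<close> times.\<close>

lemma maxprod_Suc: "maxprod (Suc n) ^ (n - 1) \<le> maxprod n ^ Suc n"
proof -
  let ?U = "{1..Suc n}"
  obtain \<psi> where \<psi>: "\<psi> \<in> ?U \<rightarrow>\<^sub>E V" "maxprod (Suc n) = dprod ?U \<psi>" using maxprod_attained by blast
  let ?E = "{e. e \<subseteq> ?U \<and> card e = 2}"
  let ?d = "\<lambda>e. card (supp (\<psi> ` e))"
  have "(\<Prod>i\<in>?U. dprod (?U - {i}) \<psi>) = (\<Prod>i\<in>?U. \<Prod>e\<in>?E. if i \<in> e then 1 else ?d e)"
  proof (intro prod.cong refl)
    fix i
    show "dprod (?U - {i}) \<psi> = (\<Prod>e\<in>?E. if i \<in> e then 1 else ?d e)"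
      unfolding dprod_def
      by (rule prod.mono_neutral_cong_left) (auto intro!: finite_subsets2)
  qed
  also have "\<dots> = (\<Prod>e\<in>?E. \<Prod>i\<in>?U. if i \<in> e then 1 else ?d e)" by (rule prod.swap)
  also have "\<dots> = (\<Prod>e\<in>?E. ?d e ^ (n - 1))"
  proof (intro prod.cong refl)
    fix e assume e: "e \<in> ?E"
    have "(\<Prod>i\<in>?U. if i \<in> e then 1 else ?d e) = (\<Prod>i\<in>?U - e. ?d e)"
      by (rule prod.mono_neutral_cong_right) auto
    moreover have "card (?U - e) = n - 1"
      using e finite_subset[of e ?U] by (subst card_Diff_subset) auto
    ultimately show "(\<Prod>i\<in>?U. if i \<in> e then 1 else ?d e) = ?d e ^ (n - 1)" by simp
  qed
  also have "\<dots> = maxprod (Suc n) ^ (n - 1)" by (simp add: \<psi>(2) dprod_def prod_power_distrib)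
  finally have "maxprod (Suc n) ^ (n - 1) = (\<Prod>i\<in>?U. dprod (?U - {i}) \<psi>)" by simp
  also have "\<dots> \<le> (\<Prod>i\<in>?U. maxprod n)"
  proof (intro prod_mono conjI)
    fix i assume i: "i \<in> ?U"
    have "dprod (?U - {i}) \<psi> \<le> maxprod (card (?U - {i}))"
      by (rule dprod_le_maxprod) (simp, rule PiE_mem[OF \<psi>(1)], blast)
    then show "dprod (?U - {i}) \<psi> \<le> maxprod n" using i by simp
  qed simp
  finally show ?thesis by simp
qed

text \<open>Half of the labels are placed on \<open>i\<close> and half on \<open>j\<close>; each of
  the \<open>h * h\<close> pairs across has at least two possible values. The argument covers
  \<open>i = j\<close>.\<close>

lemma maxprod_double:
  assumes ij: "i \<in> V" "j \<in> V" "card (supp {i, j}) \<ge> 2"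
  shows "maxprod (2 * h) \<ge> 2 ^ (h * h)"
proof -
  let ?n = "2 * h"
  define \<psi> where "\<psi> l = (if l \<le> h then i else j)" for l :: nat
  let ?c = "\<lambda>(l, l'). {l, l' :: nat}"
  let ?X = "?c ` ({1..h} \<times> {h + 1..?n})"
  have inj: "inj_on ?c ({1..h} \<times> {h + 1..?n})"
    by (rule inj_onI) (auto simp: doubleton_eq_iff)
  have sub: "?X \<subseteq> {e. e \<subseteq> {1..?n} \<and> card e = 2}" by auto
  have "2 ^ (h * h) = (\<Prod>e\<in>?X. 2::nat)" using inj by (simp add: card_image)
  also have "\<dots> \<le> (\<Prod>e\<in>?X. card (supp (\<psi> ` e)))"
  proof (intro prod_mono conjI)
    fix e assume "e \<in> ?X"
    then have "\<psi> ` e = {i, j}" by (auto simp: \<psi>_def)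
    then show "2 \<le> card (supp (\<psi> ` e))" using ij by simp
  qed simp
  also have "\<dots> \<le> dprod {1..?n} \<psi>"
  proof -
    let ?S = "{e. e \<subseteq> {1..?n} \<and> card e = 2}"
    have "dprod {1..?n} \<psi> = (\<Prod>e\<in>?S - ?X. card (supp (\<psi> ` e))) * (\<Prod>e\<in>?X. card (supp (\<psi> ` e)))"
      unfolding dprod_def by (rule prod.subset_diff[OF sub finite_subsets2]) simp
    moreover have "(\<Prod>e\<in>?S - ?X. card (supp (\<psi> ` e))) \<ge> 1"
    proof (rule prod_ge_1)
      fix e assume "e \<in> ?S - ?X"
      then obtain x y where "e = {x, y}" by (auto simp: card_2_iff)
      then have "\<psi> ` e = {\<psi> x, \<psi> y}" "\<psi> x \<in> V" "\<psi> y \<in> V" using ij by (auto simp: \<psi>_def)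
      then show "1 \<le> card (supp (\<psi> ` e))" using card_supp_pos[of "\<psi> x" "\<psi> y"] by simp
    qed
    ultimately show ?thesis by simp
  qed
  also have "\<dots> \<le> maxprod (card {1..?n})"
    using ij by (intro dprod_le_maxprod) (auto simp: \<psi>_def)
  finally show ?thesis by simp
qed

text \<open>The logarithm of \<open>maxprod\<close> per pair of labels is decreasing by
  \<open>maxprod_Suc\<close> and bounded away from 0 by \<open>maxprod_double\<close>, so it has a
  positive limit. The factor \<open>card V ^ n\<close> between the two rank bounds disappears in a
  root of order \<open>n ^ 2\<close>.\<close>

lemma rank_growth_random:
  assumes ij: "i \<in> V" "j \<in> V" "card (supp {i, j}) \<ge> 2"
  shows "\<exists>c::real. c > 1 \<and> (\<lambda>n. enat_root (n ^ 2) (connection_rank f n)) \<longlonglongrightarrow> ereal c"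
proof -
  define L where "L n = ln (real (maxprod n))" for n
  have Gpos: "real (maxprod n) > 0" for n using maxprod_pos[of n] by simp
  have L0: "L n \<ge> 0" for n using maxprod_pos[of n] by (simp add: L_def)
  \<comment> \<open>Half the logarithm per pair on \<open>n + 2\<close> labels; the shift by 2 keeps
    the denominator positive.\<close>
  define x where "x n = L (n + 2) / (real (n + 2) * real (n + 1))" for n
  have "decseq x"
  proof (rule decseq_SucI)
    fix n
    have "real (maxprod (Suc (n + 2))) ^ (n + 2 - 1) \<le> real (maxprod (n + 2)) ^ Suc (n + 2)"
      using maxprod_Suc[of "n + 2"] by (metis of_nat_le_iff of_nat_power)
    then have "ln (real (maxprod (Suc (n + 2))) ^ (n + 2 - 1)) \<le> ln (real (maxprod (n + 2)) ^ Suc (n + 2))"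
      using Gpos by (subst ln_le_cancel_iff) auto
    moreover have "ln (real (maxprod (Suc (n + 2))) ^ (n + 2 - 1)) = real (n + 1) * L (Suc (n + 2))"
      using Gpos by (subst ln_realpow) (auto simp: L_def numeral_3_eq_3)
    moreover have "ln (real (maxprod (n + 2)) ^ Suc (n + 2)) = real (n + 3) * L (n + 2)"
      using Gpos by (subst ln_realpow) (auto simp: L_def numeral_3_eq_3)
    ultimately have "real (n + 1) * L (Suc (n + 2)) \<le> real (n + 3) * L (n + 2)" by simp
    then show "x (Suc n) \<le> x n" by (simp add: x_def divide_simps) (simp add: algebra_simps)
  qed
  moreover have "0 \<le> x n" for n using L0 by (simp add: x_def)
  ultimately obtain l where l: "x \<longlonglongrightarrow> l" using decseq_convergent by blast
  \<comment> \<open>On even sizes the crossing pairs are \<open>h * h\<close> against a denominator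
    below the square of \<open>2 * h\<close>, hence the 4.\<close>
  have "l \<ge> ln 2 / 4"
  proof (rule LIMSEQ_le_const[OF LIMSEQ_subseq_LIMSEQ[OF l, of "\<lambda>h. 2 * h"]])
    show "strict_mono (\<lambda>h::nat. 2 * h)" by (simp add: strict_mono_def)
    have "ln 2 / 4 \<le> x (2 * h)" for h
    proof -
      have "real (2 ^ ((h + 1) * (h + 1))) \<le> real (maxprod (2 * (h + 1)))"
        using maxprod_double[OF ij, of "h + 1"] by (subst of_nat_le_iff) simp
      then have "ln (real (2 ^ ((h + 1) * (h + 1)))) \<le> L (2 * h + 2)"
        unfolding L_def using Gpos by (subst ln_le_cancel_iff) auto
      moreover have "ln (real (2 ^ k)) = real k * ln 2" for k by (simp add: ln_realpow)
      ultimately have le: "real ((h + 1) * (h + 1)) * ln 2 \<le> L (2 * h + 2)" by (simp only:)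
      have "ln 2 / 4 * (real (2 * h + 2) * real (2 * h + 1)) \<le> ln 2 / 4 * (real (2 * h + 2) * real (2 * h + 2))"
        by (intro mult_left_mono) auto
      also have "\<dots> = real ((h + 1) * (h + 1)) * ln 2" by (simp add: algebra_simps)
      also note le
      finally show ?thesis by (simp add: x_def pos_le_divide_eq)
    qed
    then show "\<exists>N. \<forall>n\<ge>N. ln 2 / 4 \<le> (x \<circ> (*) 2) n" by simp
  qed
  then have lpos: "l > 0" by (smt (verit) divide_pos_pos ln_gt_zero)
  have "(\<lambda>n. L n / (real n)\<^sup>2) \<longlonglongrightarrow> l"
  proof -
    have "(\<lambda>n. x n * ((real n + 1) / (real n + 2))) \<longlonglongrightarrow> l * 1"
      by (intro tendsto_mult l) real_asymp
    moreover have "x n * ((real n + 1) / (real n + 2)) = L (n + 2) / (real (n + 2))\<^sup>2" for n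
      by (simp add: x_def power2_eq_square add.commute)
    ultimately have "(\<lambda>n. L (n + 2) / (real (n + 2))\<^sup>2) \<longlonglongrightarrow> l" by simp
    then show ?thesis by (rule LIMSEQ_offset)
  qed
  note Llim = this
  have "(\<lambda>n. enat_root (n ^ 2) (connection_rank f n)) \<longlonglongrightarrow> ereal (exp l)"
  proof (rule enat_root_tendsto[where lo = maxprod and hi = "\<lambda>n. card V ^ n * maxprod n" and start = 1])
    have cV: "real (card V) > 0" using V V_nonempty by (simp add: card_gt_0_iff)
    have "(\<lambda>n. exp (L n / (real n)\<^sup>2)) \<longlonglongrightarrow> exp l" by (intro tendsto_intros Llim)
    moreover have "\<forall>\<^sub>F n in sequentially. exp (L n / (real n)\<^sup>2) = root (n ^ 2) (real (maxprod n))"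
      using eventually_ge_at_top[of 1]
      by eventually_elim (use Gpos in \<open>simp add: root_eq_exp L_def\<close>)
    ultimately show "(\<lambda>n. root (n ^ 2) (real (maxprod n))) \<longlonglongrightarrow> exp l" by (rule Lim_transform_eventually)
    have "(\<lambda>n. ln (card V) / real n) \<longlonglongrightarrow> 0" by (rule lim_const_over_n)
    then have "(\<lambda>n. exp (ln (card V) / real n + L n / (real n)\<^sup>2)) \<longlonglongrightarrow> exp (0 + l)"
      by (intro tendsto_intros Llim)
    then have "(\<lambda>n. exp (ln (card V) / real n + L n / (real n)\<^sup>2)) \<longlonglongrightarrow> exp l" by simp
    moreover have "\<forall>\<^sub>F n in sequentially. exp (ln (card V) / real n + L n / (real n)\<^sup>2) =
       root (n ^ 2) (real (card V ^ n * maxprod n))"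
      using eventually_ge_at_top[of 1]
    proof eventually_elim
      case (elim n)
      have "ln (real (card V ^ n * maxprod n)) = n * ln (card V) + L n"
        using cV Gpos[of n] by (simp add: L_def ln_mult ln_realpow)
      then have "ln (real (card V ^ n * maxprod n)) / real (n ^ 2) = ln (card V) / real n + L n / (real n)\<^sup>2"
        using elim by (simp add: add_divide_distrib power2_eq_square)
      moreover have "root (n ^ 2) (real (card V ^ n * maxprod n)) =
         exp (ln (real (card V ^ n * maxprod n)) / real (n ^ 2))"
        using elim cV Gpos[of n] by (intro root_eq_exp) auto
      ultimately show ?case by simp
    qed
    ultimately show "(\<lambda>n. root (n ^ 2) (real (card V ^ n * maxprod n))) \<longlonglongrightarrow> exp l"
      by (rule Lim_transform_eventually)
  qed (use rank_lower rank_upper in auto)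
  then show ?thesis using lpos by (intro exI[of _ "exp l"]) simp
qed

section \<open>Realization of the model by independent random variables\<close>

definition edge_pmf :: "nat \<times> nat \<Rightarrow> real pmf" where
  "edge_pmf p = embed_pmf (\<lambda>b. if b \<in> B then \<pi> {fst p, snd p} b else 0)"

lemma pmf_edge_pmf:
  assumes "i \<in> V" "j \<in> V"
  shows "pmf (edge_pmf (i, j)) b = (if b \<in> B then \<pi> {i, j} b else 0)"
  unfolding edge_pmf_def fst_conv snd_conv
proof (rule pmf_embed_pmf)
  show nn: "0 \<le> (if b \<in> B then \<pi> {i, j} b else 0)" for b using \<pi> assms by simp
  have "(\<integral>\<^sup>+b. ennreal (if b \<in> B then \<pi> {i, j} b else 0) \<partial>count_space UNIV) =
     (\<integral>\<^sup>+b. ennreal (\<pi> {i, j} b) * indicator B b \<partial>count_space UNIV)"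
    by (intro nn_integral_cong) (auto simp: indicator_def)
  also have "\<dots> = (\<integral>\<^sup>+b. ennreal (\<pi> {i, j} b) \<partial>count_space B)"
    by (simp add: nn_integral_count_space_indicator)
  also have "\<dots> = (\<Sum>b\<in>B. ennreal (\<pi> {i, j} b))" using B by (rule nn_integral_count_space_finite)
  also have "\<dots> = ennreal (\<Sum>b\<in>B. \<pi> {i, j} b)" using \<pi> assms by (intro sum_ennreal) auto
  finally show "(\<integral>\<^sup>+b. ennreal (if b \<in> B then \<pi> {i, j} b else 0) \<partial>count_space UNIV) = 1"
    using \<pi>_sum assms by simp
qed

definition cut :: "real \<Rightarrow> real" where "cut x = (if x \<in> B then x else 0)"

definition Pairs :: "(nat \<times> nat) set" where "Pairs = {(i, j). i \<in> V \<and> j \<in> V \<and> i \<le> j}"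

text \<open>The random variables are truncated to \<open>B\<close> only to have finite range everywhere, not just
  almost everywhere.\<close>

definition H :: "(nat \<times> nat \<Rightarrow> real) rwgraph" where
  "H = \<lparr>rnodes = V, rnodeweight = \<alpha>, rspace = measure_pmf (Pi_pmf Pairs 0 edge_pmf),
     redgeweight = \<lambda>i j \<omega>. cut (\<omega> (min i j, max i j))\<rparr>"

lemma finite_Pairs: "finite Pairs"
  by (rule finite_subset[of _ "V \<times> V"]) (use V in \<open>auto simp: Pairs_def\<close>)

lemma min_max_Pairs: "i \<in> V \<Longrightarrow> j \<in> V \<Longrightarrow> (min i j, max i j) \<in> Pairs"
  by (auto simp: Pairs_def min_def max_def)

lemma randomly_weighted_graph_H: "randomly_weighted_graph H"
proof -
  let ?M = "measure_pmf (Pi_pmf Pairs 0 edge_pmf)"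
  have fin: "finite ((\<lambda>\<omega>. cut (\<omega> (min i j, max i j))) ` UNIV)" for i j
    by (rule finite_subset[of _ "insert 0 B"]) (use B in \<open>auto simp: cut_def\<close>)
  have "prob_space.indep_vars ?M (\<lambda>_. count_space UNIV) (\<lambda>x f. f x) Pairs"
    by (rule indep_vars_Pi_pmf[OF finite_Pairs])
  then have "prob_space.indep_vars ?M (\<lambda>_. borel) (\<lambda>x f. cut (f x)) Pairs"
    by (rule prob_space.indep_vars_compose2[OF measure_pmf.prob_space_axioms]) simp
  also have "?this \<longleftrightarrow> prob_space.indep_vars ?M (\<lambda>_. borel)
     (\<lambda>(i, j). \<lambda>\<omega>. cut (\<omega> (min i j, max i j))) Pairs"
    by (rule prob_space.indep_vars_cong[OF measure_pmf.prob_space_axioms])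
       (auto simp: Pairs_def min_def max_def)
  finally show ?thesis
    using V \<alpha> fin measure_pmf.prob_space_axioms[of "Pi_pmf Pairs 0 edge_pmf"]
    unfolding randomly_weighted_graph_def H_def rwgraph.simps
    by (auto simp: less_imp_le min.commute max.commute Pairs_def)
qed

lemma integral_redgeweight:
  assumes ij: "i \<in> V" "j \<in> V"
  shows "(\<integral>\<omega>. redgeweight H i j \<omega> ^ k \<partial>rspace H) = \<mu> {i, j} k"
proof -
  let ?p = "(min i j, max i j)"
  have p: "min i j \<in> V" "max i j \<in> V" "{min i j, max i j} = {i, j}"
    using ij by (auto simp: min_def max_def)
  have "(\<integral>\<omega>. redgeweight H i j \<omega> ^ k \<partial>rspace H) =
     (\<integral>x. cut x ^ k \<partial>measure_pmf (map_pmf (\<lambda>\<omega>. \<omega> ?p) (Pi_pmf Pairs 0 edge_pmf)))"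
    by (simp add: H_def)
  also have "map_pmf (\<lambda>\<omega>. \<omega> ?p) (Pi_pmf Pairs 0 edge_pmf) = edge_pmf ?p"
    unfolding Pi_pmf_component[OF finite_Pairs] using min_max_Pairs[OF ij] by (simp only: if_True)
  also have "(\<integral>x. cut x ^ k \<partial>measure_pmf (edge_pmf ?p)) = (\<Sum>b\<in>B. pmf (edge_pmf ?p) b *\<^sub>R cut b ^ k)"
    using pmf_edge_pmf[OF p(1,2)] by (intro integral_measure_pmf[OF B]) (auto simp: set_pmf_iff split: if_splits)
  also have "\<dots> = \<mu> {i, j} k"
    by (intro sum.cong refl) (simp add: pmf_edge_pmf[OF p(1,2)] p(3) cut_def)
  finally show ?thesis .
qed

lemma f_eq_rhom:
  assumes F: "multigraph F"
  shows "f F = rhom F H"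
proof -
  have HV: "rnodes H = V" "rnodeweight H = \<alpha>" by (simp_all add: H_def)
  show ?thesis
    unfolding model[OF F] edge_hom_def rhom_def HV
  proof (intro sum.cong refl arg_cong2[where f = "(*)"])
    fix \<phi> assume \<phi>: "\<phi> \<in> nodes F \<rightarrow>\<^sub>E V"
    have prob: "measure (rspace H) (space (rspace H)) = 1"
      using measure_pmf.prob_space by (simp add: H_def)
    let ?w = "\<lambda>a b k. \<integral>\<omega>. redgeweight H a b \<omega> ^ k \<partial>rspace H"
    have "(\<Prod>(i, j)\<in>{(i, j). i \<in> nodes F \<and> j \<in> nodes F \<and> i < j}. ?w (\<phi> i) (\<phi> j) (mult F i j)) =
      (\<Prod>e\<in>set_mset (edges F). ?w (Min (\<phi> ` e)) (Max (\<phi> ` e)) (count (edges F) e))"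
      using \<phi> by (intro prod_ordered_pairs_eq_prod_edges[OF F, where V = V])
        (auto simp: integral_redgeweight insert_commute \<pi>_sum prob)
    also have "\<dots> = (\<Prod>e\<in>set_mset (edges F). \<mu> (\<phi> ` e) (count (edges F) e))"
    proof (intro prod.cong refl)
      fix e assume e: "e \<in># edges F"
      obtain i j where ij: "e = {i, j}" "i \<in> nodes F" "j \<in> nodes F"
        using F e by (elim multigraph_edgeE)
      have "\<phi> i \<in> V" "\<phi> j \<in> V" using \<phi> ij by auto
      then have "Min (\<phi> ` e) \<in> V" "Max (\<phi> ` e) \<in> V" "{Min (\<phi> ` e), Max (\<phi> ` e)} = \<phi> ` e"
        using ij by (auto simp: min_def max_def)
      then show "?w (Min (\<phi> ` e)) (Max (\<phi> ` e)) (count (edges F) e) = \<mu> (\<phi> ` e) (count (edges F) e)"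
        by (simp add: integral_redgeweight)
    qed
    finally show "(\<Prod>e\<in>set_mset (edges F). \<mu> (\<phi> ` e) (count (edges F) e)) =
      (\<Prod>(i, j)\<in>{(i, j). i \<in> nodes F \<and> j \<in> nodes F \<and> i < j}. ?w (\<phi> i) (\<phi> j) (mult F i j))" by simp
  qed
qed

lemma proper_H:
  assumes ij: "i \<in> V" "j \<in> V" "card (supp {i, j}) \<ge> 2"
  shows "proper H"
proof -
  obtain x y where xy: "x \<in> supp {i, j}" "y \<in> supp {i, j}" "x \<noteq> y"
    using ij(3) finite_supp[of "{i, j}"] by (metis One_nat_def card_le_Suc0_iff_eq not_less_eq_eq numeral_2_eq_2)
  let ?p = "(min i j, max i j)"
  have p: "min i j \<in> V" "max i j \<in> V" "{min i j, max i j} = {i, j}"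
    using ij by (auto simp: min_def max_def)
  have "measure (rspace H) {\<omega> \<in> space (rspace H). redgeweight H i j \<omega> = z} > 0" if z: "z \<in> supp {i, j}" for z
  proof -
    have "pmf (edge_pmf ?p) z \<noteq> 0" using z by (simp add: pmf_edge_pmf[OF p(1,2)] p(3) supp_def)
    then have "z \<in> set_pmf (edge_pmf ?p)" by (simp add: set_pmf_iff)
    moreover have "cut z = z" using z by (simp add: cut_def supp_def)
    ultimately have "measure (measure_pmf (edge_pmf ?p)) {t. cut t = z} > 0" by (intro measure_pmf_posI) auto
    also have "edge_pmf ?p = map_pmf (\<lambda>\<omega>. \<omega> ?p) (Pi_pmf Pairs 0 edge_pmf)"
      unfolding Pi_pmf_component[OF finite_Pairs] using min_max_Pairs[OF ij(1,2)] by (simp only: if_True)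
    finally show ?thesis by (simp add: H_def vimage_def)
  qed
  note pos = this
  have "rnodes H = V" by (simp add: H_def)
  then show ?thesis unfolding proper_def
    by (intro bexI[of _ i] bexI[of _ j] exI[of _ x] exI[of _ y] conjI xy(3) pos xy(1,2))
      (simp_all only: ij(1,2))
qed

end

section \<open>The trichotomy\<close>

theorem theorem3p10:
  fixes f :: "mgraph \<Rightarrow> real"
  assumes "graph_parameter f"
    and "weakly_reflection_positive f"
    and "multiplicative f"
    and "\<exists>F. multigraph F \<and> f F \<noteq> 0"
  shows "(\<forall>n\<ge>2. connection_rank f n = \<infinity>)
    \<or> (\<exists>c::real. c \<ge> 1
         \<and> (\<lambda>n. enat_root n (connection_rank f n)) \<longlonglongrightarrow> ereal c
         \<and> (\<exists>H::wgraph. weighted_graph H \<and> (\<forall>F. multigraph F \<longrightarrow> f F = hom F H)))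
    \<or> (\<exists>c::real. c > 1
         \<and> (\<lambda>n. enat_root (n ^ 2) (connection_rank f n)) \<longlonglongrightarrow> ereal c
         \<and> (\<exists>H::(nat \<times> nat \<Rightarrow> real) rwgraph. randomly_weighted_graph H \<and> proper H
              \<and> (\<forall>F. multigraph F \<longrightarrow> f F = rhom F H)))"
proof (cases "\<forall>n\<ge>2. connection_rank f n = \<infinity>")
  case True
  then show ?thesis by blast
next
  case False
  then obtain n where n: "n \<ge> 2" "connection_rank f n \<noteq> \<infinity>" by blast
  interpret reflection_positive_parameter f by unfold_locales (fact assms)+
  obtain V \<alpha> \<pi> B where m: "finite V" "finite B" "\<forall>i\<in>V. \<alpha> i > 0"
    "\<forall>i\<in>V. \<forall>j\<in>V. \<forall>b\<in>B. \<pi> {i, j} b \<ge> 0"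
    "\<forall>i\<in>V. \<forall>j\<in>V. (\<Sum>b\<in>B. \<pi> {i, j} b) = 1"
    "\<forall>F. multigraph F \<longrightarrow> f F = edge_hom V \<alpha> (\<lambda>A k. \<Sum>b\<in>B. \<pi> A b * b ^ k) F"
    using finite_rank_imp_model[OF n] by (elim exE conjE) (rule that; assumption)
  interpret random_model f V \<alpha> \<pi> B
    by (rule random_model.intro) (use m assms(4) in \<open>simp_all only:\<close>)
  show ?thesis
  \<comment> \<open>Either all edge distributions are concentrated on one value, which gives an
    ordinary weighted graph, or some support has at least two elements, which makes the model proper
    and the growth exponent quadratic.\<close>
  proof (cases "\<forall>i\<in>V. \<forall>j\<in>V. card (supp {i, j}) = 1")
    case True
    then have det: "\<And>i j. i \<in> V \<Longrightarrow> j \<in> V \<Longrightarrow> card (supp {i, j}) = 1" by blast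
    let ?H = "\<lparr>wnodes = V, nodeweight = \<alpha>, edgeweight = \<lambda>i j. det_weight {i, j}\<rparr>"
    have "weighted_graph ?H"
      using V \<alpha> by (simp add: weighted_graph_def insert_commute)
    then show ?thesis using rank_growth_det[OF det] f_eq_hom[OF det] by blast
  next
    case False
    then obtain i j where ij: "i \<in> V" "j \<in> V" "card (supp {i, j}) \<noteq> 1" by blast
    then have "card (supp {i, j}) \<ge> 2" using card_supp_pos[of i j] by simp
    note ij = ij(1,2) this
    show ?thesis
      using rank_growth_random[OF ij] randomly_weighted_graph_H proper_H[OF ij] f_eq_rhom by blast
  qed
qed

end
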